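(* Let $n\ge 1$ and let $g$ be the Semi-Riemannian metric on $GL_n=GL_n(\mathbb{R})$ given by $g_A(V,W)=\mathrm{tr}(A^{-1}VA^{-1}W)$ for $A\in GL_n$, $V,W\in T_A(GL_n)=M_n(\mathbb{R})$. For $c\in\mathbb{R}\setminus\{0\}$ put $SL_n(c)=\{M\in GL_n:\det(M)=c\}$, endowed with the restriction of $g$. Then $GL_n=\bigcup_{c\neq0}SL_n(c)$ is a foliation of $GL_n$, whose leaves $SL_n(c)$ are totally geodesic Semi-Riemannian submanifolds with respect to the metric $g$ of $GL_n$. The leaves are Einstein, symmetric, geodesically complete, mutually isometric Semi-Riemannian hypersurfaces with signature $\left(\frac{n(n+1)}{2}-1,\frac{n(n-1)}{2}\right)$ and with scalar curvature $S=-\frac{(n-1)n(n+1)}{2}$. A curve $P=P(t)$ is a geodesic of $(SL_n(c),g)$ if and only if $P(t)=Ke^{tC}$ with $K,C\in M_n(\mathbb{R})$, $\det(K)=c$ and $\mathrm{tr}(C)=0$.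
   Context: The signature $(p,q)$ lists first the index of positivity and then the index of negativity. A Semi-Riemannian manifold is Einstein if its Ricci tensor is a (constant) multiple of the metric. A Semi-Riemannian (globally) symmetric space is a connected Semi-Riemannian manifold $M$ such that for each $p\in M$ there is an isometry of $M$ fixing $p$ with differential $-\mathrm{id}$ on $T_pM$. Sign conventions: with $\nabla$ the Levi-Civita connection, $R_{XY}Z=\nabla_{[X,Y]}Z-\nabla_X\nabla_YZ+\nabla_Y\nabla_XZ$; $Ric(X,Y)$ is the trace of $Z\mapsto R_{XZ}Y$; the scalar curvature is the trace of $Ric$ with respect to the metric. Geodesics are understood as maximal ones, and constant curves are regarded as geodesics. *)

theory Defs
  imports "HOL-Analysis.Analysis"
begin

text \<open>
  Manifolds are embedded submanifolds of a Euclidean space \<open>'a\<close>, given as subsets of \<open>'a\<close>.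
  Tangent vectors at a point are elements of \<open>'a\<close>. Functions on a manifold (vector fields,
  metrics, maps) are total functions on \<open>'a\<close>; only their values on the manifold matter.
\<close>

subsection \<open>Smooth functions\<close>

text \<open>\<open>Ck_on k S f\<close> is meant for open \<open>S\<close> and finite-dimensional domains only: there,
  differentiability together with \<open>C\<^sup>k\<close> directional derivatives is \<open>C\<^sup>k\<^sup>+\<^sup>1\<close>.\<close>

primrec Ck_on ::
    "nat \<Rightarrow> 'a::euclidean_space set \<Rightarrow> ('a \<Rightarrow> 'b::real_normed_vector) \<Rightarrow> bool" where
  "Ck_on 0 S f = continuous_on S f"
| "Ck_on (Suc k) S f =
    ((\<forall>x\<in>S. f differentiable (at x)) \<and> (\<forall>v. Ck_on k S (\<lambda>x. frechet_derivative f (at x) v)))"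

definition smooth_on ::
    "'a::euclidean_space set \<Rightarrow> ('a \<Rightarrow> 'b::real_normed_vector) \<Rightarrow> bool" where
  "smooth_on S f \<longleftrightarrow> (\<forall>k. Ck_on k S f)"

definition smooth_map ::
    "'a::euclidean_space set \<Rightarrow> ('a \<Rightarrow> 'b::real_normed_vector) \<Rightarrow> bool" where
  "smooth_map M f \<longleftrightarrow>
    (\<forall>p\<in>M. \<exists>U F. open U \<and> p \<in> U \<and> smooth_on U F \<and> (\<forall>q\<in>U \<inter> M. F q = f q))"

definition diffeomorphism ::
    "'a::euclidean_space set \<Rightarrow> 'b::euclidean_space set \<Rightarrow> ('a \<Rightarrow> 'b) \<Rightarrow> bool" where
  "diffeomorphism M N f \<longleftrightarrow> smooth_map M f \<and> f ` M = N \<and>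
    (\<exists>h. smooth_map N h \<and> (\<forall>p\<in>M. h (f p) = p))"

subsection \<open>Submanifolds, tangent spaces, foliations\<close>

definition slice_chart ::
    "'a::euclidean_space set \<Rightarrow> 'a set \<Rightarrow> ('a \<Rightarrow> 'a) \<Rightarrow> 'a set \<Rightarrow> bool" where
  "slice_chart M U \<phi> F \<longleftrightarrow> open U \<and> open (\<phi> ` U) \<and> diffeomorphism U (\<phi> ` U) \<phi> \<and>
    subspace F \<and> \<phi> ` (U \<inter> M) = \<phi> ` U \<inter> F"

definition manifold :: "nat \<Rightarrow> 'a::euclidean_space set \<Rightarrow> bool" where
  "manifold m M \<longleftrightarrow> (\<forall>p\<in>M. \<exists>U \<phi> F. p \<in> U \<and> slice_chart M U \<phi> F \<and> dim F = m)"

definition curves_through ::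
    "'a::euclidean_space set \<Rightarrow> 'a \<Rightarrow> 'a \<Rightarrow> (real \<Rightarrow> 'a) set" where
  "curves_through M p v = {\<gamma>. \<exists>e>0. smooth_on {-e<..<e} \<gamma> \<and> \<gamma> ` {-e<..<e} \<subseteq> M \<and>
    \<gamma> 0 = p \<and> (\<gamma> has_vector_derivative v) (at 0)}"

definition tangent_space :: "'a::euclidean_space set \<Rightarrow> 'a \<Rightarrow> 'a set" where
  "tangent_space M p = {v. curves_through M p v \<noteq> {}}"

definition differential ::
    "'a::euclidean_space set \<Rightarrow> ('a \<Rightarrow> 'b::real_normed_vector) \<Rightarrow> 'a \<Rightarrow> 'a \<Rightarrow> 'b" where
  "differential M f p v =
    (THE w. \<forall>\<gamma>\<in>curves_through M p v. ((\<lambda>t. f (\<gamma> t)) has_vector_derivative w) (at 0))"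

text \<open>The leaves are decomposed by charts of \<open>N\<close> into parallel \<open>k\<close>-dimensional plaques.
  A leaf need not be embedded and is to be connected in its own manifold topology; since it meets
  a chart in plaques that are components, this is expressed by path-connectedness, whereas
  connectedness in the subspace topology would also admit unions of several dense leaves.\<close>

definition foliation :: "'a::euclidean_space set \<Rightarrow> nat \<Rightarrow> 'a set set \<Rightarrow> bool" where
  "foliation N k \<L> \<longleftrightarrow>
    (\<exists>m. manifold m N) \<and> \<Union>\<L> = N \<and> pairwise disjnt \<L> \<and>
    (\<forall>L\<in>\<L>. L \<noteq> {} \<and> path_connected L) \<and>
    (\<forall>p\<in>N. \<exists>U \<phi> F E. p \<in> U \<and> slice_chart N U \<phi> F \<and> subspace E \<and> E \<subseteq> F \<and> dim E = k \<and>
      (\<forall>L\<in>\<L>. \<forall>C\<in>components (U \<inter> L). \<exists>v. C = {q \<in> U \<inter> N. \<phi> q - v \<in> E}))"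

subsection \<open>Vector fields and metrics\<close>

definition vector_fields :: "'a::euclidean_space set \<Rightarrow> ('a \<Rightarrow> 'a) set" where
  "vector_fields M = {X. smooth_map M X \<and> (\<forall>p\<in>M. X p \<in> tangent_space M p)}"

text \<open>Vector fields are \<open>'a\<close>-valued functions on \<open>M\<close>, so this is the coordinate formula for
  \<open>[X, Y] f = X (Y f) - Y (X f)\<close> in the coordinates of the surrounding space.\<close>

definition lie_bracket ::
    "'a::euclidean_space set \<Rightarrow> ('a \<Rightarrow> 'a) \<Rightarrow> ('a \<Rightarrow> 'a) \<Rightarrow> 'a \<Rightarrow> 'a" where
  "lie_bracket M X Y p = differential M Y p (X p) - differential M X p (Y p)"

type_synonym 'a metric = "'a \<Rightarrow> 'a \<Rightarrow> 'a \<Rightarrow> real"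

definition pos_index :: "('a::euclidean_space \<Rightarrow> 'a \<Rightarrow> real) \<Rightarrow> 'a set \<Rightarrow> nat" where
  "pos_index \<beta> V = Max {dim W | W. subspace W \<and> W \<subseteq> V \<and> (\<forall>w\<in>W - {0}. \<beta> w w > 0)}"

definition neg_index :: "('a::euclidean_space \<Rightarrow> 'a \<Rightarrow> real) \<Rightarrow> 'a set \<Rightarrow> nat" where
  "neg_index \<beta> V = Max {dim W | W. subspace W \<and> W \<subseteq> V \<and> (\<forall>w\<in>W - {0}. \<beta> w w < 0)}"

definition has_signature :: "'a::euclidean_space set \<Rightarrow> 'a metric \<Rightarrow> nat \<times> nat \<Rightarrow> bool" where
  "has_signature M g s \<longleftrightarrow>
    (\<forall>p\<in>M. (pos_index (g p) (tangent_space M p), neg_index (g p) (tangent_space M p)) = s)"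

text \<open>\<open>g p\<close> is constrained on the tangent space at \<open>p \<in> M\<close> only, so the restriction of a metric
  to a submanifold is denoted by the same \<open>g\<close>.\<close>

definition semi_riemannian_metric :: "'a::euclidean_space set \<Rightarrow> 'a metric \<Rightarrow> bool" where
  "semi_riemannian_metric M g \<longleftrightarrow>
    (\<forall>p\<in>M. \<forall>x\<in>tangent_space M p. \<forall>y\<in>tangent_space M p. \<forall>z\<in>tangent_space M p. \<forall>a b.
       g p (a *\<^sub>R x + b *\<^sub>R y) z = a * g p x z + b * g p y z) \<and>
    (\<forall>p\<in>M. \<forall>x\<in>tangent_space M p. \<forall>y\<in>tangent_space M p. g p x y = g p y x) \<and>
    (\<forall>p\<in>M. \<forall>x\<in>tangent_space M p. (\<forall>y\<in>tangent_space M p. g p x y = 0) \<longrightarrow> x = 0) \<and>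
    (\<forall>X\<in>vector_fields M. \<forall>Y\<in>vector_fields M. smooth_map M (\<lambda>p. g p (X p) (Y p))) \<and>
    (\<exists>s. has_signature M g s)"

definition semi_riemannian_manifold :: "'a::euclidean_space set \<Rightarrow> 'a metric \<Rightarrow> bool" where
  "semi_riemannian_manifold M g \<longleftrightarrow> (\<exists>m. manifold m M) \<and> semi_riemannian_metric M g"

definition semi_riemannian_submanifold ::
    "'a::euclidean_space set \<Rightarrow> 'a metric \<Rightarrow> 'a set \<Rightarrow> bool" where
  "semi_riemannian_submanifold N g M \<longleftrightarrow>
    semi_riemannian_manifold N g \<and> M \<subseteq> N \<and> semi_riemannian_manifold M g"

definition semi_riemannian_hypersurface ::
    "'a::euclidean_space set \<Rightarrow> 'a metric \<Rightarrow> 'a set \<Rightarrow> bool" where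
  "semi_riemannian_hypersurface N g M \<longleftrightarrow>
    semi_riemannian_submanifold N g M \<and> (\<exists>m. manifold (Suc m) N \<and> manifold m M)"

definition isometry ::
    "'a::euclidean_space set \<Rightarrow> 'a metric \<Rightarrow> 'b::euclidean_space set \<Rightarrow> 'b metric \<Rightarrow>
     ('a \<Rightarrow> 'b) \<Rightarrow> bool" where
  "isometry M g N h f \<longleftrightarrow> diffeomorphism M N f \<and>
    (\<forall>p\<in>M. \<forall>x\<in>tangent_space M p. \<forall>y\<in>tangent_space M p.
       h (f p) (differential M f p x) (differential M f p y) = g p x y)"

definition isometric ::
    "'a::euclidean_space set \<Rightarrow> 'a metric \<Rightarrow> 'b::euclidean_space set \<Rightarrow> 'b metric \<Rightarrow> bool" where
  "isometric M g N h \<longleftrightarrow> (\<exists>f. isometry M g N h f)"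

definition symmetric_space :: "'a::euclidean_space set \<Rightarrow> 'a metric \<Rightarrow> bool" where
  "symmetric_space M g \<longleftrightarrow> semi_riemannian_manifold M g \<and> connected M \<and>
    (\<forall>p\<in>M. \<exists>f. isometry M g M g f \<and> f p = p \<and>
       (\<forall>v\<in>tangent_space M p. differential M f p v = - v))"

subsection \<open>Levi-Civita connection and curvature\<close>

definition is_levi_civita ::
    "'a::euclidean_space set \<Rightarrow> 'a metric \<Rightarrow> (('a \<Rightarrow> 'a) \<Rightarrow> ('a \<Rightarrow> 'a) \<Rightarrow> 'a \<Rightarrow> 'a) \<Rightarrow> bool" where
  "is_levi_civita M g D \<longleftrightarrow>
    (\<forall>X\<in>vector_fields M. \<forall>Y\<in>vector_fields M. D X Y \<in> vector_fields M) \<and>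
    (\<forall>X\<in>vector_fields M. \<forall>X'\<in>vector_fields M. \<forall>Y\<in>vector_fields M.
       \<forall>f h :: 'a \<Rightarrow> real. smooth_map M f \<and> smooth_map M h \<longrightarrow>
       (\<forall>p\<in>M. D (\<lambda>q. f q *\<^sub>R X q + h q *\<^sub>R X' q) Y p = f p *\<^sub>R D X Y p + h p *\<^sub>R D X' Y p)) \<and>
    (\<forall>X\<in>vector_fields M. \<forall>Y\<in>vector_fields M. \<forall>Y'\<in>vector_fields M. \<forall>a b :: real. \<forall>p\<in>M.
       D X (\<lambda>q. a *\<^sub>R Y q + b *\<^sub>R Y' q) p = a *\<^sub>R D X Y p + b *\<^sub>R D X Y' p) \<and>
    (\<forall>X\<in>vector_fields M. \<forall>Y\<in>vector_fields M. \<forall>f :: 'a \<Rightarrow> real. smooth_map M f \<longrightarrow>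
       (\<forall>p\<in>M. D X (\<lambda>q. f q *\<^sub>R Y q) p = differential M f p (X p) *\<^sub>R Y p + f p *\<^sub>R D X Y p)) \<and>
    (\<forall>X\<in>vector_fields M. \<forall>Y\<in>vector_fields M. \<forall>p\<in>M.
       lie_bracket M X Y p = D X Y p - D Y X p) \<and>
    (\<forall>X\<in>vector_fields M. \<forall>Y\<in>vector_fields M. \<forall>Z\<in>vector_fields M. \<forall>p\<in>M.
       differential M (\<lambda>q. g q (Y q) (Z q)) p (X p) = g p (D X Y p) (Z p) + g p (Y p) (D X Z p))"

text \<open>Unique only as far as values at points of \<open>M\<close> are concerned.\<close>

definition levi_civita ::
    "'a::euclidean_space set \<Rightarrow> 'a metric \<Rightarrow> ('a \<Rightarrow> 'a) \<Rightarrow> ('a \<Rightarrow> 'a) \<Rightarrow> 'a \<Rightarrow> 'a" where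
  "levi_civita M g = (SOME D. is_levi_civita M g D)"

definition curvature_field ::
    "'a::euclidean_space set \<Rightarrow> 'a metric \<Rightarrow> ('a \<Rightarrow> 'a) \<Rightarrow> ('a \<Rightarrow> 'a) \<Rightarrow> ('a \<Rightarrow> 'a) \<Rightarrow> 'a \<Rightarrow> 'a" where
  "curvature_field M g X Y Z p =
    (let D = levi_civita M g in D (lie_bracket M X Y) Z p - D X (D Y Z) p + D Y (D X Z) p)"

definition curvature ::
    "'a::euclidean_space set \<Rightarrow> 'a metric \<Rightarrow> 'a \<Rightarrow> 'a \<Rightarrow> 'a \<Rightarrow> 'a \<Rightarrow> 'a" where
  "curvature M g p x y z =
    (THE w. \<forall>X\<in>vector_fields M. \<forall>Y\<in>vector_fields M. \<forall>Z\<in>vector_fields M.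
       X p = x \<and> Y p = y \<and> Z p = z \<longrightarrow> curvature_field M g X Y Z p = w)"

definition trace_on :: "'a::euclidean_space set \<Rightarrow> ('a \<Rightarrow> 'a) \<Rightarrow> real" where
  "trace_on V L =
    (let B = (SOME B. independent B \<and> span B = V) in \<Sum>b\<in>B. representation B (L b) b)"

definition ricci :: "'a::euclidean_space set \<Rightarrow> 'a metric \<Rightarrow> 'a \<Rightarrow> 'a \<Rightarrow> 'a \<Rightarrow> real" where
  "ricci M g p x y = trace_on (tangent_space M p) (\<lambda>z. curvature M g p x z y)"

text \<open>The trace of a bilinear form with respect to \<open>\<beta>\<close> is the trace of the endomorphism that
  represents it via \<open>\<beta>\<close>.\<close>

definition form_trace ::
    "('a::euclidean_space \<Rightarrow> 'a \<Rightarrow> real) \<Rightarrow> 'a set \<Rightarrow> ('a \<Rightarrow> 'a \<Rightarrow> real) \<Rightarrow> real" where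
  "form_trace \<beta> V h = trace_on V (\<lambda>x. THE z. z \<in> V \<and> (\<forall>y\<in>V. \<beta> z y = h x y))"

definition scalar_curvature :: "'a::euclidean_space set \<Rightarrow> 'a metric \<Rightarrow> 'a \<Rightarrow> real" where
  "scalar_curvature M g p = form_trace (g p) (tangent_space M p) (ricci M g p)"

definition einstein :: "'a::euclidean_space set \<Rightarrow> 'a metric \<Rightarrow> bool" where
  "einstein M g \<longleftrightarrow> semi_riemannian_manifold M g \<and>
    (\<exists>c. \<forall>p\<in>M. \<forall>x\<in>tangent_space M p. \<forall>y\<in>tangent_space M p. ricci M g p x y = c * g p x y)"

subsection \<open>Totally geodesic submanifolds\<close>

definition normal_part ::
    "'a::euclidean_space set \<Rightarrow> 'a metric \<Rightarrow> 'a set \<Rightarrow> 'a \<Rightarrow> 'a \<Rightarrow> 'a" where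
  "normal_part N g M p v = (THE w. w \<in> tangent_space N p \<and>
    (\<forall>u\<in>tangent_space M p. g p w u = 0) \<and> v - w \<in> tangent_space M p)"

text \<open>The shape tensor (second fundamental form) \<open>II(x, y) = nor (D X Y)\<close>, with \<open>D\<close> the
  connection of the surrounding \<open>N\<close> and \<open>X, Y\<close> fields on \<open>N\<close> tangent to \<open>M\<close> along \<open>M\<close>
  that extend \<open>x, y\<close>.\<close>

definition shape_tensor ::
    "'a::euclidean_space set \<Rightarrow> 'a metric \<Rightarrow> 'a set \<Rightarrow> 'a \<Rightarrow> 'a \<Rightarrow> 'a \<Rightarrow> 'a" where
  "shape_tensor N g M p x y =
    (THE w. \<forall>X\<in>vector_fields N. \<forall>Y\<in>vector_fields N.
       (\<forall>q\<in>M. X q \<in> tangent_space M q \<and> Y q \<in> tangent_space M q) \<and> X p = x \<and> Y p = y \<longrightarrow>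
       normal_part N g M p (levi_civita N g X Y p) = w)"

definition totally_geodesic ::
    "'a::euclidean_space set \<Rightarrow> 'a metric \<Rightarrow> 'a set \<Rightarrow> bool" where
  "totally_geodesic N g M \<longleftrightarrow> semi_riemannian_submanifold N g M \<and>
    (\<forall>p\<in>M. \<forall>x\<in>tangent_space M p. \<forall>y\<in>tangent_space M p. shape_tensor N g M p x y = 0)"

subsection \<open>Geodesics\<close>

definition fields_along ::
    "'a::euclidean_space set \<Rightarrow> real set \<Rightarrow> (real \<Rightarrow> 'a) \<Rightarrow> (real \<Rightarrow> 'a) set" where
  "fields_along M I \<gamma> = {Z. smooth_on I Z \<and> (\<forall>t\<in>I. Z t \<in> tangent_space M (\<gamma> t))}"

definition is_covariant_derivative ::
    "'a::euclidean_space set \<Rightarrow> 'a metric \<Rightarrow> real set \<Rightarrow> (real \<Rightarrow> 'a) \<Rightarrow>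
     ((real \<Rightarrow> 'a) \<Rightarrow> real \<Rightarrow> 'a) \<Rightarrow> bool" where
  "is_covariant_derivative M g I \<gamma> C \<longleftrightarrow>
    (\<forall>Z\<in>fields_along M I \<gamma>. C Z \<in> fields_along M I \<gamma>) \<and>
    (\<forall>Z\<in>fields_along M I \<gamma>. \<forall>Z'\<in>fields_along M I \<gamma>. \<forall>a b :: real. \<forall>t\<in>I.
       C (\<lambda>s. a *\<^sub>R Z s + b *\<^sub>R Z' s) t = a *\<^sub>R C Z t + b *\<^sub>R C Z' t) \<and>
    (\<forall>Z\<in>fields_along M I \<gamma>. \<forall>h :: real \<Rightarrow> real. smooth_on I h \<longrightarrow>
       (\<forall>t\<in>I. C (\<lambda>s. h s *\<^sub>R Z s) t = deriv h t *\<^sub>R Z t + h t *\<^sub>R C Z t)) \<and>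
    (\<forall>V\<in>vector_fields M. \<forall>X\<in>vector_fields M. \<forall>t\<in>I. X (\<gamma> t) = vector_derivative \<gamma> (at t) \<longrightarrow>
       C (\<lambda>s. V (\<gamma> s)) t = levi_civita M g X V (\<gamma> t))"

text \<open>Unique only as far as values at parameters in \<open>I\<close> are concerned.\<close>

definition covariant_derivative ::
    "'a::euclidean_space set \<Rightarrow> 'a metric \<Rightarrow> real set \<Rightarrow> (real \<Rightarrow> 'a) \<Rightarrow>
     (real \<Rightarrow> 'a) \<Rightarrow> real \<Rightarrow> 'a" where
  "covariant_derivative M g I \<gamma> = (SOME C. is_covariant_derivative M g I \<gamma> C)"

definition geodesic_on ::
    "'a::euclidean_space set \<Rightarrow> 'a metric \<Rightarrow> real set \<Rightarrow> (real \<Rightarrow> 'a) \<Rightarrow> bool" where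
  "geodesic_on M g I \<gamma> \<longleftrightarrow> open I \<and> is_interval I \<and> I \<noteq> {} \<and> smooth_on I \<gamma> \<and> \<gamma> ` I \<subseteq> M \<and>
    (\<forall>t\<in>I. covariant_derivative M g I \<gamma> (\<lambda>s. vector_derivative \<gamma> (at s)) t = 0)"

definition maximal_geodesic ::
    "'a::euclidean_space set \<Rightarrow> 'a metric \<Rightarrow> real set \<Rightarrow> (real \<Rightarrow> 'a) \<Rightarrow> bool" where
  "maximal_geodesic M g I \<gamma> \<longleftrightarrow> geodesic_on M g I \<gamma> \<and>
    (\<forall>J \<delta>. geodesic_on M g J \<delta> \<and> I \<subseteq> J \<and> (\<forall>t\<in>I. \<delta> t = \<gamma> t) \<longrightarrow> J = I)"

definition geodesically_complete :: "'a::euclidean_space set \<Rightarrow> 'a metric \<Rightarrow> bool" where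
  "geodesically_complete M g \<longleftrightarrow> (\<forall>I \<gamma>. maximal_geodesic M g I \<gamma> \<longrightarrow> I = UNIV)"

subsection \<open>The general linear group with the trace metric\<close>

definition GL :: "(real^'n^'n) set" where
  "GL = {A. invertible A}"

definition SL :: "real \<Rightarrow> (real^'n^'n) set" where
  "SL c = {A \<in> GL. det A = c}"

definition trace_metric :: "(real^'n^'n) metric" where
  "trace_metric A V W = trace (matrix_inv A ** V ** matrix_inv A ** W)"

definition matrix_exp :: "real^'n^'n \<Rightarrow> real^'n^'n" where
  "matrix_exp A = (\<Sum>k. (1 / fact k) *\<^sub>R (((**) A ^^ k) (mat 1)))"

end

theory Submission
  imports Defs
begin

text \<open>
  Write vector fields on \<open>GL\<close> or on a leaf as \<open>X p = p \<xi>(p)\<close>. Left multiplication is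
  isometric and the trace form is ad-invariant, so the Levi-Civita connection is that of a
  bi-invariant metric: \<open>\<nabla>\<^sub>X Y = p (X \<eta> + [\<xi>, \<eta>] / 2)\<close>. It follows that the curvature is
  \<open>p [[\<xi>, \<eta>], \<zeta>] / 4\<close>, that the Ricci form is a multiple of the Killing form, which on traceless
  matrices is a multiple of the trace form, and that a curve \<open>P\<close> is a geodesic iff
  \<open>P\<inverse> P'\<close> is constant. The leaves are totally geodesic since \<open>X \<eta>\<close> and \<open>[\<xi>, \<eta>]\<close> remain
  traceless, \<open>X \<mapsto> p X\<inverse> p\<close> is the geodesic symmetry at \<open>p\<close>, and left multiplication by a
  matrix of determinant \<open>d / c\<close> carries \<open>SL c\<close> to \<open>SL d\<close>.
\<close>

subsection \<open>Calculus of smooth functions\<close>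

text \<open>Differential, connection, curvature, trace and covariant derivative are all selected by
  \<open>SOME\<close> or \<open>THE\<close>, and fields are total functions of which only the values
  on the manifold count. So each notion needs an explicit witness and a uniqueness proof at points
  of the manifold, and identities are transported by congruence on the manifold. Left trivialisation
  keeps this manageable: every tangent vector extends to a global left-invariant field, so local
  frames, cut-off functions and Christoffel symbols never occur, and a vector field becomes a
  matrix-valued function subject to one trace condition. Traces and dimensions are computed with the
  unit matrices projected to the tangent space. These may be linearly dependent, but their
  coefficient functionals are plain matrix entries. The one global ingredient is the connectedness
  of a leaf, which rests on the factorisation into elementary matrices.\<close>

abbreviation fderiv :: "('a::real_normed_vector \<Rightarrow> 'b::real_normed_vector) \<Rightarrow> 'a \<Rightarrow> 'a \<Rightarrow> 'b" where
  "fderiv f x \<equiv> frechet_derivative f (at x)"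

lemma Ck_on_subset: "Ck_on k S f \<Longrightarrow> T \<subseteq> S \<Longrightarrow> Ck_on k T f"
  by (induction k arbitrary: f) (auto intro: continuous_on_subset)

lemma frechet_derivative_cong_open:
  assumes "open S" "x \<in> S" "\<And>y. y \<in> S \<Longrightarrow> f y = g y"
  shows "fderiv f x = fderiv g x"
proof -
  have "(f has_derivative f') (at x) \<longleftrightarrow> (g has_derivative f') (at x)" for f'
    using has_derivative_transform_within_open[of f f' x UNIV S g]
      has_derivative_transform_within_open[of g f' x UNIV S f] assms by auto
  then show ?thesis
    by (simp add: frechet_derivative_def)
qed

lemma Ck_on_cong:
  assumes "open S" "\<And>x. x \<in> S \<Longrightarrow> f x = g x" "Ck_on k S f"
  shows "Ck_on k S g"
  using assms(2,3)
proof (induction k arbitrary: f g)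
  case 0
  then show ?case
    using continuous_on_cong[of S S f g] by simp
next
  case (Suc k)
  have "g differentiable at x" if "x \<in> S" for x
  proof -
    have "f differentiable at x"
      using Suc.prems that by simp
    then obtain D where "(f has_derivative D) (at x)"
      unfolding differentiable_def by blast
    from has_derivative_transform_within_open[OF this \<open>open S\<close> that] Suc.prems(1) show ?thesis
      unfolding differentiable_def by blast
  qed
  moreover have "Ck_on k S (\<lambda>x. fderiv g x v)" for v
  proof (rule Suc.IH)
    show "Ck_on k S (\<lambda>x. fderiv f x v)"
      using Suc.prems by simp
    show "fderiv f x v = fderiv g x v" if "x \<in> S" for x
      using frechet_derivative_cong_open[OF \<open>open S\<close> that Suc.prems(1)] by simp
  qed
  ultimately show ?case
    by simp
qed

text \<open>The definition speaks of \<open>frechet_derivative\<close>; this form accepts an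
  explicitly known derivative, which is what the closure rules below produce.\<close>

lemma Ck_on_SucI:
  assumes "open S" "\<And>x. x \<in> S \<Longrightarrow> (f has_derivative f' x) (at x)"
    and "\<And>v. Ck_on k S (\<lambda>x. f' x v)"
  shows "Ck_on (Suc k) S f"
proof -
  have "Ck_on k S (\<lambda>x. fderiv f x v)" for v
    by (rule Ck_on_cong[OF \<open>open S\<close> _ assms(3)]) (simp add: frechet_derivative_at[OF assms(2)])
  then show ?thesis
    using assms(2) by (auto simp: differentiable_def)
qed

lemma Ck_on_SucD:
  assumes "Ck_on (Suc k) S f"
  shows "x \<in> S \<Longrightarrow> (f has_derivative fderiv f x) (at x)"
    and "Ck_on k S (\<lambda>x. fderiv f x v)"
  using assms frechet_derivative_works by auto

lemma Ck_on_Suc_imp: "Ck_on (Suc k) S f \<Longrightarrow> Ck_on k S f"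
proof (induction k arbitrary: f)
  case 0
  then show ?case
    by (auto intro!: continuous_at_imp_continuous_on differentiable_imp_continuous_within)
next
  case (Suc k)
  from Suc.prems have "\<forall>x\<in>S. f differentiable (at x)"
    by simp
  moreover have "Ck_on k S (\<lambda>x. fderiv f x v)" for v
    by (rule Suc.IH, rule Ck_on_SucD(2)[OF Suc.prems])
  ultimately show ?case
    by simp
qed

lemma Ck_on_local:
  assumes "\<And>x. x \<in> S \<Longrightarrow> \<exists>U. open U \<and> x \<in> U \<and> Ck_on k U f"
  shows "Ck_on k S f"
  using assms
proof (induction k arbitrary: f)
  case 0
  have "continuous (at x within S) f" if "x \<in> S" for x
  proof -
    obtain U where "open U" "x \<in> U" "continuous_on U f"
      using 0[OF \<open>x \<in> S\<close>] by auto
    then show ?thesis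
      using continuous_at_imp_continuous_at_within continuous_on_eq_continuous_at by blast
  qed
  then show ?case
    by (simp add: continuous_on_eq_continuous_within)
next
  case (Suc k)
  have "f differentiable at x" if "x \<in> S" for x
    using Suc.prems[OF that] by auto
  moreover have "Ck_on k S (\<lambda>x. fderiv f x v)" for v
  proof (rule Suc.IH)
    fix x assume "x \<in> S"
    from Suc.prems[OF this] obtain U where "open U" "x \<in> U" "Ck_on (Suc k) U f"
      by blast
    then show "\<exists>U. open U \<and> x \<in> U \<and> Ck_on k U (\<lambda>x. fderiv f x v)"
      using Ck_on_SucD(2) by blast
  qed
  ultimately show ?case
    by simp
qed

lemma Ck_on_const: "open S \<Longrightarrow> Ck_on k S (\<lambda>x. c)"
proof (induction k arbitrary: c)
  case (Suc k)
  show ?case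
    by (rule Ck_on_SucI[where f' = "\<lambda>x v. 0"]) (use Suc in auto)
qed simp

lemma Ck_on_bounded_linear:
  assumes "open S" "bounded_linear L"
  shows "Ck_on k S L"
proof (cases k)
  case 0
  then show ?thesis
    using assms linear_continuous_on by auto
next
  case (Suc m)
  show ?thesis
    unfolding Suc
    by (rule Ck_on_SucI[where f' = "\<lambda>x. L"])
       (use assms bounded_linear_imp_has_derivative Ck_on_const in auto)
qed

lemma Ck_on_add:
  assumes "open S" "Ck_on k S f" "Ck_on k S g"
  shows "Ck_on k S (\<lambda>x. f x + g x)"
  using assms(2,3)
proof (induction k arbitrary: f g)
  case 0
  then show ?case
    by (simp add: continuous_on_add)
next
  case (Suc k)
  show ?case
  proof (rule Ck_on_SucI[OF \<open>open S\<close>])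
    show "((\<lambda>x. f x + g x) has_derivative
        (\<lambda>v. fderiv f x v + fderiv g x v)) (at x)" if "x \<in> S" for x
      by (intro has_derivative_add Ck_on_SucD(1)[OF Suc.prems(1)] Ck_on_SucD(1)[OF Suc.prems(2)] that)
    show "Ck_on k S (\<lambda>x. fderiv f x v + fderiv g x v)" for v
      by (intro Suc.IH Ck_on_SucD(2) Suc.prems)
  qed
qed

lemma Ck_on_sum:
  assumes "open S" "\<And>i. i \<in> I \<Longrightarrow> Ck_on k S (f i)"
  shows "Ck_on k S (\<lambda>x. \<Sum>i\<in>I. f i x)"
  using assms(2)
  by (induction I rule: infinite_finite_induct) (auto intro: Ck_on_const Ck_on_add assms(1))

text \<open>The Leibniz rule reproduces the form \<open>B (f x) (g x)\<close>, so one induction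
  covers products of reals, scalar multiples, inner products, matrix products and Lie
  brackets.\<close>

lemma Ck_on_bilinear:
  assumes "bounded_bilinear B" "open S" "Ck_on k S f" "Ck_on k S g"
  shows "Ck_on k S (\<lambda>x. B (f x) (g x))"
  using assms(3,4)
proof (induction k arbitrary: f g)
  case 0
  then show ?case
    using bounded_bilinear.continuous_on[OF assms(1)] by auto
next
  case (Suc k)
  show ?case
  proof (rule Ck_on_SucI[OF \<open>open S\<close>])
    fix x assume "x \<in> S"
    show "((\<lambda>x. B (f x) (g x)) has_derivative
        (\<lambda>v. B (f x) (fderiv g x v) + B (fderiv f x v) (g x))) (at x)"
      by (intro bounded_bilinear.FDERIV[OF assms(1)] Ck_on_SucD(1)[OF Suc.prems(1)]
          Ck_on_SucD(1)[OF Suc.prems(2)] \<open>x \<in> S\<close>)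
  next
    fix v
    show "Ck_on k S (\<lambda>x. B (f x) (fderiv g x v) + B (fderiv f x v) (g x))"
      by (intro Ck_on_add Suc.IH assms(2) Ck_on_SucD(2)[OF Suc.prems(1)] Ck_on_SucD(2)[OF Suc.prems(2)]
          Ck_on_Suc_imp[OF Suc.prems(1)] Ck_on_Suc_imp[OF Suc.prems(2)])
  qed
qed

text \<open>The derivative of 1/f is a product of 1/f with itself and f', so the induction
  hypothesis for 1/f itself closes the argument.\<close>

lemma Ck_on_inverse:
  fixes f :: "'a::euclidean_space \<Rightarrow> real"
  assumes "open S" "Ck_on k S f" "\<And>x. x \<in> S \<Longrightarrow> f x \<noteq> 0"
  shows "Ck_on k S (\<lambda>x. inverse (f x))"
  using assms(2)
proof (induction k)
  case 0
  then show ?case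
    using assms(3) by (simp add: continuous_on_inverse)
next
  case (Suc k)
  note mult = Ck_on_bilinear[OF bounded_bilinear_mult \<open>open S\<close>]
  note f = Suc.prems
  show ?case
  proof (rule Ck_on_SucI[OF \<open>open S\<close>])
    fix x assume "x \<in> S"
    show "((\<lambda>x. inverse (f x)) has_derivative
        (\<lambda>v. (- 1) * (inverse (f x) * fderiv f x v * inverse (f x)))) (at x)"
      using Deriv.has_derivative_inverse[OF _ Ck_on_SucD(1)[OF f]] assms(3) \<open>x \<in> S\<close> by auto
  next
    fix v
    show "Ck_on k S (\<lambda>x. (- 1) * (inverse (f x) * fderiv f x v * inverse (f x)))"
      by (intro mult Ck_on_const Suc.IH Ck_on_SucD[OF f] assms(1) Ck_on_Suc_imp[OF f])
  qed
qed

text \<open>In the chain rule the direction \<open>fderiv g x v\<close> varies with x, whereas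
  \<open>Ck_on\<close> only controls derivatives of \<open>f\<close> in fixed directions. Expanding
  the direction in the standard basis separates the two.\<close>

lemma Ck_on_compose:
  fixes g :: "'a::euclidean_space \<Rightarrow> 'b::euclidean_space"
  assumes "open S" "open T" "g ` S \<subseteq> T" "Ck_on k S g" "Ck_on k T f"
  shows "Ck_on k S (\<lambda>x. f (g x))"
  using assms(4,5)
proof (induction k arbitrary: f)
  case 0
  then show ?case
    using continuous_on_compose2[of T f S g] assms(3) by simp
next
  case (Suc k)
  define f' where "f' = (\<lambda>x v. \<Sum>b\<in>Basis. (fderiv g x v \<bullet> b) *\<^sub>R
      fderiv f (g x) b)"
  show ?case
  proof (rule Ck_on_SucI[OF \<open>open S\<close>])
    fix x assume "x \<in> S"
    have "((\<lambda>x. f (g x)) has_derivative (\<lambda>v. fderiv f (g x) (fderiv g x v))) (at x)"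
      by (rule has_derivative_compose[OF Ck_on_SucD(1)[OF Suc.prems(1) \<open>x \<in> S\<close>] Ck_on_SucD(1)[OF Suc.prems(2)]])
         (use assms(3) \<open>x \<in> S\<close> in auto)
    moreover have "fderiv f (g x) w = (\<Sum>b\<in>Basis. (w \<bullet> b) *\<^sub>R fderiv f (g x) b)" for w
    proof -
      interpret linear "fderiv f (g x)"
        using Ck_on_SucD(1)[OF Suc.prems(2)] has_derivative_linear assms(3) \<open>x \<in> S\<close> by blast
      have "fderiv f (g x) w = fderiv f (g x) (\<Sum>b\<in>Basis. (w \<bullet> b) *\<^sub>R b)"
        by (simp add: euclidean_representation)
      then show ?thesis
        by (simp only: sum scale)
    qed
    then have "(\<lambda>v. fderiv f (g x) (fderiv g x v)) = f' x"
      unfolding f'_def by blast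
    ultimately show "((\<lambda>x. f (g x)) has_derivative f' x) (at x)"
      by simp
  next
    fix v
    have "Ck_on k S (\<lambda>x. fderiv f (g x) b)" for b
      using Suc.IH[OF Ck_on_Suc_imp[OF Suc.prems(1)] Ck_on_SucD(2)[OF Suc.prems(2)]] .
    moreover have "Ck_on k S (\<lambda>x. fderiv g x v \<bullet> b)" for b
      by (rule Ck_on_bilinear[OF bounded_bilinear_inner \<open>open S\<close> Ck_on_SucD(2)[OF Suc.prems(1)] Ck_on_const[OF \<open>open S\<close>]])
    ultimately show "Ck_on k S (\<lambda>x. f' x v)"
      unfolding f'_def
      by (intro Ck_on_sum Ck_on_bilinear[OF bounded_bilinear_scaleR] \<open>open S\<close>)
  qed
qed

section \<open>Closure properties of smooth functions\<close>

lemma smooth_on_subset: "smooth_on S f \<Longrightarrow> T \<subseteq> S \<Longrightarrow> smooth_on T f"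
  using Ck_on_subset unfolding smooth_on_def by blast

lemma smooth_on_cong:
  "open S \<Longrightarrow> (\<And>x. x \<in> S \<Longrightarrow> f x = g x) \<Longrightarrow> smooth_on S f \<Longrightarrow> smooth_on S g"
  unfolding smooth_on_def using Ck_on_cong by blast

lemma smooth_on_local:
  assumes "\<And>x. x \<in> S \<Longrightarrow> \<exists>U. open U \<and> x \<in> U \<and> smooth_on U f"
  shows "smooth_on S f"
  unfolding smooth_on_def
proof
  fix k
  show "Ck_on k S f"
  proof (rule Ck_on_local)
    fix x assume "x \<in> S"
    from assms[OF this] show "\<exists>U. open U \<and> x \<in> U \<and> Ck_on k U f"
      by (auto simp: smooth_on_def)
  qed
qed

lemma smooth_on_has_derivative:
  "smooth_on S f \<Longrightarrow> x \<in> S \<Longrightarrow> (f has_derivative fderiv f x) (at x)"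
  unfolding smooth_on_def using Ck_on_SucD(1) by blast

lemma smooth_on_frechet_derivative:
  "smooth_on S f \<Longrightarrow> smooth_on S (\<lambda>x. fderiv f x v)"
  unfolding smooth_on_def using Ck_on_SucD(2) by blast

lemma smooth_on_const: "open S \<Longrightarrow> smooth_on S (\<lambda>x. c)"
  by (simp add: smooth_on_def Ck_on_const)

lemma smooth_on_bounded_linear: "open S \<Longrightarrow> bounded_linear L \<Longrightarrow> smooth_on S L"
  by (simp add: smooth_on_def Ck_on_bounded_linear)

lemma smooth_on_ident: "open S \<Longrightarrow> smooth_on S (\<lambda>x. x)"
  by (rule smooth_on_bounded_linear[OF _ bounded_linear_ident])

lemma smooth_on_bilinear:
  "bounded_bilinear B \<Longrightarrow> open S \<Longrightarrow> smooth_on S f \<Longrightarrow> smooth_on S g \<Longrightarrow> smooth_on S (\<lambda>x. B (f x) (g x))"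
  by (simp add: smooth_on_def Ck_on_bilinear)

lemmas smooth_on_scaleR = smooth_on_bilinear[OF bounded_bilinear_scaleR]
lemmas smooth_on_mult = smooth_on_bilinear[OF bounded_bilinear_mult]
lemmas smooth_on_inner = smooth_on_bilinear[OF bounded_bilinear_inner]

lemma smooth_on_add:
  "open S \<Longrightarrow> smooth_on S f \<Longrightarrow> smooth_on S g \<Longrightarrow> smooth_on S (\<lambda>x. f x + g x)"
  by (simp add: smooth_on_def Ck_on_add)

lemma smooth_on_sum:
  "open S \<Longrightarrow> (\<And>i. i \<in> I \<Longrightarrow> smooth_on S (f i)) \<Longrightarrow> smooth_on S (\<lambda>x. \<Sum>i\<in>I. f i x)"
  by (simp add: smooth_on_def Ck_on_sum)

lemma smooth_on_compose:
  fixes g :: "'a::euclidean_space \<Rightarrow> 'b::euclidean_space"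
  assumes "open S" "open T" "g ` S \<subseteq> T" "smooth_on S g" "smooth_on T f"
  shows "smooth_on S (\<lambda>x. f (g x))"
  using assms Ck_on_compose unfolding smooth_on_def by blast

lemma smooth_on_linear:
  fixes g :: "'a::euclidean_space \<Rightarrow> 'b::euclidean_space"
  assumes "bounded_linear L" "open S" "smooth_on S g"
  shows "smooth_on S (\<lambda>x. L (g x))"
  by (rule smooth_on_compose[OF assms(2) open_UNIV _ assms(3) smooth_on_bounded_linear])
     (use assms in auto)

lemma smooth_on_diff:
  fixes f :: "'a::euclidean_space \<Rightarrow> 'b::euclidean_space"
  assumes "open S" "smooth_on S f" "smooth_on S g"
  shows "smooth_on S (\<lambda>x. f x - g x)"
  using smooth_on_add[OF assms(1,2) smooth_on_linear[OF bounded_linear_minus[OF bounded_linear_ident] assms(1,3)]]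
  by simp

lemma smooth_on_inverse:
  fixes f :: "'a::euclidean_space \<Rightarrow> real"
  shows "open S \<Longrightarrow> smooth_on S f \<Longrightarrow> (\<And>x. x \<in> S \<Longrightarrow> f x \<noteq> 0) \<Longrightarrow> smooth_on S (\<lambda>x. inverse (f x))"
  by (simp add: smooth_on_def Ck_on_inverse)

lemma smooth_on_divide:
  fixes f :: "'a::euclidean_space \<Rightarrow> real"
  shows "open S \<Longrightarrow> smooth_on S f \<Longrightarrow> smooth_on S g \<Longrightarrow> (\<And>x. x \<in> S \<Longrightarrow> g x \<noteq> 0) \<Longrightarrow>
    smooth_on S (\<lambda>x. f x / g x)"
  unfolding divide_inverse by (intro smooth_on_mult smooth_on_inverse)

lemma smooth_on_prod:
  fixes f :: "'i \<Rightarrow> 'a::euclidean_space \<Rightarrow> real"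
  assumes "open S" "\<And>i. i \<in> I \<Longrightarrow> smooth_on S (f i)"
  shows "smooth_on S (\<lambda>x. \<Prod>i\<in>I. f i x)"
  using assms(2)
  by (induction I rule: infinite_finite_induct) (auto intro: smooth_on_const smooth_on_mult assms(1))

lemma smooth_on_euclidean_componentwise:
  fixes f :: "'a::euclidean_space \<Rightarrow> 'b::euclidean_space"
  assumes "open S" "\<And>b. b \<in> Basis \<Longrightarrow> smooth_on S (\<lambda>x. f x \<bullet> b)"
  shows "smooth_on S f"
proof -
  have "smooth_on S (\<lambda>x. \<Sum>b\<in>Basis. (f x \<bullet> b) *\<^sub>R b)"
    by (intro smooth_on_sum smooth_on_scaleR smooth_on_const assms)
  then show ?thesis
    by (simp add: euclidean_representation)
qed

lemma smooth_on_directional_derivative: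
  fixes G :: "'a::euclidean_space \<Rightarrow> 'a"
  assumes "open S" "smooth_on S F" "smooth_on S G"
  shows "smooth_on S (\<lambda>x. fderiv F x (G x))"
proof (rule smooth_on_cong[OF \<open>open S\<close>])
  show "smooth_on S (\<lambda>x. \<Sum>b\<in>Basis. (G x \<bullet> b) *\<^sub>R fderiv F x b)"
    by (intro smooth_on_sum smooth_on_scaleR smooth_on_inner smooth_on_const
        smooth_on_frechet_derivative assms)
  fix x assume "x \<in> S"
  then interpret linear "fderiv F x"
    using smooth_on_has_derivative[OF assms(2)] has_derivative_linear by blast
  have "fderiv F x (G x) = fderiv F x (\<Sum>b\<in>Basis. (G x \<bullet> b) *\<^sub>R b)"
    by (simp add: euclidean_representation)
  then show "(\<Sum>b\<in>Basis. (G x \<bullet> b) *\<^sub>R fderiv F x b) = fderiv F x (G x)"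
    by (simp only: sum scale)
qed

section \<open>Symmetry of second derivatives\<close>

text \<open>The mean value theorem, applied first along v and then along w, turns the second
  difference into \<open>s\<^sup>2\<close> times the mixed derivative at a nearby point, and that
  derivative is continuous. The second difference is symmetric in v and w, hence so is its
  limit.\<close>

lemma second_difference_limit:
  fixes f :: "'a::euclidean_space \<Rightarrow> real"
  assumes "open S" "p \<in> S" "smooth_on S f"
  shows "((\<lambda>s. (f (p + s *\<^sub>R v + s *\<^sub>R w) - f (p + s *\<^sub>R v) - f (p + s *\<^sub>R w) + f p) / s\<^sup>2) \<longlongrightarrow>
    fderiv (\<lambda>q. fderiv f q v) p w) (at_right 0)"
proof -
  define f1 where "f1 = (\<lambda>q. fderiv f q v)"
  define f2 where "f2 = (\<lambda>q. fderiv f1 q w)"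
  have smooth1: "smooth_on S f1"
    unfolding f1_def by (rule smooth_on_frechet_derivative[OF assms(3)])
  have smooth2: "smooth_on S f2"
    unfolding f2_def by (rule smooth_on_frechet_derivative[OF smooth1])
  have cont2: "isCont f2 p"
    using smooth_on_has_derivative[OF smooth2 \<open>p \<in> S\<close>] has_derivative_continuous by blast
  obtain e where e: "e > 0" "ball p e \<subseteq> S"
    using assms(1,2) openE by blast
  have deriv: "((\<lambda>t. h (q + t *\<^sub>R u)) has_field_derivative fderiv h (q + t *\<^sub>R u) u) (at t)"
    if "smooth_on S h" "q + t *\<^sub>R u \<in> S" for h :: "'a \<Rightarrow> real" and q u t
  proof -
    interpret linear "fderiv h (q + t *\<^sub>R u)"
      using smooth_on_has_derivative[OF that] has_derivative_linear by blast
    have "((\<lambda>t. h (q + t *\<^sub>R u)) has_derivative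
        (\<lambda>s. fderiv h (q + t *\<^sub>R u) (s *\<^sub>R u))) (at t)"
      by (rule has_derivative_compose[where f = "\<lambda>t. q + t *\<^sub>R u", OF _ smooth_on_has_derivative[OF that]])
         (auto intro!: derivative_eq_intros)
    moreover have "(\<lambda>s. fderiv h (q + t *\<^sub>R u) (s *\<^sub>R u)) =
        (*) (fderiv h (q + t *\<^sub>R u) u)"
      by (simp add: fun_eq_iff scale)
    ultimately show ?thesis
      unfolding has_field_derivative_def by simp
  qed
  have "\<exists>d>0. \<forall>s>0. s < d \<longrightarrow>
      \<bar>(f (p + s *\<^sub>R v + s *\<^sub>R w) - f (p + s *\<^sub>R v) - f (p + s *\<^sub>R w) + f p) / s\<^sup>2 - f2 p\<bar> < r"
    if "r > 0" for r
  proof -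
    obtain d0 where d0: "d0 > 0" "\<And>q. dist q p < d0 \<Longrightarrow> dist (f2 q) (f2 p) < r"
      using cont2 \<open>r > 0\<close> unfolding continuous_at_eps_delta by blast
    define m where "m = min e d0"
    \<comment> \<open>For s < d every point p + a v + b w with coefficients in [0, s] is closer than
      m to p; the summand 1 keeps the denominator positive when v = w = 0.\<close>
    define d where "d = m / (norm v + norm w + 1)"
    have pos: "norm v + norm w + 1 > 0"
      using norm_ge_zero[of v] norm_ge_zero[of w] by linarith
    have "m > 0" "d > 0"
      using e d0 pos by (auto simp: m_def d_def)
    have near: "dist (p + a *\<^sub>R v + b *\<^sub>R w) p < m" if "0 \<le> a" "a \<le> s" "0 \<le> b" "b \<le> s" "s < d" for a b s
    proof -
      have "norm (a *\<^sub>R v + b *\<^sub>R w) \<le> a * norm v + b * norm w"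
        using norm_triangle_ineq[of "a *\<^sub>R v" "b *\<^sub>R w"] that by simp
      also have "\<dots> \<le> s * norm v + s * norm w"
        using that by (intro add_mono mult_right_mono) auto
      also have "\<dots> \<le> s * (norm v + norm w + 1)"
        using that by (simp add: algebra_simps)
      also have "\<dots> < d * (norm v + norm w + 1)"
        using that pos by (intro mult_strict_right_mono) auto
      also have "\<dots> = m"
        using pos by (simp add: d_def)
      finally show ?thesis
        by (simp add: dist_norm algebra_simps)
    qed
    then have inS: "p + a *\<^sub>R v + b *\<^sub>R w \<in> S" if "0 \<le> a" "a \<le> s" "0 \<le> b" "b \<le> s" "s < d" for a b s
      using that e by (force simp: m_def dist_commute)
    have "\<bar>(f (p + s *\<^sub>R v + s *\<^sub>R w) - f (p + s *\<^sub>R v) - f (p + s *\<^sub>R w) + f p) / s\<^sup>2 - f2 p\<bar> < r"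
      if s: "0 < s" "s < d" for s
    proof -
      define \<phi> where "\<phi> = (\<lambda>t. f (p + s *\<^sub>R w + t *\<^sub>R v) - f (p + t *\<^sub>R v))"
      have \<phi>': "(\<phi> has_field_derivative f1 (p + s *\<^sub>R w + t *\<^sub>R v) - f1 (p + t *\<^sub>R v)) (at t)"
        if "0 \<le> t" "t \<le> s" for t
        unfolding \<phi>_def f1_def
        by (intro DERIV_diff deriv[OF assms(3)])
           (use inS[of t s s] inS[of t s 0] that s in \<open>auto simp: algebra_simps\<close>)
      then obtain a where a: "0 < a" "a < s"
        "\<phi> s - \<phi> 0 = (s - 0) * (f1 (p + s *\<^sub>R w + a *\<^sub>R v) - f1 (p + a *\<^sub>R v))"
        using MVT2[OF s(1) \<phi>'] by auto
      have f1': "((\<lambda>t. f1 (p + a *\<^sub>R v + t *\<^sub>R w)) has_field_derivative f2 (p + a *\<^sub>R v + t *\<^sub>R w)) (at t)"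
        if "0 \<le> t" "t \<le> s" for t
        unfolding f2_def
        by (rule deriv[OF smooth1]) (use inS[of a s t] that a s in auto)
      then obtain b where b: "0 < b" "b < s"
        "f1 (p + a *\<^sub>R v + s *\<^sub>R w) - f1 (p + a *\<^sub>R v + 0 *\<^sub>R w) = (s - 0) * f2 (p + a *\<^sub>R v + b *\<^sub>R w)"
        using MVT2[OF s(1) f1'] by auto
      have "f (p + s *\<^sub>R v + s *\<^sub>R w) - f (p + s *\<^sub>R v) - f (p + s *\<^sub>R w) + f p = \<phi> s - \<phi> 0"
        by (simp add: \<phi>_def add_ac)
      also have "\<dots> = s\<^sup>2 * f2 (p + a *\<^sub>R v + b *\<^sub>R w)"
        using a(3) b(3) by (simp add: power2_eq_square add_ac)
      finally show ?thesis
        using d0(2)[of "p + a *\<^sub>R v + b *\<^sub>R w"] near[of a s b] a b s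
        by (simp add: m_def dist_real_def)
    qed
    then show ?thesis
      using \<open>d > 0\<close> by blast
  qed
  then have "((\<lambda>s. (f (p + s *\<^sub>R v + s *\<^sub>R w) - f (p + s *\<^sub>R v) - f (p + s *\<^sub>R w) + f p) / s\<^sup>2)
      \<longlongrightarrow> f2 p) (at_right 0)"
    by (simp add: tendsto_iff eventually_at_right_field dist_real_def)
  then show ?thesis
    unfolding f2_def f1_def .
qed

lemma second_derivative_symmetric_real:
  fixes f :: "'a::euclidean_space \<Rightarrow> real"
  assumes "open S" "p \<in> S" "smooth_on S f"
  shows "fderiv (\<lambda>q. fderiv f q v) p w =
         fderiv (\<lambda>q. fderiv f q w) p v"
proof (rule tendsto_unique[OF _ second_difference_limit[OF assms]])
  have "(\<lambda>s. (f (p + s *\<^sub>R v + s *\<^sub>R w) - f (p + s *\<^sub>R v) - f (p + s *\<^sub>R w) + f p) / s\<^sup>2) =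
        (\<lambda>s. (f (p + s *\<^sub>R w + s *\<^sub>R v) - f (p + s *\<^sub>R w) - f (p + s *\<^sub>R v) + f p) / s\<^sup>2)"
    by (simp add: algebra_simps)
  then show "((\<lambda>s. (f (p + s *\<^sub>R v + s *\<^sub>R w) - f (p + s *\<^sub>R v) - f (p + s *\<^sub>R w) + f p) / s\<^sup>2) \<longlongrightarrow>
    fderiv (\<lambda>q. fderiv f q w) p v) (at_right 0)"
    using second_difference_limit[OF assms, of w v] by simp
qed simp

lemma frechet_derivative_inner_left:
  assumes "f differentiable (at x)"
  shows "fderiv (\<lambda>x. f x \<bullet> b) x v = fderiv f x v \<bullet> b"
proof -
  have "((\<lambda>x. f x \<bullet> b) has_derivative (\<lambda>v. fderiv f x v \<bullet> b)) (at x)"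
    using assms frechet_derivative_works has_derivative_inner_left by blast
  then show ?thesis
    using frechet_derivative_at by metis
qed

lemma second_derivative_symmetric:
  fixes f :: "'a::euclidean_space \<Rightarrow> 'b::euclidean_space"
  assumes "open S" "p \<in> S" "smooth_on S f"
  shows "fderiv (\<lambda>q. fderiv f q v) p w =
         fderiv (\<lambda>q. fderiv f q w) p v"
proof (rule euclidean_eqI)
  fix b :: 'b
  have *: "fderiv (\<lambda>q. fderiv f q v) p w \<bullet> b =
      frechet_derivative (\<lambda>q. fderiv (\<lambda>q. f q \<bullet> b) q v) (at p) w" for v w
  proof -
    have "frechet_derivative (\<lambda>q. fderiv (\<lambda>q. f q \<bullet> b) q v) (at p)
        = fderiv (\<lambda>q. fderiv f q v \<bullet> b) p"
      by (rule frechet_derivative_cong_open[OF assms(1,2)], rule frechet_derivative_inner_left)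
         (use smooth_on_has_derivative[OF assms(3)] in \<open>auto simp: differentiable_def\<close>)
    moreover have "(\<lambda>q. fderiv f q v) differentiable at p"
      using smooth_on_has_derivative[OF smooth_on_frechet_derivative[OF assms(3)] assms(2)]
      unfolding differentiable_def by blast
    ultimately show ?thesis
      using frechet_derivative_inner_left by metis
  qed
  have "smooth_on S (\<lambda>q. f q \<bullet> b)"
    by (intro smooth_on_inner smooth_on_const assms)
  then show "fderiv (\<lambda>q. fderiv f q v) p w \<bullet> b =
         fderiv (\<lambda>q. fderiv f q w) p v \<bullet> b"
    unfolding * using second_derivative_symmetric_real assms by blast
qed

subsection \<open>Smooth maps on subsets and their differentials\<close>

lemma smooth_mapE:
  assumes "smooth_map M f" "p \<in> M"
  obtains U F where "open U" "p \<in> U" "smooth_on U F" "\<And>q. q \<in> U \<Longrightarrow> q \<in> M \<Longrightarrow> F q = f q"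
proof -
  have "\<exists>U F. open U \<and> p \<in> U \<and> smooth_on U F \<and> (\<forall>q\<in>U \<inter> M. F q = f q)"
    using assms unfolding smooth_map_def by (rule bspec)
  then show thesis
    using that by (elim exE conjE) simp
qed

lemma smooth_map_smooth_on: "open S \<Longrightarrow> smooth_on S f \<Longrightarrow> M \<subseteq> S \<Longrightarrow> smooth_map M f"
  unfolding smooth_map_def by (intro ballI exI[of _ S] exI[of _ f]) auto

lemma smooth_map_cong:
  assumes "\<And>x. x \<in> M \<Longrightarrow> f x = g x" "smooth_map M f"
  shows "smooth_map M g"
  using assms unfolding smooth_map_def by simp

lemma smooth_map_const: "smooth_map M (\<lambda>x. c)"
  by (rule smooth_map_smooth_on[OF open_UNIV]) (auto intro: smooth_on_const)

lemma smooth_map_ident: "smooth_map M (\<lambda>x. x)"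
  by (rule smooth_map_smooth_on[OF open_UNIV]) (auto intro: smooth_on_ident)

text \<open>Extensions of \<open>f\<close> and \<open>g\<close> live on different neighbourhoods;
  this does the intersecting once, so that an operation on smooth maps only has to be checked on
  open sets.\<close>

lemma smooth_map_combine:
  fixes M :: "'a::euclidean_space set"
  assumes "smooth_map M f" "smooth_map M g"
    and "\<And>(W :: 'a set) F G. open W \<Longrightarrow> smooth_on W F \<Longrightarrow> smooth_on W G \<Longrightarrow> smooth_on W (\<lambda>x. h (F x) (G x))"
  shows "smooth_map M (\<lambda>x. h (f x) (g x))"
  unfolding smooth_map_def
proof
  fix p assume "p \<in> M"
  obtain U F where F: "open U" "p \<in> U" "smooth_on U F" "\<And>q. q \<in> U \<Longrightarrow> q \<in> M \<Longrightarrow> F q = f q"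
    using smooth_mapE[OF assms(1) \<open>p \<in> M\<close>] by metis
  obtain V G where G: "open V" "p \<in> V" "smooth_on V G" "\<And>q. q \<in> V \<Longrightarrow> q \<in> M \<Longrightarrow> G q = g q"
    using smooth_mapE[OF assms(2) \<open>p \<in> M\<close>] by metis
  have "smooth_on (U \<inter> V) (\<lambda>x. h (F x) (G x))"
    by (rule assms(3)[OF open_Int[OF F(1) G(1)] smooth_on_subset[OF F(3)] smooth_on_subset[OF G(3)]]) auto
  then show "\<exists>U F. open U \<and> p \<in> U \<and> smooth_on U F \<and> (\<forall>q\<in>U \<inter> M. F q = h (f q) (g q))"
    using F(1,2,4) G(1,2,4) by (intro exI[of _ "U \<inter> V"] exI[of _ "\<lambda>x. h (F x) (G x)"]) auto
qed

lemma smooth_map_bilinear: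
  "bounded_bilinear B \<Longrightarrow> smooth_map M f \<Longrightarrow> smooth_map M g \<Longrightarrow> smooth_map M (\<lambda>x. B (f x) (g x))"
  by (rule smooth_map_combine[where h = B]) (auto intro: smooth_on_bilinear)

lemma smooth_map_add:
  "smooth_map M f \<Longrightarrow> smooth_map M g \<Longrightarrow> smooth_map M (\<lambda>x. f x + g x)"
  by (rule smooth_map_combine[where h = "(+)"]) (auto intro: smooth_on_add)

lemma smooth_map_linear:
  fixes f :: "'a::euclidean_space \<Rightarrow> 'b::euclidean_space"
  shows "bounded_linear L \<Longrightarrow> smooth_map M f \<Longrightarrow> smooth_map M (\<lambda>x. L (f x))"
  by (rule smooth_map_combine[where h = "\<lambda>y _. L y"]) (auto intro: smooth_on_linear)

lemma smooth_map_diff: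
  fixes f :: "'a::euclidean_space \<Rightarrow> 'b::euclidean_space"
  assumes "smooth_map M f" "smooth_map M g"
  shows "smooth_map M (\<lambda>x. f x - g x)"
  using smooth_map_add[OF assms(1) smooth_map_linear[OF bounded_linear_minus[OF bounded_linear_ident] assms(2)]]
  by simp

lemma smooth_on_compose_smooth_map:
  fixes \<gamma> :: "'c::euclidean_space \<Rightarrow> 'a::euclidean_space"
  assumes "open I" "smooth_on I \<gamma>" "\<gamma> ` I \<subseteq> M" "smooth_map M f"
  shows "smooth_on I (\<lambda>t. f (\<gamma> t))"
proof (rule smooth_on_local)
  fix t assume "t \<in> I"
  obtain U F where F: "open U" "\<gamma> t \<in> U" "smooth_on U F" "\<And>q. q \<in> U \<Longrightarrow> q \<in> M \<Longrightarrow> F q = f q"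
    using smooth_mapE[OF assms(4)] \<open>t \<in> I\<close> assms(3) by (metis image_subset_iff)
  define J where "J = I \<inter> \<gamma> -` U"
  have "continuous_on I \<gamma>"
    using assms(2) unfolding smooth_on_def by (metis Ck_on.simps(1))
  then have "open J"
    unfolding J_def by (rule continuous_open_preimage[OF _ assms(1) F(1)])
  have "smooth_on J (\<lambda>t. F (\<gamma> t))"
    by (rule smooth_on_compose[OF \<open>open J\<close> F(1) _ smooth_on_subset[OF assms(2)] F(3)]) (auto simp: J_def)
  then have "smooth_on J (\<lambda>t. f (\<gamma> t))"
    by (rule smooth_on_cong[OF \<open>open J\<close>, rotated]) (use F(4) assms(3) in \<open>auto simp: J_def\<close>)
  then show "\<exists>U. open U \<and> t \<in> U \<and> smooth_on U (\<lambda>t. f (\<gamma> t))"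
    using \<open>open J\<close> \<open>t \<in> I\<close> F(2) by (auto simp: J_def)
qed

lemma smooth_on_vector_derivative:
  fixes \<gamma> :: "real \<Rightarrow> 'a::euclidean_space"
  assumes "smooth_on I \<gamma>" "t \<in> I"
  shows "(\<gamma> has_vector_derivative vector_derivative \<gamma> (at t)) (at t)"
  using differentiableI[OF smooth_on_has_derivative[OF assms]] by (simp only: vector_derivative_works)

lemma smooth_on_velocity:
  fixes \<gamma> :: "real \<Rightarrow> 'a::euclidean_space"
  assumes "open I" "smooth_on I \<gamma>"
  shows "smooth_on I (\<lambda>t. vector_derivative \<gamma> (at t))"
proof (rule smooth_on_cong[OF assms(1) _ smooth_on_frechet_derivative[OF assms(2), of 1]])
  fix t assume "t \<in> I"
  then have \<gamma>': "(\<gamma> has_derivative fderiv \<gamma> t) (at t)"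
    by (rule smooth_on_has_derivative[OF assms(2)])
  then have "(\<gamma> has_vector_derivative fderiv \<gamma> t 1) (at t)"
    using has_derivative_linear[OF \<gamma>'] unfolding has_vector_derivative_def
    by (simp add: linear_cmul[symmetric])
  then show "fderiv \<gamma> t 1 = vector_derivative \<gamma> (at t)"
    by (simp add: vector_derivative_at)
qed

section \<open>Curves through a point and the differential of a map\<close>

lemma curves_throughD:
  assumes "\<gamma> \<in> curves_through M p v"
  shows "\<gamma> 0 = p" "(\<gamma> has_vector_derivative v) (at 0)" "p \<in> M" "eventually (\<lambda>t. \<gamma> t \<in> M) (nhds 0)"
proof -
  obtain e where e: "e > 0" "\<gamma> ` {-e<..<e} \<subseteq> M" "\<gamma> 0 = p" "(\<gamma> has_vector_derivative v) (at 0)"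
    using assms unfolding curves_through_def by blast
  then show "\<gamma> 0 = p" "(\<gamma> has_vector_derivative v) (at 0)" "p \<in> M"
    by auto
  have "open {-e<..<e}" "0 \<in> {-e<..<e}"
    using e by auto
  then have "eventually (\<lambda>t. t \<in> {-e<..<e}) (nhds 0)"
    by (rule eventually_nhds_in_open)
  then show "eventually (\<lambda>t. \<gamma> t \<in> M) (nhds 0)"
    by eventually_elim (use e in auto)
qed

text \<open>Curves in \<open>curves_through\<close> are centred at the parameter 0, so other
  parameters of a given curve enter by translation.\<close>

lemma curve_shift:
  fixes \<gamma> :: "real \<Rightarrow> 'a::euclidean_space"
  assumes "open I" "smooth_on I \<gamma>" "\<gamma> ` I \<subseteq> M" "t \<in> I" "(\<gamma> has_vector_derivative v) (at t)"
  shows "(\<lambda>s. \<gamma> (t + s)) \<in> curves_through M (\<gamma> t) v"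
proof -
  obtain e where e: "e > 0" "ball t e \<subseteq> I"
    using assms(1,4) openE by blast
  have sub: "(\<lambda>s. t + s) ` {-e<..<e} \<subseteq> I"
    using e(2) by (auto simp: subset_iff dist_real_def)
  have "smooth_on {-e<..<e} (\<lambda>s. \<gamma> (t + s))"
    by (rule smooth_on_compose[OF _ assms(1) sub _ assms(2)])
       (auto intro!: smooth_on_add smooth_on_const smooth_on_ident)
  moreover have "((\<lambda>s. \<gamma> (t + s)) has_vector_derivative v) (at 0)"
    using vector_diff_chain_at[of "\<lambda>s. t + s" 1 0 \<gamma> v] assms(5)
    by (simp add: has_vector_derivative_add_const o_def has_vector_derivative_id add.commute)
  ultimately show ?thesis
    unfolding curves_through_def using e(1) sub assms(3) by fastforce
qed

lemma has_vector_derivative_transform_eventually: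
  assumes "(f has_vector_derivative d) (at x)" "eventually (\<lambda>t. f t = g t) (nhds x)"
  shows "(g has_vector_derivative d) (at x)"
  using assms has_vector_derivative_cong_ev[where f=f and g=g and S=UNIV and x=x]
    eventually_nhds_x_imp_x[OF assms(2)] by simp

text \<open>Near 0 the curve stays both in \<open>M\<close> and in the domain of the extension,
  where \<open>F\<close> and \<open>f\<close> agree along it. So derivatives along curves in
  \<open>M\<close> are those of any extension.\<close>

lemma curve_has_vector_derivative_ext:
  assumes "\<gamma> \<in> curves_through M p v" "open U" "p \<in> U" "(F has_derivative F') (at p)"
    and "\<And>q. q \<in> U \<Longrightarrow> q \<in> M \<Longrightarrow> F q = f q"
  shows "((\<lambda>t. f (\<gamma> t)) has_vector_derivative F' v) (at 0)"
proof -
  note \<gamma> = curves_throughD[OF assms(1)]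
  have "((\<lambda>t. F (\<gamma> t)) has_derivative (\<lambda>t. F' (t *\<^sub>R v))) (at 0)"
    by (rule has_derivative_compose) (use \<gamma> assms(4) in \<open>auto simp: has_vector_derivative_def\<close>)
  moreover have "(\<lambda>t. F' (t *\<^sub>R v)) = (\<lambda>t. t *\<^sub>R F' v)"
    using has_derivative_linear[OF assms(4)] by (simp add: linear_cmul)
  ultimately have deriv: "((\<lambda>t. F (\<gamma> t)) has_vector_derivative F' v) (at 0)"
    by (simp add: has_vector_derivative_def)
  have "isCont \<gamma> 0"
    using \<gamma>(2) has_vector_derivative_continuous by blast
  then have "eventually (\<lambda>t. \<gamma> t \<in> U) (nhds 0)"
    using assms(2,3) \<gamma>(1) unfolding continuous_within tendsto_def eventually_at_filter
    by (auto elim!: allE[of _ U] elim: eventually_mono)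
  then have ev: "eventually (\<lambda>t. F (\<gamma> t) = f (\<gamma> t)) (nhds 0)"
    using \<gamma>(4) by eventually_elim (use assms(5) in auto)
  show ?thesis
    by (rule has_vector_derivative_transform_eventually[OF deriv ev])
qed

text \<open>One curve has to exist: without any, every value would satisfy the condition under the
  \<open>THE\<close>.\<close>

lemma differential_eqI:
  assumes "\<gamma> \<in> curves_through M p v"
    and "\<And>\<gamma>. \<gamma> \<in> curves_through M p v \<Longrightarrow> ((\<lambda>t. f (\<gamma> t)) has_vector_derivative w) (at 0)"
  shows "differential M f p v = w"
  unfolding differential_def
proof (rule the_equality)
  show "w' = w" if "\<forall>\<gamma>\<in>curves_through M p v. ((\<lambda>t. f (\<gamma> t)) has_vector_derivative w') (at 0)" for w'
    using that assms vector_derivative_unique_at by blast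
qed (use assms in blast)

lemma differential_eq_derivative:
  assumes "v \<in> tangent_space M p" "open U" "p \<in> U" "(F has_derivative F') (at p)"
    and "\<And>q. q \<in> U \<Longrightarrow> q \<in> M \<Longrightarrow> F q = f q"
  shows "differential M f p v = F' v"
proof -
  obtain \<gamma> where "\<gamma> \<in> curves_through M p v"
    using assms(1) unfolding tangent_space_def by blast
  then show ?thesis
    by (rule differential_eqI) (rule curve_has_vector_derivative_ext[OF _ assms(2-5)])
qed

lemma differential_along_curve:
  assumes "\<gamma> \<in> curves_through M p v" "smooth_map M f"
  shows "((\<lambda>t. f (\<gamma> t)) has_vector_derivative differential M f p v) (at 0)"
proof -
  have "p \<in> M"
    using curves_throughD(3)[OF assms(1)] .
  then obtain U F where F: "open U" "p \<in> U" "smooth_on U F" "\<And>q. q \<in> U \<Longrightarrow> q \<in> M \<Longrightarrow> F q = f q"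
    using smooth_mapE[OF assms(2)] by metis
  note F' = smooth_on_has_derivative[OF F(3,2)]
  have v: "v \<in> tangent_space M p"
    using assms(1) unfolding tangent_space_def by blast
  have "differential M f p v = fderiv F p v"
    by (rule differential_eq_derivative[OF v F(1,2) F' F(4)])
  then show ?thesis
    using curve_has_vector_derivative_ext[OF assms(1) F(1,2) F' F(4)] by simp
qed

lemma differential_eq_curve:
  assumes "\<gamma> \<in> curves_through M p v" "smooth_map M f"
    and "((\<lambda>t. f (\<gamma> t)) has_vector_derivative w) (at 0)"
  shows "differential M f p v = w"
  using differential_along_curve[OF assms(1,2)] assms(3) vector_derivative_unique_at by blast

lemma differential_cong:
  assumes "v \<in> tangent_space M p" "smooth_map M f" "\<And>q. q \<in> M \<Longrightarrow> f q = g q"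
  shows "differential M f p v = differential M g p v"
proof -
  obtain \<gamma> where \<gamma>: "\<gamma> \<in> curves_through M p v"
    using assms(1) unfolding tangent_space_def by blast
  show ?thesis
  proof (rule differential_eq_curve[OF \<gamma> assms(2)])
    have "smooth_map M g"
      using smooth_map_cong[OF assms(3,2)] by blast
    then have "((\<lambda>t. g (\<gamma> t)) has_vector_derivative differential M g p v) (at 0)"
      using differential_along_curve[OF \<gamma>] by blast
    moreover have "eventually (\<lambda>t. g (\<gamma> t) = f (\<gamma> t)) (nhds 0)"
      using curves_throughD(4)[OF \<gamma>] by eventually_elim (use assms(3) in auto)
    ultimately show "((\<lambda>t. f (\<gamma> t)) has_vector_derivative differential M g p v) (at 0)"
      by (rule has_vector_derivative_transform_eventually)
  qed
qed

lemma differential_bilinear: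
  assumes "bounded_bilinear B" "v \<in> tangent_space M p" "smooth_map M f" "smooth_map M g"
  shows "differential M (\<lambda>q. B (f q) (g q)) p v =
    B (f p) (differential M g p v) + B (differential M f p v) (g p)"
proof -
  obtain \<gamma> where \<gamma>: "\<gamma> \<in> curves_through M p v"
    using assms(2) unfolding tangent_space_def by blast
  have "\<gamma> 0 = p"
    using curves_throughD(1)[OF \<gamma>] .
  then show ?thesis
    using differential_eq_curve[OF \<gamma> smooth_map_bilinear[OF assms(1,3,4)]]
      bounded_bilinear.has_vector_derivative[OF assms(1) differential_along_curve[OF \<gamma> assms(3)]
        differential_along_curve[OF \<gamma> assms(4)]] by simp
qed

lemma differential_add:
  assumes "v \<in> tangent_space M p" "smooth_map M f" "smooth_map M g"
  shows "differential M (\<lambda>q. f q + g q) p v = differential M f p v + differential M g p v"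
proof -
  obtain \<gamma> where \<gamma>: "\<gamma> \<in> curves_through M p v"
    using assms(1) unfolding tangent_space_def by blast
  show ?thesis
    by (intro differential_eq_curve[OF \<gamma> smooth_map_add[OF assms(2,3)]] has_vector_derivative_add
        differential_along_curve[OF \<gamma>] assms)
qed

lemma differential_linear:
  fixes f :: "'a::euclidean_space \<Rightarrow> 'b::euclidean_space"
  assumes "bounded_linear L" "v \<in> tangent_space M p" "smooth_map M f"
  shows "differential M (\<lambda>q. L (f q)) p v = L (differential M f p v)"
proof -
  obtain \<gamma> where \<gamma>: "\<gamma> \<in> curves_through M p v"
    using assms(2) unfolding tangent_space_def by blast
  show ?thesis
    by (intro differential_eq_curve[OF \<gamma> smooth_map_linear[OF assms(1,3)]]
        bounded_linear.has_vector_derivative[OF assms(1)] differential_along_curve[OF \<gamma> assms(3)])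
qed

lemma differential_const:
  assumes "v \<in> tangent_space M p"
  shows "differential M (\<lambda>q. c) p v = 0"
  by (rule differential_eq_derivative[OF assms open_UNIV UNIV_I has_derivative_const]) auto

lemma differential_ident:
  assumes "v \<in> tangent_space M p"
  shows "differential M (\<lambda>q. q) p v = v"
  by (rule differential_eq_derivative[OF assms open_UNIV UNIV_I has_derivative_ident]) auto

lemma differential_lincomb:
  assumes "smooth_map M f" "p \<in> M" "x \<in> tangent_space M p" "y \<in> tangent_space M p"
    and "a *\<^sub>R x + b *\<^sub>R y \<in> tangent_space M p"
  shows "differential M f p (a *\<^sub>R x + b *\<^sub>R y) = a *\<^sub>R differential M f p x + b *\<^sub>R differential M f p y"
proof -
  obtain U F where F: "open U" "p \<in> U" "smooth_on U F" "\<And>q. q \<in> U \<Longrightarrow> q \<in> M \<Longrightarrow> F q = f q"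
    using smooth_mapE[OF assms(1,2)] by metis
  note F' = smooth_on_has_derivative[OF F(3,2)]
  show ?thesis
    using has_derivative_linear[OF F'] assms(3-5)
    by (simp add: differential_eq_derivative[OF _ F(1,2) F' F(4)] linear_add linear_cmul)
qed

section \<open>Derivatives along vector fields\<close>

lemma smooth_map_differential:
  assumes "smooth_map M f" "X \<in> vector_fields M"
  shows "smooth_map M (\<lambda>q. differential M f q (X q))"
  unfolding smooth_map_def
proof
  fix p assume "p \<in> M"
  have X: "smooth_map M X" "\<And>q. q \<in> M \<Longrightarrow> X q \<in> tangent_space M q"
    using assms(2) by (auto simp: vector_fields_def)
  obtain U F where F: "open U" "p \<in> U" "smooth_on U F" "\<And>q. q \<in> U \<Longrightarrow> q \<in> M \<Longrightarrow> F q = f q"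
    using smooth_mapE[OF assms(1) \<open>p \<in> M\<close>] by metis
  obtain V G where G: "open V" "p \<in> V" "smooth_on V G" "\<And>q. q \<in> V \<Longrightarrow> q \<in> M \<Longrightarrow> G q = X q"
    using smooth_mapE[OF X(1) \<open>p \<in> M\<close>] by metis
  have "smooth_on (U \<inter> V) (\<lambda>q. fderiv F q (G q))"
    by (intro smooth_on_directional_derivative open_Int F G smooth_on_subset[OF F(3)] smooth_on_subset[OF G(3)]) auto
  moreover have "fderiv F q (G q) = differential M f q (X q)" if "q \<in> (U \<inter> V) \<inter> M" for q
    using that G(4) differential_eq_derivative[OF X(2) F(1) _ smooth_on_has_derivative[OF F(3)] F(4)] by auto
  ultimately show "\<exists>U F. open U \<and> p \<in> U \<and> smooth_on U F \<and> (\<forall>q\<in>U \<inter> M. F q = differential M f q (X q))"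
    using F(1,2) G(1,2)
    by (intro exI[of _ "U \<inter> V"] exI[of _ "\<lambda>q. fderiv F q (G q)"]) auto
qed

text \<open>A product rule, since q enters both as base point and through the direction: the first
  term freezes the direction at \<open>G p\<close>, the second freezes the derivative of
  \<open>F\<close> at p.\<close>

lemma has_derivative_directional_derivative:
  fixes G :: "'a::euclidean_space \<Rightarrow> 'a"
  assumes "open W" "smooth_on W F" "smooth_on W G" "p \<in> W"
  shows "((\<lambda>q. fderiv F q (G q)) has_derivative
    (\<lambda>w. frechet_derivative (\<lambda>q. fderiv F q (G p)) (at p) w +
         fderiv F p (fderiv G p w))) (at p)"
proof -
  define H where "H = (\<lambda>b q. fderiv F q b)"
  have expand: "fderiv F q v = (\<Sum>b\<in>Basis. (v \<bullet> b) *\<^sub>R H b q)" if "q \<in> W" for q v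
  proof -
    interpret linear "fderiv F q"
      using smooth_on_has_derivative[OF assms(2) that] has_derivative_linear by blast
    have "fderiv F q v = fderiv F q (\<Sum>b\<in>Basis. (v \<bullet> b) *\<^sub>R b)"
      by (simp add: euclidean_representation)
    then show ?thesis
      by (simp only: sum scale H_def)
  qed
  have H': "(H b has_derivative fderiv (H b) p) (at p)" for b
    using smooth_on_has_derivative[OF smooth_on_frechet_derivative[OF assms(2)] assms(4)]
    unfolding H_def by blast
  note G' = smooth_on_has_derivative[OF assms(3,4)]
  \<comment> \<open>Linearity in v lets the basis sum with coefficients
    \<open>G p \<bullet> b\<close> be reassembled below as the derivative of
    \<open>H (G p)\<close>.\<close>
  have Hv: "fderiv (H v) p = (\<lambda>w. \<Sum>b\<in>Basis. (v \<bullet> b) *\<^sub>R fderiv (H b) p w)" for v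
  proof -
    have "((\<lambda>q. \<Sum>b\<in>Basis. (v \<bullet> b) *\<^sub>R H b q) has_derivative
        (\<lambda>w. \<Sum>b\<in>Basis. (v \<bullet> b) *\<^sub>R fderiv (H b) p w)) (at p)"
      by (intro has_derivative_sum has_derivative_scaleR_right H')
    then have "(H v has_derivative
        (\<lambda>w. \<Sum>b\<in>Basis. (v \<bullet> b) *\<^sub>R fderiv (H b) p w)) (at p)"
      by (rule has_derivative_transform_within_open[OF _ assms(1,4)]) (simp add: expand H_def[of])
    then show ?thesis
      using frechet_derivative_at by metis
  qed
  have "((\<lambda>q. \<Sum>b\<in>Basis. (G q \<bullet> b) *\<^sub>R H b q) has_derivative
      (\<lambda>w. \<Sum>b\<in>Basis. (G p \<bullet> b) *\<^sub>R fderiv (H b) p w +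
        (fderiv G p w \<bullet> b) *\<^sub>R H b p)) (at p)"
    by (intro has_derivative_sum has_derivative_scaleR has_derivative_inner_left H' G')
  then have "((\<lambda>q. fderiv F q (G q)) has_derivative
      (\<lambda>w. \<Sum>b\<in>Basis. (G p \<bullet> b) *\<^sub>R fderiv (H b) p w +
        (fderiv G p w \<bullet> b) *\<^sub>R H b p)) (at p)"
    by (rule has_derivative_transform_within_open[OF _ assms(1,4)]) (rule expand[symmetric])
  moreover have "(\<lambda>w. \<Sum>b\<in>Basis. (G p \<bullet> b) *\<^sub>R fderiv (H b) p w +
        (fderiv G p w \<bullet> b) *\<^sub>R H b p) =
      (\<lambda>w. frechet_derivative (H (G p)) (at p) w + fderiv F p (fderiv G p w))"
    unfolding Hv[of "G p"] sum.distrib using expand[OF assms(4)] by (intro ext) simp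
  ultimately show ?thesis
    by (simp add: H_def)
qed

text \<open>Links the coordinate formula of \<open>lie_bracket\<close> with the commutator of
  derivations: the second derivatives of an extension of f cancel by symmetry. Tangency of the
  bracket is assumed because the coordinate formula does not display it.\<close>

lemma differential_commutator:
  fixes f :: "'a::euclidean_space \<Rightarrow> 'b::euclidean_space"
  assumes "smooth_map M f" "X \<in> vector_fields M" "Y \<in> vector_fields M" "p \<in> M"
    and "lie_bracket M X Y p \<in> tangent_space M p"
  shows "differential M (\<lambda>q. differential M f q (Y q)) p (X p) -
         differential M (\<lambda>q. differential M f q (X q)) p (Y p) =
         differential M f p (lie_bracket M X Y p)"
proof -
  obtain U F where F: "open U" "p \<in> U" "smooth_on U F" "\<And>q. q \<in> U \<Longrightarrow> q \<in> M \<Longrightarrow> F q = f q"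
    using smooth_mapE[OF assms(1,4)] by metis
  have field: "\<exists>V G. open V \<and> p \<in> V \<and> V \<subseteq> U \<and> smooth_on V G \<and> (\<forall>q\<in>V \<inter> M. G q = Z q)"
    if "Z \<in> vector_fields M" for Z
  proof -
    have "smooth_map M Z"
      using that by (simp add: vector_fields_def)
    then obtain V G where G: "open V" "p \<in> V" "smooth_on V G" "\<And>q. q \<in> V \<Longrightarrow> q \<in> M \<Longrightarrow> G q = Z q"
      using smooth_mapE[OF _ assms(4)] by metis
    then show ?thesis
      using F(1,2) smooth_on_subset[OF G(3)]
      by (intro exI[of _ "V \<inter> U"] exI[of _ G]) auto
  qed
  have second: "differential M (\<lambda>q. differential M f q (Z q)) p w =
      frechet_derivative (\<lambda>q. fderiv F q (Z p)) (at p) w +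
      fderiv F p (differential M Z p w)"
    if Z: "Z \<in> vector_fields M" and w: "w \<in> tangent_space M p" for Z w
  proof -
    obtain V G where G: "open V" "p \<in> V" "V \<subseteq> U" "smooth_on V G" "\<And>q. q \<in> V \<Longrightarrow> q \<in> M \<Longrightarrow> G q = Z q"
      using field[OF Z] by (metis IntI)
    have Zt: "Z q \<in> tangent_space M q" if "q \<in> M" for q
      using Z that by (simp add: vector_fields_def)
    have "fderiv F q (G q) = differential M f q (Z q)" if "q \<in> V" "q \<in> M" for q
      using that G(3,5) differential_eq_derivative[OF Zt F(1) _ smooth_on_has_derivative[OF F(3)] F(4)]
      by (simp add: subset_iff)
    then have "differential M (\<lambda>q. differential M f q (Z q)) p w =
      frechet_derivative (\<lambda>q. fderiv F q (G p)) (at p) w +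
         fderiv F p (fderiv G p w)"
      using differential_eq_derivative[OF w G(1,2)
          has_derivative_directional_derivative[OF G(1) smooth_on_subset[OF F(3) G(3)] G(4,2)]] by simp
    moreover have "differential M Z p w = fderiv G p w"
      by (rule differential_eq_derivative[OF w G(1,2) smooth_on_has_derivative[OF G(4,2)] G(5)])
    ultimately show ?thesis
      using G(2,5) assms(4) by simp
  qed
  have XY: "X p \<in> tangent_space M p" "Y p \<in> tangent_space M p"
    using assms(2-4) by (auto simp: vector_fields_def)
  interpret linear "fderiv F p"
    using smooth_on_has_derivative[OF F(3,2)] has_derivative_linear by blast
  have "differential M f p (lie_bracket M X Y p) = fderiv F p (lie_bracket M X Y p)"
    by (rule differential_eq_derivative[OF assms(5) F(1,2) smooth_on_has_derivative[OF F(3,2)] F(4)])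
  also have "\<dots> = fderiv F p (differential M Y p (X p)) -
      fderiv F p (differential M X p (Y p))"
    by (simp add: lie_bracket_def diff)
  finally show ?thesis
    using second_derivative_symmetric[OF F(1,2,3), of "X p" "Y p"]
    by (simp add: second[OF assms(3) XY(1)] second[OF assms(2) XY(2)])
qed

subsection \<open>Matrices\<close>

lemma bounded_bilinear_matrix_mult: "bounded_bilinear ((**) :: real^'n^'n \<Rightarrow> real^'n^'n \<Rightarrow> real^'n^'n)"
proof -
  have "bilinear ((**) :: real^'n^'n \<Rightarrow> real^'n^'n \<Rightarrow> real^'n^'n)"
    unfolding bilinear_def
    by (auto intro!: linearI simp: matrix_matrix_mult_def vec_eq_iff sum.distrib sum_distrib_left algebra_simps)
  then show ?thesis
    by (simp add: bilinear_conv_bounded_bilinear)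
qed

interpretation mm: bounded_bilinear "(**) :: real^'n^'n \<Rightarrow> real^'n^'n \<Rightarrow> real^'n^'n"
  by (rule bounded_bilinear_matrix_mult)

lemmas mm_distribs = mm.add_left mm.add_right mm.diff_left mm.diff_right mm.scaleR_left mm.scaleR_right
  mm.minus_left mm.minus_right mm.zero_left mm.zero_right

lemma bounded_linear_trace: "bounded_linear (trace :: real^'n^'n \<Rightarrow> real)"
  unfolding trace_def
  by (intro bounded_linear_sum bounded_linear_compose[OF bounded_linear_vec_nth bounded_linear_vec_nth])

lemmas trace_scaleR = linear_cmul[OF bounded_linear.linear[OF bounded_linear_trace], simplified]
lemmas trace_minus = linear_neg[OF bounded_linear.linear[OF bounded_linear_trace]]
lemmas trace_zero = linear_0[OF bounded_linear.linear[OF bounded_linear_trace]]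
lemmas trace_distribs = trace_add trace_sub trace_scaleR trace_minus trace_zero

lemma bounded_linear_entry: "bounded_linear (\<lambda>A :: real^'n^'m. A $ i $ j)"
  by (intro bounded_linear_compose[OF bounded_linear_vec_nth bounded_linear_vec_nth])

lemma GL_iff_det: "A \<in> GL \<longleftrightarrow> det A \<noteq> 0"
  by (simp add: GL_def invertible_det_nz)

lemma matrix_inv_left: "A \<in> GL \<Longrightarrow> matrix_inv A ** A = mat 1"
  and matrix_inv_right: "A \<in> GL \<Longrightarrow> A ** matrix_inv A = mat 1"
proof -
  assume "A \<in> GL"
  then have "\<exists>B. A ** B = mat 1 \<and> B ** A = mat 1"
    by (simp add: GL_def invertible_def)
  then have "A ** matrix_inv A = mat 1 \<and> matrix_inv A ** A = mat 1"
    unfolding matrix_inv_def by (rule someI_ex)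
  then show "matrix_inv A ** A = mat 1" "A ** matrix_inv A = mat 1"
    by auto
qed

lemma matrix_inv_cancel_left: "A \<in> GL \<Longrightarrow> matrix_inv A ** (A ** B) = B"
  and matrix_inv_cancel_right: "A \<in> GL \<Longrightarrow> A ** (matrix_inv A ** B) = B"
  for B :: "real^'n^'n"
  by (simp_all add: matrix_mul_assoc matrix_inv_left matrix_inv_right)

lemmas matrix_cancel = matrix_inv_left matrix_inv_right matrix_inv_cancel_left matrix_inv_cancel_right

lemma matrix_inv_eqI:
  fixes A B :: "real^'n^'n"
  assumes "A ** B = mat 1"
  shows "matrix_inv A = B" "A \<in> GL" "B \<in> GL"
proof -
  have BA: "B ** A = mat 1"
    using assms matrix_left_right_inverse by blast
  then show GL: "A \<in> GL" "B \<in> GL"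
    using assms by (auto simp: GL_def invertible_def)
  have "matrix_inv A = matrix_inv A ** (A ** B)"
    by (simp add: assms)
  then show "matrix_inv A = B"
    using GL by (simp add: matrix_inv_cancel_left)
qed

lemma GL_mult: "A \<in> GL \<Longrightarrow> B \<in> GL \<Longrightarrow> A ** B \<in> GL"
  by (simp add: GL_iff_det det_mul)

lemma GL_inv: "A \<in> GL \<Longrightarrow> matrix_inv A \<in> GL"
  using matrix_inv_eqI(3)[OF matrix_inv_right] .

lemma matrix_inv_mult:
  fixes A B :: "real^'n^'n"
  assumes "A \<in> GL" "B \<in> GL"
  shows "matrix_inv (A ** B) = matrix_inv B ** matrix_inv A"
proof (rule matrix_inv_eqI(1))
  have "(A ** B) ** (matrix_inv B ** matrix_inv A) = A ** (B ** (matrix_inv B ** matrix_inv A))"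
    by (simp only: matrix_mul_assoc)
  then show "(A ** B) ** (matrix_inv B ** matrix_inv A) = mat 1"
    using assms by (simp add: matrix_cancel)
qed

lemma matrix_inv_inv: "A \<in> GL \<Longrightarrow> matrix_inv (matrix_inv A) = A"
  for A :: "real^'n^'n"
  by (rule matrix_inv_eqI(1)[OF matrix_inv_left])

lemma det_inv: "A \<in> GL \<Longrightarrow> det (matrix_inv A) = inverse (det A)"
  for A :: "real^'n^'n"
  by (metis GL_iff_det det_I det_mul inverse_unique matrix_inv_right)

section \<open>Smoothness of the determinant and of inversion\<close>

lemma smooth_on_matrix:
  fixes f :: "'a::euclidean_space \<Rightarrow> real^'n^'m"
  assumes "open S" "\<And>i j. smooth_on S (\<lambda>x. f x $ i $ j)"
  shows "smooth_on S f"
  by (rule smooth_on_euclidean_componentwise[OF assms(1)])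
     (auto simp: Basis_vec_def inner_axis assms(2))

lemma smooth_on_entry:
  fixes f :: "'a::euclidean_space \<Rightarrow> real^'n^'m"
  assumes "open S" "smooth_on S f"
  shows "smooth_on S (\<lambda>x. f x $ i $ j)"
  using smooth_on_linear[OF bounded_linear_entry assms] .

lemma smooth_on_det:
  fixes f :: "'a::euclidean_space \<Rightarrow> real^'n^'n"
  assumes "open S" "smooth_on S f"
  shows "smooth_on S (\<lambda>x. det (f x))"
  unfolding det_def
  by (intro smooth_on_sum smooth_on_mult smooth_on_prod smooth_on_const smooth_on_entry assms)

lemma continuous_on_det':
  fixes f :: "'a::topological_space \<Rightarrow> real^'n^'n"
  assumes "continuous_on S f"
  shows "continuous_on S (\<lambda>x. det (f x))"
  unfolding det_def by (intro continuous_intros assms)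

lemma open_GL: "open (GL :: (real^'n^'n) set)"
proof -
  have "GL = {A :: real^'n^'n. det A \<noteq> 0}"
    by (auto simp: GL_iff_det)
  then show ?thesis
    using open_Collect_neq[of "det :: real^'n^'n \<Rightarrow> real" "\<lambda>_. 0"] continuous_on_det'[of UNIV "\<lambda>A :: real^'n^'n. A"]
    by simp
qed

text \<open>Cramer's rule exhibits the entries of the inverse as quotients of polynomials.\<close>

lemma matrix_inv_entry:
  fixes A :: "real^'n^'n"
  assumes "A \<in> GL"
  shows "matrix_inv A $ i $ j = det (\<chi> k l. if l = i then axis j 1 $ k else A $ k $ l) / det A"
proof -
  define x where "x = matrix_inv A *v axis j 1"
  have "A *v x = axis j 1"
    using assms by (simp add: x_def matrix_vector_mul_assoc matrix_inv_right)
  then have "x = (\<chi> i. det (\<chi> k l. if l = i then axis j 1 $ k else A $ k $ l) / det A)"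
    using cramer assms GL_iff_det by blast
  moreover have "x $ i = matrix_inv A $ i $ j"
    by (simp add: x_def matrix_vector_mult_basis column_def)
  ultimately show ?thesis
    by simp
qed

lemma smooth_on_matrix_inv: "smooth_on GL (matrix_inv :: real^'n^'n \<Rightarrow> real^'n^'n)"
proof (rule smooth_on_matrix[OF open_GL])
  fix i j
  have "smooth_on GL (\<lambda>A :: real^'n^'n. (\<chi> k l. if l = i then axis j 1 $ k else A $ k $ l) :: real^'n^'n)"
  proof (rule smooth_on_matrix[OF open_GL])
    fix k l
    show "smooth_on GL (\<lambda>A :: real^'n^'n. ((\<chi> k l. if l = i then axis j 1 $ k else A $ k $ l) :: real^'n^'n) $ k $ l)"
      by (cases "l = i") (auto intro!: smooth_on_const smooth_on_entry smooth_on_ident open_GL)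
  qed
  then have "smooth_on GL (\<lambda>A :: real^'n^'n. det (\<chi> k l. if l = i then axis j 1 $ k else A $ k $ l) / det A)"
    by (intro smooth_on_divide smooth_on_det smooth_on_ident open_GL) (auto simp: GL_iff_det)
  then show "smooth_on GL (\<lambda>A :: real^'n^'n. matrix_inv A $ i $ j)"
    by (rule smooth_on_cong[OF open_GL, rotated]) (simp add: matrix_inv_entry)
qed

section \<open>Cofactors and the derivative of the determinant\<close>

definition unit_matrix :: "'n \<Rightarrow> 'n \<Rightarrow> real^'n^'n" where
  "unit_matrix i j = axis i (axis j 1)"

text \<open>This is the signed minor of the entry (i, j), equivalently the partial derivative of
  \<open>det\<close> with respect to that entry.\<close>

definition cofactor :: "real^'n^'n \<Rightarrow> 'n \<Rightarrow> 'n \<Rightarrow> real" where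
  "cofactor A i j = det (\<chi> k. if k = i then axis j 1 else A $ k)"

lemma unit_matrix_nth: "unit_matrix i j $ k $ l = (if k = i \<and> l = j then 1 else 0)"
  by (simp add: unit_matrix_def axis_def)

lemma mult_unit_matrix_nth: "(A ** unit_matrix i j) $ k $ l = (if l = j then A $ k $ i else 0)"
  by (cases "l = j") (simp_all add: matrix_matrix_mult_def unit_matrix_nth if_distrib cong: if_cong)

lemma unit_matrix_mult_nth: "(unit_matrix i j ** A) $ k $ l = (if k = i then A $ j $ l else 0)"
  by (cases "k = i") (simp_all add: matrix_matrix_mult_def unit_matrix_nth if_distrib[of "\<lambda>x. x * y" for y] cong: if_cong)

text \<open>The determinant is linear in row i, hence affine in each entry. Both the derivative of
  \<open>det\<close> and the charts of the leaves rest on this.\<close>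

lemma det_add_unit_matrix: "det (A + t *\<^sub>R unit_matrix i j) = det A + t * cofactor A i j"
proof -
  have "A + t *\<^sub>R unit_matrix i j = (\<chi> k. if k = i then A $ k + t *s axis j 1 else A $ k)"
    by (simp add: vec_eq_iff unit_matrix_nth axis_def)
  moreover have "(\<chi> k. if k = i then A $ k else A $ k) = A"
    by (simp add: vec_eq_iff)
  ultimately show ?thesis
    using det_row_add[of i "\<lambda>k. A $ k" "\<lambda>k. t *s axis j 1" "\<lambda>k. A $ k"]
      det_row_mul[of i t "\<lambda>k. axis j 1" "\<lambda>k. A $ k"]
    by (simp add: cofactor_def)
qed

text \<open>The perturbed entry lies in the row that the cofactor overwrites.\<close>

lemma cofactor_add_unit_matrix: "cofactor (A + t *\<^sub>R unit_matrix i j) i j = cofactor A i j"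
  unfolding cofactor_def
  by (rule arg_cong[where f = det]) (simp add: vec_eq_iff unit_matrix_nth)

lemma cofactor_mat_1: "cofactor (mat 1 :: real^'n^'n) i j = (if i = j then 1 else 0)"
proof (cases "i = j")
  case True
  have "(\<chi> k. if k = i then axis i 1 else mat 1 $ k) = (mat 1 :: real^'n^'n)"
    by (simp add: vec_eq_iff mat_def axis_def)
  then have "cofactor (mat 1 :: real^'n^'n) i i = 1"
    unfolding cofactor_def by simp
  then show ?thesis
    using True by simp
next
  case False
  then show ?thesis
    unfolding cofactor_def
    by (auto intro!: det_identical_rows[OF False] simp: row_def vec_eq_iff mat_def axis_def)
qed

lemma smooth_on_cofactor:
  fixes f :: "'a::euclidean_space \<Rightarrow> real^'n^'n"
  assumes "open S" "smooth_on S f"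
  shows "smooth_on S (\<lambda>x. cofactor (f x) i j)"
  unfolding cofactor_def
proof (intro smooth_on_det smooth_on_matrix assms)
  fix k l
  show "smooth_on S (\<lambda>x. (\<chi> k. if k = i then axis j 1 else f x $ k) $ k $ l)"
    by (cases "k = i") (auto intro!: smooth_on_const smooth_on_entry assms)
qed

lemma matrix_expansion: "A = (\<Sum>i\<in>UNIV. \<Sum>j\<in>UNIV. A $ i $ j *\<^sub>R unit_matrix i j)"
proof -
  have "(\<Sum>i\<in>UNIV. \<Sum>j\<in>UNIV. A $ i $ j *\<^sub>R unit_matrix i j) $ k $ l = A $ k $ l" for k l
  proof -
    have "(\<Sum>i\<in>UNIV. \<Sum>j\<in>UNIV. A $ i $ j *\<^sub>R unit_matrix i j) $ k $ l =
        (\<Sum>i\<in>UNIV. \<Sum>j\<in>UNIV. if k = i then if l = j then A $ i $ j else 0 else 0)"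
      by (simp add: unit_matrix_nth) (intro sum.cong refl, simp)
    also have "\<dots> = (\<Sum>i\<in>UNIV. if k = i then \<Sum>j\<in>UNIV. if l = j then A $ i $ j else 0 else 0)"
      by (intro sum.cong refl) simp
    finally show ?thesis
      by simp
  qed
  then show ?thesis
    by (simp add: vec_eq_iff)
qed

text \<open>A derivative exists because \<open>det\<close> is a polynomial. Its value on a unit
  matrix is the slope of the affine function \<open>det_add_unit_matrix\<close> at the identity, and
  the unit matrices span.\<close>

lemma has_derivative_det_mat_1: "(det has_derivative trace) (at (mat 1 :: real^'n^'n))"
proof -
  have "smooth_on UNIV (det :: real^'n^'n \<Rightarrow> real)"
    by (intro smooth_on_det[of UNIV "\<lambda>x. x"] smooth_on_ident) auto
  then obtain D where D: "(det has_derivative D) (at (mat 1 :: real^'n^'n))"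
    using smooth_on_has_derivative by blast
  then interpret linear D
    using has_derivative_linear by blast
  have unit: "D (unit_matrix i j) = (if i = j then 1 else 0)" for i j
  proof -
    have "((\<lambda>t. det (mat 1 + t *\<^sub>R unit_matrix i j)) has_derivative (\<lambda>t. D (t *\<^sub>R unit_matrix i j))) (at 0)"
      by (rule has_derivative_compose[where f = "\<lambda>t. mat 1 + t *\<^sub>R unit_matrix i j"])
         (use D in \<open>auto intro!: derivative_eq_intros\<close>)
    moreover have "((\<lambda>t. det (mat 1 + t *\<^sub>R unit_matrix i j)) has_derivative
        (\<lambda>t. t * (if i = j then 1 else 0))) (at 0)"
      unfolding det_add_unit_matrix cofactor_mat_1 by (auto intro!: derivative_eq_intros)
    ultimately have "(\<lambda>t. D (t *\<^sub>R unit_matrix i j)) = (\<lambda>t. t * (if i = j then 1 else 0))"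
      by (rule has_derivative_unique)
    from fun_cong[OF this, of 1] show ?thesis
      by simp
  qed
  have "D H = trace H" for H
  proof -
    have "D H = (\<Sum>i\<in>UNIV. \<Sum>j\<in>UNIV. H $ i $ j *\<^sub>R D (unit_matrix i j))"
      by (subst matrix_expansion[of H]) (simp only: sum scale)
    then show ?thesis
      by (simp add: unit trace_def if_distrib cong: if_cong)
  qed
  then show ?thesis
    using D by (metis ext)
qed

text \<open>Jacobi's formula, moved from the identity to A by writing det X as det A times the
  determinant of the product of the inverse of A with X.\<close>

lemma has_derivative_det:
  fixes A :: "real^'n^'n"
  assumes "A \<in> GL"
  shows "(det has_derivative (\<lambda>H. det A * trace (matrix_inv A ** H))) (at A)"
proof -
  have "((\<lambda>X. matrix_inv A ** X) has_derivative (\<lambda>X. matrix_inv A ** X)) (at A)"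
    by (rule bounded_linear_imp_has_derivative[OF mm.bounded_linear_right])
  moreover have "(det has_derivative trace) (at (matrix_inv A ** A))"
    using has_derivative_det_mat_1 assms by (simp add: matrix_inv_left)
  ultimately have "((\<lambda>X. det (matrix_inv A ** X)) has_derivative (\<lambda>H. trace (matrix_inv A ** H))) (at A)"
    by (rule has_derivative_compose)
  then have "((\<lambda>X. det A * det (matrix_inv A ** X)) has_derivative (\<lambda>H. det A * trace (matrix_inv A ** H))) (at A)"
    by (rule has_derivative_mult_right)
  moreover have "(\<lambda>X. det A * det (matrix_inv A ** X)) = det"
    using assms by (intro ext) (simp add: det_mul[symmetric] matrix_inv_cancel_right)
  ultimately show ?thesis
    by simp
qed

lemma has_vector_derivative_det:
  fixes \<gamma> :: "real \<Rightarrow> real^'n^'n"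
  assumes "(\<gamma> has_vector_derivative v) (at t)" "\<gamma> t \<in> GL"
  shows "((\<lambda>t. det (\<gamma> t)) has_vector_derivative det (\<gamma> t) * trace (matrix_inv (\<gamma> t) ** v)) (at t)"
proof -
  have "((\<lambda>t. det (\<gamma> t)) has_derivative (\<lambda>s. det (\<gamma> t) * trace (matrix_inv (\<gamma> t) ** (s *\<^sub>R v)))) (at t)"
    by (rule has_derivative_compose[where f = \<gamma> and g = det])
       (use assms has_derivative_det in \<open>auto simp: has_vector_derivative_def\<close>)
  then show ?thesis
    by (simp add: has_vector_derivative_def mm.scaleR_right trace_scaleR mult_ac)
qed

text \<open>Jacobi's formula and the affine formula compute the same derivative of
  \<open>det (A + t E)\<close>, with E the unit matrix at (i, j).\<close>

lemma cofactor_eq: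
  fixes A :: "real^'n^'n"
  assumes "A \<in> GL"
  shows "cofactor A i j = det A * matrix_inv A $ j $ i"
proof -
  have "((\<lambda>t. A + t *\<^sub>R unit_matrix i j) has_vector_derivative unit_matrix i j) (at 0)"
    by (auto intro!: derivative_eq_intros simp: has_vector_derivative_def)
  then have "((\<lambda>t. det (A + t *\<^sub>R unit_matrix i j)) has_vector_derivative
      det A * trace (matrix_inv A ** unit_matrix i j)) (at 0)"
    using has_vector_derivative_det[of "\<lambda>t. A + t *\<^sub>R unit_matrix i j" "unit_matrix i j" 0] assms by simp
  moreover have "((\<lambda>t. det (A + t *\<^sub>R unit_matrix i j)) has_vector_derivative cofactor A i j) (at 0)"
    unfolding det_add_unit_matrix
    by (auto intro!: derivative_eq_intros simp: has_vector_derivative_def)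
  ultimately have "cofactor A i j = det A * trace (matrix_inv A ** unit_matrix i j)"
    using vector_derivative_unique_at by blast
  also have "trace (matrix_inv A ** unit_matrix i j) = matrix_inv A $ j $ i"
    by (simp add: trace_def mult_unit_matrix_nth)
  finally show ?thesis .
qed

text \<open>Otherwise column i of the inverse would vanish.\<close>

lemma exists_cofactor_nonzero:
  fixes A :: "real^'n^'n"
  assumes "A \<in> GL"
  shows "\<exists>j. cofactor A i j \<noteq> 0"
proof (rule ccontr)
  assume "\<not> ?thesis"
  then have "matrix_inv A $ j $ i = 0" for j
    using assms by (simp add: cofactor_eq GL_iff_det)
  then have "(A ** matrix_inv A) $ i $ i = 0"
    by (simp add: matrix_matrix_mult_def)
  then show False
    using assms by (simp add: matrix_inv_right mat_def)
qed

subsection \<open>The matrix exponential\<close>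

definition matrix_power :: "real^'n^'n \<Rightarrow> nat \<Rightarrow> real^'n^'n" where
  "matrix_power A k = ((**) A ^^ k) (mat 1)"

lemma matrix_power_0: "matrix_power A 0 = mat 1"
  and matrix_power_Suc: "matrix_power A (Suc k) = A ** matrix_power A k"
  by (simp_all add: matrix_power_def)

lemma matrix_power_Suc2: "matrix_power A (Suc k) = matrix_power A k ** A"
proof (induction k)
  case (Suc k)
  have "matrix_power A (Suc (Suc k)) = A ** (matrix_power A k ** A)"
    by (simp only: matrix_power_Suc[of A "Suc k"] Suc)
  then show ?case
    by (simp only: matrix_mul_assoc matrix_power_Suc)
qed (simp add: matrix_power_Suc matrix_power_0)

lemma matrix_power_scaleR: "matrix_power (t *\<^sub>R A) k = t ^ k *\<^sub>R matrix_power A k"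
  by (induction k) (simp_all add: matrix_power_0 matrix_power_Suc mm.scaleR_left mm.scaleR_right)

text \<open>The norm is submultiplicative only up to a factor K and \<open>mat 1\<close> need not
  have norm 1, so the comparison is with norm (mat 1) times the series of exp (norm A * K).\<close>

lemma summable_matrix_exp:
  fixes A :: "real^'n^'n"
  shows "summable (\<lambda>k. (1 / fact k) *\<^sub>R matrix_power A k)"
proof -
  obtain K where K: "K > 0" "\<forall>(X :: real^'n^'n) (Y :: real^'n^'n). norm (X ** Y) \<le> norm X * norm Y * K"
    using bounded_bilinear.pos_bounded[OF bounded_bilinear_matrix_mult[where 'n = 'n]] by auto
  have bound: "norm (matrix_power A k) \<le> norm (mat 1 :: real^'n^'n) * (norm A * K) ^ k" for k
  proof (induction k)
    case (Suc k)
    have "norm (matrix_power A (Suc k)) \<le> norm A * norm (matrix_power A k) * K"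
      unfolding matrix_power_Suc using K(2) by simp
    also have "\<dots> \<le> norm A * (norm (mat 1 :: real^'n^'n) * (norm A * K) ^ k) * K"
      using K(1) Suc by (intro mult_right_mono mult_left_mono) auto
    finally show ?case
      by (simp add: mult_ac)
  qed (simp add: matrix_power_0)
  show ?thesis
  proof (rule summable_comparison_test)
    show "\<exists>N. \<forall>k\<ge>N. norm ((1 / fact k) *\<^sub>R matrix_power A k) \<le>
        norm (mat 1 :: real^'n^'n) * (inverse (fact k) * (norm A * K) ^ k)"
      using bound by (auto simp: field_simps intro!: divide_right_mono)
    show "summable (\<lambda>k. norm (mat 1 :: real^'n^'n) * (inverse (fact k) * (norm A * K) ^ k))"
      by (intro summable_mult summable_exp)
  qed
qed

lemma matrix_exp_eq: "matrix_exp A = (\<Sum>k. (1 / fact k) *\<^sub>R matrix_power A k)"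
  by (simp add: matrix_exp_def matrix_power_def)

text \<open>Each entry of the exponential is an everywhere convergent real power series in t, to
  which termwise differentiation applies.\<close>

lemma matrix_exp_entry: "matrix_exp (t *\<^sub>R A) $ i $ j = (\<Sum>k. (matrix_power A k $ i $ j / fact k) * t ^ k)"
  and summable_matrix_exp_entry: "summable (\<lambda>k. (matrix_power A k $ i $ j / fact k) * t ^ k)"
proof -
  have eq: "((1 / fact k) *\<^sub>R matrix_power (t *\<^sub>R A) k) $ i $ j = (matrix_power A k $ i $ j / fact k) * t ^ k" for k
    by (simp add: matrix_power_scaleR)
  have "matrix_exp (t *\<^sub>R A) $ i $ j = (\<Sum>k. ((1 / fact k) *\<^sub>R matrix_power (t *\<^sub>R A) k) $ i $ j)"
    unfolding matrix_exp_eq by (rule bounded_linear.suminf[OF bounded_linear_entry summable_matrix_exp])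
  then show "matrix_exp (t *\<^sub>R A) $ i $ j = (\<Sum>k. (matrix_power A k $ i $ j / fact k) * t ^ k)"
    by (simp only: eq)
  show "summable (\<lambda>k. (matrix_power A k $ i $ j / fact k) * t ^ k)"
    using bounded_linear.summable[OF bounded_linear_entry[of i j] summable_matrix_exp[of "t *\<^sub>R A"]]
    by (simp only: eq)
qed

lemma matrix_exp_commute: "A ** matrix_exp (t *\<^sub>R A) = matrix_exp (t *\<^sub>R A) ** A"
proof -
  have "A ** matrix_power (t *\<^sub>R A) k = matrix_power (t *\<^sub>R A) k ** A" for k
    by (simp add: matrix_power_scaleR mm.scaleR_left mm.scaleR_right
        matrix_power_Suc[symmetric] matrix_power_Suc2[symmetric])
  then show ?thesis
    unfolding matrix_exp_eq bounded_linear.suminf[OF mm.bounded_linear_right summable_matrix_exp]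
      bounded_linear.suminf[OF mm.bounded_linear_left summable_matrix_exp]
    by (simp add: mm.scaleR_left mm.scaleR_right)
qed

lemma has_vector_derivative_matrixI:
  fixes f :: "real \<Rightarrow> real^'n^'m"
  assumes "\<And>i j. ((\<lambda>t. f t $ i $ j) has_field_derivative f' $ i $ j) (at t)"
  shows "(f has_vector_derivative f') (at t)"
  unfolding has_vector_derivative_def
proof (subst has_derivative_componentwise_within, intro ballI)
  fix b :: "real^'n^'m" assume "b \<in> Basis"
  then obtain i j where b: "b = axis i (axis j 1)"
    by (auto simp: Basis_vec_def)
  show "((\<lambda>x. f x \<bullet> b) has_derivative (\<lambda>x. (x *\<^sub>R f') \<bullet> b)) (at t)"
    using assms[of i j] unfolding has_field_derivative_def b by (simp add: inner_axis mult.commute[of _ "f' $ i $ j"])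
qed

lemma has_vector_derivative_matrix_exp:
  "((\<lambda>t. matrix_exp (t *\<^sub>R A)) has_vector_derivative A ** matrix_exp (t *\<^sub>R A)) (at t)"
proof (rule has_vector_derivative_matrixI)
  fix i j
  define c where "c = (\<lambda>i k. matrix_power A k $ i $ j / fact k)"
  have "((\<lambda>x. \<Sum>k. c i k * x ^ k) has_field_derivative (\<Sum>k. diffs (c i) k * t ^ k)) (at t)"
    by (rule termdiffs_strong_converges_everywhere) (unfold c_def, rule summable_matrix_exp_entry)
  moreover have "(\<Sum>k. diffs (c i) k * t ^ k) = (A ** matrix_exp (t *\<^sub>R A)) $ i $ j"
  proof -
    \<comment> \<open>\<open>diffs\<close> supplies the factor k + 1, which leaves A^(k+1) / k!.
      Splitting off one left factor A expresses this through the coefficients of the other entries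
      in column j.\<close>
    have "diffs (c i) k * t ^ k = (\<Sum>l\<in>UNIV. A $ i $ l * (c l k * t ^ k))" for k
    proof -
      have "diffs (c i) k = matrix_power A (Suc k) $ i $ j / fact k"
        by (simp add: diffs_def c_def del: of_nat_Suc)
      also have "\<dots> = (\<Sum>l\<in>UNIV. A $ i $ l * c l k)"
        by (simp add: matrix_power_Suc matrix_matrix_mult_def c_def sum_divide_distrib)
      finally show ?thesis
        by (simp add: sum_distrib_right mult.assoc)
    qed
    then have "(\<Sum>k. diffs (c i) k * t ^ k) = (\<Sum>k. \<Sum>l\<in>UNIV. A $ i $ l * (c l k * t ^ k))"
      by simp
    also have "\<dots> = (\<Sum>l\<in>UNIV. \<Sum>k. A $ i $ l * (c l k * t ^ k))"
      by (rule suminf_sum, rule summable_mult, unfold c_def, rule summable_matrix_exp_entry)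
    also have "\<dots> = (\<Sum>l\<in>UNIV. A $ i $ l * (\<Sum>k. c l k * t ^ k))"
      by (intro sum.cong refl suminf_mult, unfold c_def, rule summable_matrix_exp_entry)
    finally show ?thesis
      by (simp add: matrix_matrix_mult_def matrix_exp_entry c_def)
  qed
  ultimately show "((\<lambda>t. matrix_exp (t *\<^sub>R A) $ i $ j) has_field_derivative (A ** matrix_exp (t *\<^sub>R A)) $ i $ j) (at t)"
    by (simp add: matrix_exp_entry c_def)
qed

lemma matrix_exp_0: "matrix_exp (0 *\<^sub>R A) = mat 1"
proof -
  have "matrix_exp (0 *\<^sub>R A) $ i $ j = mat 1 $ i $ j" for i j
    unfolding matrix_exp_entry powser_zero by (simp add: matrix_power_0)
  then show ?thesis
    by (simp add: vec_eq_iff)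
qed

text \<open>The derivative is the exponential itself times a constant matrix, so the induction on
  the order of differentiability closes.\<close>

lemma smooth_on_matrix_exp: "smooth_on UNIV (\<lambda>t. matrix_exp (t *\<^sub>R A))"
proof -
  have "Ck_on k UNIV (\<lambda>t. matrix_exp (t *\<^sub>R A))" for k
  proof (induction k)
    case 0
    have "isCont (\<lambda>t. matrix_exp (t *\<^sub>R A)) t" for t
      using has_vector_derivative_matrix_exp has_vector_derivative_continuous by blast
    then show ?case
      by (simp add: continuous_at_imp_continuous_on)
  next
    case (Suc k)
    show ?case
    proof (rule Ck_on_SucI[OF open_UNIV])
      show "((\<lambda>t. matrix_exp (t *\<^sub>R A)) has_derivative (\<lambda>s. s *\<^sub>R (A ** matrix_exp (t *\<^sub>R A)))) (at t)" for t
        using has_vector_derivative_matrix_exp has_vector_derivative_def by blast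
      show "Ck_on k UNIV (\<lambda>t. s *\<^sub>R (A ** matrix_exp (t *\<^sub>R A)))" for s
        by (intro Ck_on_bilinear[OF bounded_bilinear_scaleR] Ck_on_bilinear[OF bounded_bilinear_matrix_mult]
            Ck_on_const Suc open_UNIV)
    qed
  qed
  then show ?thesis
    by (simp add: smooth_on_def)
qed

text \<open>The product has derivative zero, because A commutes with its exponential, and equals the
  identity at t = 0.\<close>

lemma matrix_exp_inverse: "matrix_exp (t *\<^sub>R A) ** matrix_exp (t *\<^sub>R (- A)) = mat 1"
proof -
  define h where "h = (\<lambda>t. matrix_exp (t *\<^sub>R A) ** matrix_exp (t *\<^sub>R (- A)))"
  have "(h has_vector_derivative 0) (at t)" for t
    unfolding h_def
    using mm.has_vector_derivative[OF has_vector_derivative_matrix_exp[of A t] has_vector_derivative_matrix_exp[of "- A" t]]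
    by (simp only: matrix_exp_commute[of A]) (simp add: mm_distribs matrix_mul_assoc)
  then have "h t = h 0"
    using has_derivative_zero_unique[of UNIV h t 0] by (auto simp: has_vector_derivative_def)
  then show ?thesis
    by (simp only: h_def matrix_exp_0) simp
qed

lemma matrix_exp_GL: "matrix_exp (t *\<^sub>R A) \<in> GL"
  using matrix_inv_eqI(2)[OF matrix_exp_inverse] .

text \<open>By Jacobi's formula the logarithmic derivative of the determinant along this curve is
  the trace of A.\<close>

lemma det_matrix_exp:
  assumes "trace A = 0"
  shows "det (matrix_exp (t *\<^sub>R A)) = 1"
proof -
  have "((\<lambda>t. det (matrix_exp (t *\<^sub>R A))) has_vector_derivative 0) (at t)" for t
    using has_vector_derivative_det[OF has_vector_derivative_matrix_exp matrix_exp_GL, of A t] assms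
    by (simp only: matrix_exp_commute[of A]) (simp add: matrix_inv_cancel_left matrix_exp_GL)
  then have "((\<lambda>t. det (matrix_exp (t *\<^sub>R A))) has_derivative (\<lambda>h. 0)) (at t)" for t
    by (simp add: has_vector_derivative_def)
  then have "det (matrix_exp (t *\<^sub>R A)) = det (matrix_exp (0 *\<^sub>R A))"
    using has_derivative_zero_unique[of UNIV "\<lambda>t. det (matrix_exp (t *\<^sub>R A))" t 0] by auto
  then show ?thesis
    by (simp only: matrix_exp_0) simp
qed

text \<open>A solution of \<open>\<gamma>' = \<gamma> C\<close> times \<open>exp (- t C)\<close> is constant.\<close>

lemma matrix_ode_unique:
  fixes \<gamma> :: "real \<Rightarrow> real^'n^'n"
  assumes "open I" "is_interval I"
    and "\<And>t. t \<in> I \<Longrightarrow> (\<gamma> has_vector_derivative \<gamma> t ** C) (at t)"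
  shows "\<exists>K. \<forall>t\<in>I. \<gamma> t = K ** matrix_exp (t *\<^sub>R C)"
proof -
  define h where "h = (\<lambda>t. \<gamma> t ** matrix_exp (t *\<^sub>R (- C)))"
  have h': "(h has_derivative (\<lambda>h. 0)) (at t within I)" if "t \<in> I" for t
  proof -
    have "(h has_vector_derivative 0) (at t)"
      unfolding h_def
      using mm.has_vector_derivative[OF assms(3)[OF that] has_vector_derivative_matrix_exp[of "- C" t]]
      by (simp add: mm_distribs matrix_mul_assoc)
    then show ?thesis
      by (simp add: has_vector_derivative_def has_derivative_at_withinI)
  qed
  have "\<exists>K. \<forall>t\<in>I. h t = K"
    using has_derivative_zero_constant[OF is_interval_convex[OF assms(2)] h'] by blast
  then obtain K where K: "\<And>t. t \<in> I \<Longrightarrow> h t = K"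
    by blast
  have "\<gamma> t = K ** matrix_exp (t *\<^sub>R C)" if "t \<in> I" for t
  proof -
    have "K ** matrix_exp (t *\<^sub>R C) = \<gamma> t ** (matrix_exp (t *\<^sub>R (- C)) ** matrix_exp (t *\<^sub>R C))"
      by (simp add: K[OF that, symmetric] h_def matrix_mul_assoc)
    then show ?thesis
      using matrix_exp_inverse[of t "- C"] by simp
  qed
  then show ?thesis
    by blast
qed

subsection \<open>Path-connectedness of the fibres of the determinant\<close>

definition scaling :: "'n \<Rightarrow> real \<Rightarrow> real^'n^'n" where
  "scaling k d = (\<chi> i j. if i = j then if i = k then d else 1 else 0)"

lemma det_scaling: "det (scaling k d) = d"
  by (subst det_diagonal) (simp_all add: scaling_def)

lemma scaling_mult: "scaling k d ** scaling k e = scaling k (d * e)"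
proof -
  have "(\<Sum>l\<in>UNIV. scaling k d $ i $ l * scaling k e $ l $ j) =
      (\<Sum>l\<in>UNIV. if l = i then scaling k (d * e) $ i $ j else 0)" for i j
    by (intro sum.cong refl) (auto simp: scaling_def)
  then show ?thesis
    by (simp add: matrix_matrix_mult_def vec_eq_iff)
qed

lemma scaling_1: "scaling k 1 = mat 1"
  by (simp add: scaling_def mat_def vec_eq_iff)

lemma continuous_on_scaling:
  assumes "continuous_on S f"
  shows "continuous_on S (\<lambda>x. scaling k (f x))"
  unfolding scaling_def
proof (intro continuous_on_vec_lambda)
  fix i j
  show "continuous_on S (\<lambda>x. if i = j then if i = k then f x else 1 else 0)"
    by (cases "i = j"; cases "i = k") (auto intro: assms)
qed

lemma continuous_on_matrix_mult:
  fixes f g :: "'a::topological_space \<Rightarrow> real^'n^'n"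
  shows "continuous_on S f \<Longrightarrow> continuous_on S g \<Longrightarrow> continuous_on S (\<lambda>x. f x ** g x)"
  by (rule bounded_bilinear.continuous_on[OF bounded_bilinear_matrix_mult])

text \<open>Reflection of the (m, n) coordinate plane in the line at angle \<theta>/2. The angles 0,
  pi/2 and pi give \<open>scaling n (-1)\<close>, the transposition of m and n, and
  \<open>scaling m (-1)\<close>, so this single family joins them all.\<close>

definition reflection :: "'n \<Rightarrow> 'n \<Rightarrow> real \<Rightarrow> real^'n^'n" where
  "reflection m n \<theta> = (\<chi> i j. if i = m then if j = m then cos \<theta> else if j = n then sin \<theta> else 0
     else if i = n then if j = m then sin \<theta> else if j = n then - cos \<theta> else 0
     else if i = j then 1 else 0)"

text \<open>An involution is invertible, so the path of reflections stays in
  \<open>GL\<close>.\<close>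

lemma reflection_square:
  assumes "m \<noteq> n"
  shows "reflection m n \<theta> ** reflection m n \<theta> = mat 1"
proof -
  have split: "sum f UNIV = f m + f n + sum f (UNIV - {m, n})" for f :: "'a \<Rightarrow> real"
    using assms by (simp add: sum.remove[of UNIV m] sum.remove[of "UNIV - {m}" n] Diff_insert2[symmetric]
        insert_commute add.assoc)
  have sc: "sin \<theta> * sin \<theta> + cos \<theta> * cos \<theta> = 1" "cos \<theta> * cos \<theta> + sin \<theta> * sin \<theta> = 1"
    using sin_cos_squared_add3[of \<theta>] by (simp_all add: add.commute)
  have "(\<Sum>k\<in>UNIV. reflection m n \<theta> $ i $ k * reflection m n \<theta> $ k $ j) = mat 1 $ i $ j" for i j
  proof -
    have "(\<Sum>k\<in>UNIV - {m, n}. reflection m n \<theta> $ i $ k * reflection m n \<theta> $ k $ j) =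
        (\<Sum>k\<in>UNIV - {m, n}. if k = i then if i = j then 1 else 0 else 0)"
      by (intro sum.cong) (auto simp: reflection_def)
    then show ?thesis
      using assms sc unfolding split[of "\<lambda>k. reflection m n \<theta> $ i $ k * reflection m n \<theta> $ k $ j"]
      by (auto simp: reflection_def mat_def sc)
  qed
  then show ?thesis
    by (simp add: vec_eq_iff matrix_matrix_mult_def)
qed

lemma continuous_on_reflection: "continuous_on S (reflection m n)"
  unfolding reflection_def
proof (intro continuous_on_vec_lambda)
  fix i j
  show "continuous_on S (\<lambda>\<theta>. if i = m then if j = m then cos \<theta> else if j = n then sin \<theta> else 0
     else if i = n then if j = m then sin \<theta> else if j = n then - cos \<theta> else 0
     else if i = j then 1 else 0)"
    by (cases "i = m"; cases "j = m"; cases "i = n"; cases "j = n") (auto intro!: continuous_intros)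
qed

lemma reflection_0: "m \<noteq> n \<Longrightarrow> reflection m n 0 = scaling n (-1)"
  by (auto simp: reflection_def scaling_def vec_eq_iff)

lemma reflection_pi_half:
  "m \<noteq> n \<Longrightarrow> reflection m n (pi/2) = (\<chi> i j. mat 1 $ i $ Transposition.transpose m n j)"
  by (auto simp: reflection_def mat_def vec_eq_iff Transposition.transpose_def)

lemma reflection_pi: "m \<noteq> n \<Longrightarrow> reflection m n pi = scaling m (-1)"
  by (auto simp: reflection_def scaling_def vec_eq_iff)

lemma path_component_image:
  assumes "path_component S x y" "continuous_on S f" "f ` S \<subseteq> T"
  shows "path_component T (f x) (f y)"
proof -
  obtain g where g: "path g" "path_image g \<subseteq> S" "pathstart g = x" "pathfinish g = y"
    using assms(1) unfolding path_component_def by blast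
  have "path (f \<circ> g)"
    using path_continuous_image[OF g(1)] continuous_on_subset[OF assms(2) g(2)] by blast
  then show ?thesis
    unfolding path_component_def using g assms(3)
    by (intro exI[of _ "f \<circ> g"]) (auto simp: path_image_compose pathstart_compose pathfinish_compose)
qed

lemma path_component_continuous:
  fixes h :: "real \<Rightarrow> 'a::topological_space"
  assumes "continuous_on {a..b} h" "a \<le> b" "h ` {a..b} \<subseteq> S"
  shows "path_component S (h a) (h b)"
proof (rule path_component_image[OF _ assms(1,3)])
  show "path_component {a..b} a b"
    using assms(2) convex_imp_path_connected[of "{a..b}"] by (simp add: path_connected_component)
qed

lemma path_component_GL_mult:
  assumes "path_component GL A A'" "path_component GL B B'"
  shows "path_component GL (A ** B) (A' ** B')"
proof (rule path_component_trans)
  have "B \<in> GL" "A' \<in> GL"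
    using assms path_component_mem by blast+
  show "path_component GL (A ** B) (A' ** B)"
    by (rule path_component_image[OF assms(1), of "\<lambda>X. X ** B"])
       (use \<open>B \<in> GL\<close> in \<open>auto intro!: continuous_on_matrix_mult continuous_intros GL_mult\<close>)
  show "path_component GL (A' ** B) (A' ** B')"
    by (rule path_component_image[OF assms(2), of "\<lambda>X. A' ** X"])
       (use \<open>A' \<in> GL\<close> in \<open>auto intro!: continuous_on_matrix_mult continuous_intros GL_mult\<close>)
qed

lemma path_component_reflection:
  assumes "m \<noteq> n" "a \<le> b"
  shows "path_component GL (reflection m n a) (reflection m n b)"
  by (rule path_component_continuous)
     (use assms matrix_inv_eqI(2)[OF reflection_square] in \<open>auto intro: continuous_on_reflection\<close>)

lemma path_component_scaling:
  assumes "d * e > 0"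
  shows "path_component GL (scaling k d) (scaling k e)"
proof (rule path_component_image[where f = "scaling k"])
  show "path_component {x. d * x > 0} d e"
  proof -
    have "convex {x. d * x > 0}"
      using convex_halfspace_gt[of 0 d] by simp
    then have "path_connected {x. d * x > 0}"
      by (rule convex_imp_path_connected)
    moreover have "d * d > 0"
      using assms by (auto simp: zero_less_mult_iff)
    ultimately show ?thesis
      using assms unfolding path_connected_component by blast
  qed
qed (auto intro: continuous_on_scaling[where f = "\<lambda>x. x"] continuous_intros simp: GL_iff_det det_scaling)

text \<open>Induction over products of elementary matrices, each of which is joined to the identity
  or to a sign change of one coordinate; these two normal forms are closed under multiplication. The
  induction also passes through singular matrices, hence the implication in
  \<open>P\<close>.\<close>

lemma path_component_GL_normal_form:
  fixes A :: "real^'n^'n"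
  assumes "A \<in> GL"
  shows "path_component GL A (mat 1) \<or> path_component GL A (scaling k (-1))"
proof -
  define P where "P = (\<lambda>A :: real^'n^'n. A \<in> GL \<longrightarrow>
    path_component GL A (mat 1) \<or> path_component GL A (scaling k (-1)))"
  have mult: "P (A ** B)" if "P A" "P B" for A B
  proof -
    have "scaling k (-1) ** scaling k (-1) = (mat 1 :: real^'n^'n)"
      by (simp add: scaling_mult scaling_1)
    moreover have "A \<in> GL" "B \<in> GL" if "A ** B \<in> GL"
      using that by (auto simp: GL_iff_det det_mul)
    ultimately show ?thesis
      using that path_component_GL_mult[of A _ B] unfolding P_def
      by (metis matrix_mul_lid matrix_mul_rid)
  qed
  have minus: "path_component GL (scaling l (-1)) (scaling k (-1))" for l
  proof (cases "l = k")
    case True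
    then show ?thesis
      by (simp add: path_component_refl GL_iff_det det_scaling)
  next
    case False
    then show ?thesis
      using path_component_sym[OF path_component_reflection[of l k 0 pi]]
      by (simp add: reflection_0 reflection_pi)
  qed
  have scaling: "P (scaling l d)" for l d
  proof -
    consider "d = 0" | "d > 0" | "d < 0"
      by linarith
    then show ?thesis
    proof cases
      case 2
      then show ?thesis
        using path_component_scaling[of d 1 l] by (simp add: P_def scaling_1)
    next
      case 3
      then show ?thesis
        using path_component_trans[OF path_component_scaling[of d "-1" l] minus] by (simp add: P_def)
    qed (simp add: P_def GL_iff_det det_scaling)
  qed
  have "P A"
  proof (rule induct_matrix_elementary_alt)
    show "P (A ** B)" if "P A" "P B" for A B
      using mult that .
    show "P A" if "row i A = 0" for A i
      using that det_zero_row(2)[of i A] by (simp add: P_def GL_iff_det)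
    show "P A" if "\<And>i j. i \<noteq> j \<Longrightarrow> A $ i $ j = 0" for A
    proof -
      \<comment> \<open>A diagonal matrix is built as a product of scalings, with \<open>K\<close>
        the set of coordinates already treated and 1 at the remaining ones.\<close>
      have diag: "P (\<chi> i j. if i = j then if i \<in> K then A $ i $ i else 1 else 0)" if "finite K" for K
        using that
      proof induction
        case empty
        have "(\<chi> i j. if i = j then if i \<in> {} then A $ i $ i else 1 else 0) = scaling k 1"
          by (simp add: scaling_def vec_eq_iff)
        then show ?case
          using scaling by simp
      next
        case (insert l K)
        have eq: "scaling l (A $ l $ l) ** (\<chi> i j. if i = j then if i \<in> K then A $ i $ i else 1 else 0) =
            (\<chi> i j. if i = j then if i \<in> insert l K then A $ i $ i else 1 else 0)"
        proof -
          have "(\<Sum>m\<in>UNIV. scaling l (A $ l $ l) $ i $ m * (if m = j then if m \<in> K then A $ m $ m else 1 else 0)) =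
              (if i = j then if i \<in> insert l K then A $ i $ i else 1 else 0)" for i j
          proof -
            have "(\<Sum>m\<in>UNIV. scaling l (A $ l $ l) $ i $ m * (if m = j then if m \<in> K then A $ m $ m else 1 else 0)) =
              (\<Sum>m\<in>UNIV. if m = i then if i = j then if i \<in> insert l K then A $ i $ i else 1 else 0 else 0)"
              using insert.hyps by (intro sum.cong) (auto simp: scaling_def)
            then show ?thesis
              by simp
          qed
          then show ?thesis
            by (simp add: matrix_matrix_mult_def vec_eq_iff)
        qed
        show ?case
          unfolding eq[symmetric] by (rule mult[OF scaling insert.IH])
      qed
      have "(\<chi> i j. if i = j then if i \<in> UNIV then A $ i $ i else 1 else 0) = A"
        using that by (auto simp: vec_eq_iff)
      then show ?thesis
        using diag[OF finite, of UNIV] by simp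
    qed
    show "P (\<chi> i j. mat 1 $ i $ Transposition.transpose m n j)" if "m \<noteq> n" for m n
    proof -
      have "path_component GL (reflection m n (pi/2)) (scaling n (-1))"
        using path_component_sym[OF path_component_reflection[OF that, of 0 "pi/2"]] that
        by (simp add: reflection_0)
      from path_component_trans[OF this minus] show ?thesis
        using that by (simp add: P_def reflection_pi_half)
    qed
    show "P (\<chi> i j. of_bool (i = m \<and> j = n \<or> i = j))" if "m \<noteq> n" for m n
    proof -
      \<comment> \<open>The straight segment from the identity to the transvection has constant
        determinant 1, since off-diagonal cofactors of the identity vanish.\<close>
      have "path_component GL (mat 1 + 0 *\<^sub>R unit_matrix m n) (mat 1 + 1 *\<^sub>R unit_matrix m n)"
        by (rule path_component_continuous)
           (auto intro!: continuous_intros simp: GL_iff_det det_add_unit_matrix cofactor_mat_1 that)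
      moreover have "mat 1 + 1 *\<^sub>R unit_matrix m n = (\<chi> i j. of_bool (i = m \<and> j = n \<or> i = j))"
        using that by (auto simp: vec_eq_iff unit_matrix_nth mat_def)
      ultimately show ?thesis
        by (simp add: P_def path_component_sym)
    qed
  qed
  then show ?thesis
    using assms by (simp add: P_def)
qed

text \<open>The determinants along a path form an interval that avoids 0.\<close>

lemma path_component_GL_det_sign:
  fixes A B :: "real^'n^'n"
  assumes "path_component GL A B"
  shows "det A * det B > 0"
proof -
  have "path_component (- {0}) (det A) (det B)"
    by (rule path_component_image[OF assms]) (auto intro!: continuous_on_det' continuous_intros simp: GL_iff_det)
  then obtain g where g: "path g" "path_image g \<subseteq> - {0}" "pathstart g = det A" "pathfinish g = det B"
    unfolding path_component_def by blast
  have "is_interval (path_image g)"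
    using connected_path_image[OF g(1)] is_interval_connected_1 by blast
  moreover have "det A \<in> path_image g" "det B \<in> path_image g"
    using g(3,4) pathstart_in_path_image pathfinish_in_path_image by metis+
  moreover have "0 \<notin> path_image g"
    using g(2) by blast
  ultimately have "\<not> (det A \<le> 0 \<and> 0 \<le> det B)" "\<not> (det B \<le> 0 \<and> 0 \<le> det A)"
    unfolding is_interval_1 by blast+
  then show ?thesis
    by (auto simp: zero_less_mult_iff)
qed

text \<open>Equal determinants exclude different normal forms, as c would be both positive and
  negative; so A and B are joined in \<open>GL\<close>. Multiplying row k of X by c / det X retracts
  \<open>GL\<close> onto the fibre and carries the path into it.\<close>

lemma path_connected_SL:
  assumes "c \<noteq> 0"
  shows "path_connected (SL c :: (real^'n^'n) set)"
  unfolding path_connected_component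
proof (intro ballI)
  fix A B :: "real^'n^'n" assume AB: "A \<in> SL c" "B \<in> SL c"
  then have GL: "A \<in> GL" "B \<in> GL" and det: "det A = c" "det B = c"
    by (auto simp: SL_def)
  define k :: 'n where "k = undefined"
  have "path_component GL A B"
    using path_component_GL_normal_form[OF GL(1), of k] path_component_GL_normal_form[OF GL(2), of k]
  proof (elim disjE)
    assume "path_component GL A (mat 1)" "path_component GL B (scaling k (-1))"
    from this[THEN path_component_GL_det_sign] show ?thesis
      by (simp add: det det_scaling)
  next
    assume "path_component GL A (scaling k (-1))" "path_component GL B (mat 1)"
    from this[THEN path_component_GL_det_sign] show ?thesis
      by (simp add: det det_scaling)
  qed (meson path_component_sym path_component_trans)+
  moreover have "continuous_on GL (\<lambda>X :: real^'n^'n. scaling k (c / det X) ** X)"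
    by (intro continuous_on_matrix_mult continuous_on_scaling continuous_intros continuous_on_det')
       (simp add: GL_iff_det)
  ultimately have "path_component (SL c) (scaling k (c / det A) ** A) (scaling k (c / det B) ** B)"
    by (rule path_component_image)
       (use assms in \<open>auto simp: SL_def GL_iff_det det_mul det_scaling\<close>)
  then show "path_component (SL c) A B"
    using assms by (simp add: det scaling_1)
qed

subsection \<open>Tangent spaces and charts of the general and special linear group\<close>

lemma tangent_space_open:
  assumes "open S" "p \<in> S"
  shows "tangent_space S p = UNIV"
proof -
  have "v \<in> tangent_space S p" for v
  proof -
    have "open ((\<lambda>t. p + t *\<^sub>R v) -` S)"
      using assms(1) by (intro open_vimage continuous_intros)
    moreover have "(0::real) \<in> (\<lambda>t. p + t *\<^sub>R v) -` S"
      using assms(2) by simp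
    ultimately obtain e where e: "e > 0" "ball (0::real) e \<subseteq> (\<lambda>t. p + t *\<^sub>R v) -` S"
      using openE by blast
    have "smooth_on {-e<..<e} (\<lambda>t. p + t *\<^sub>R v)"
      by (intro smooth_on_add smooth_on_scaleR smooth_on_const smooth_on_ident) auto
    moreover have "((\<lambda>t. p + t *\<^sub>R v) has_vector_derivative v) (at 0)"
      by (auto intro!: derivative_eq_intros simp: has_vector_derivative_def)
    moreover have "(\<lambda>t. p + t *\<^sub>R v) ` {-e<..<e} \<subseteq> S"
      using e(2) by (auto simp: subset_iff dist_real_def)
    ultimately have "(\<lambda>t. p + t *\<^sub>R v) \<in> curves_through S p v"
      unfolding curves_through_def using e(1) by auto
    then show ?thesis
      unfolding tangent_space_def by blast
  qed
  then show ?thesis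
    by blast
qed

lemma SL_subset_GL: "SL c \<subseteq> GL"
  by (auto simp: SL_def)

lemma SL_iff: "c \<noteq> 0 \<Longrightarrow> A \<in> SL c \<longleftrightarrow> det A = c"
  by (auto simp: SL_def GL_iff_det)

lemma matrix_exp_curve_SL:
  assumes "K \<in> SL c" "trace C = 0"
  shows "K ** matrix_exp (t *\<^sub>R C) \<in> SL c"
  using assms by (simp add: SL_def GL_mult matrix_exp_GL det_mul det_matrix_exp)

lemma smooth_on_matrix_mult:
  fixes f g :: "'a::euclidean_space \<Rightarrow> real^'n^'n"
  shows "open S \<Longrightarrow> smooth_on S f \<Longrightarrow> smooth_on S g \<Longrightarrow> smooth_on S (\<lambda>x. f x ** g x)"
  by (rule smooth_on_bilinear[OF bounded_bilinear_matrix_mult])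

lemma matrix_exp_curve_derivative:
  fixes K C :: "real^'n^'n"
  shows "((\<lambda>t. K ** matrix_exp (t *\<^sub>R C)) has_vector_derivative K ** (C ** matrix_exp (t *\<^sub>R C))) (at t)"
  by (rule bounded_linear.has_vector_derivative[OF mm.bounded_linear_right has_vector_derivative_matrix_exp])

lemma smooth_on_matrix_exp_curve:
  fixes K C :: "real^'n^'n"
  shows "smooth_on UNIV (\<lambda>t. K ** matrix_exp (t *\<^sub>R C))"
  by (intro smooth_on_matrix_mult smooth_on_const smooth_on_matrix_exp open_UNIV)

text \<open>Differentiating det = c along a curve gives the trace condition, as det p is nonzero.
  Conversely, p exp (t C) with C traceless stays in the fibre and has velocity p C.\<close>

lemma tangent_space_SL:
  fixes p :: "real^'n^'n"
  assumes "p \<in> SL c"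
  shows "tangent_space (SL c) p = {v. trace (matrix_inv p ** v) = 0}"
proof (intro set_eqI iffI)
  have GL: "p \<in> GL"
    using assms by (simp add: SL_def)
  fix v
  {
    assume "v \<in> tangent_space (SL c) p"
    then obtain \<gamma> where \<gamma>: "\<gamma> \<in> curves_through (SL c) p v"
      unfolding tangent_space_def by blast
    note \<gamma>' = curves_throughD[OF \<gamma>]
    have "((\<lambda>t. det (\<gamma> t)) has_vector_derivative det p * trace (matrix_inv p ** v)) (at 0)"
      using has_vector_derivative_det[OF \<gamma>'(2)] GL \<gamma>'(1) by simp
    moreover have "((\<lambda>t. det (\<gamma> t)) has_vector_derivative 0) (at 0)"
    proof (rule has_vector_derivative_transform_eventually)
      show "((\<lambda>t. c) has_vector_derivative 0) (at 0)"
        by (rule has_vector_derivative_const)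
      show "eventually (\<lambda>t. c = det (\<gamma> t)) (nhds 0)"
        using \<gamma>'(4) by eventually_elim (simp add: SL_def)
    qed
    ultimately have "det p * trace (matrix_inv p ** v) = 0"
      using vector_derivative_unique_at by blast
    then show "v \<in> {v. trace (matrix_inv p ** v) = 0}"
      using GL by (simp add: GL_iff_det)
  next
    assume v: "v \<in> {v. trace (matrix_inv p ** v) = 0}"
    define C where "C = matrix_inv p ** v"
    define \<gamma> where "\<gamma> = (\<lambda>t. p ** matrix_exp (t *\<^sub>R C))"
    have v_eq: "v = p ** C"
      using GL by (simp add: C_def matrix_cancel)
    have "(\<gamma> has_vector_derivative p ** (C ** matrix_exp (0 *\<^sub>R C))) (at 0)"
      unfolding \<gamma>_def by (rule matrix_exp_curve_derivative)
    then have "(\<gamma> has_vector_derivative v) (at 0)"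
      unfolding matrix_exp_0 v_eq by simp
    moreover have "\<gamma> 0 = p"
      unfolding \<gamma>_def matrix_exp_0 by simp
    moreover have "smooth_on {-1<..<1} \<gamma>"
      unfolding \<gamma>_def by (rule smooth_on_subset[OF smooth_on_matrix_exp_curve]) simp
    moreover have "\<gamma> t \<in> SL c" for t
      unfolding \<gamma>_def by (rule matrix_exp_curve_SL) (use assms v in \<open>auto simp: C_def\<close>)
    ultimately have "\<gamma> \<in> curves_through (SL c) p v"
      unfolding curves_through_def by (auto intro: exI[of _ 1])
    then show "v \<in> tangent_space (SL c) p"
      unfolding tangent_space_def by blast
  }
qed

text \<open>As \<open>det\<close> is affine in each entry, replacing an entry with nonzero cofactor by \<open>det - c\<close>
  is a chart, whose inverse solves an affine equation.\<close>

definition det_chart :: "real \<Rightarrow> 'n \<Rightarrow> 'n \<Rightarrow> real^'n^'n \<Rightarrow> real^'n^'n" where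
  "det_chart c i j A = A + (det A - c - A $ i $ j) *\<^sub>R unit_matrix i j"

definition det_chart_inv :: "real \<Rightarrow> 'n \<Rightarrow> 'n \<Rightarrow> real^'n^'n \<Rightarrow> real^'n^'n" where
  "det_chart_inv c i j B = B + ((c + B $ i $ j - det B) / cofactor B i j) *\<^sub>R unit_matrix i j"

definition cofactor_domain :: "'n \<Rightarrow> 'n \<Rightarrow> (real^'n^'n) set" where
  "cofactor_domain i j = {A. cofactor A i j \<noteq> 0}"

lemma det_chart_entry: "det_chart c i j A $ i $ j = det A - c"
  by (simp add: det_chart_def unit_matrix_nth)

text \<open>Both maps change only the entry (i, j), on which its own cofactor does not
  depend.\<close>

lemma det_chart_domain:
  "det_chart c i j A \<in> cofactor_domain i j \<longleftrightarrow> A \<in> cofactor_domain i j"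
  "det_chart_inv c i j A \<in> cofactor_domain i j \<longleftrightarrow> A \<in> cofactor_domain i j"
  by (simp_all add: det_chart_def det_chart_inv_def cofactor_domain_def cofactor_add_unit_matrix)

lemma det_chart_inv_det_chart:
  assumes "A \<in> cofactor_domain i j"
  shows "det_chart_inv c i j (det_chart c i j A) = A"
proof -
  define s where "s = det A - c - A $ i $ j"
  define k where "k = cofactor A i j"
  have \<phi>: "det_chart c i j A = A + s *\<^sub>R unit_matrix i j"
    by (simp add: det_chart_def s_def)
  have "cofactor (det_chart c i j A) i j = k" "det (det_chart c i j A) = det A + s * k"
    by (simp_all add: \<phi> cofactor_add_unit_matrix det_add_unit_matrix k_def)
  moreover have "(c + (det A - c) - (det A + s * k)) / k = - s"
    using assms by (simp add: k_def cofactor_domain_def)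
  ultimately have "det_chart_inv c i j (det_chart c i j A) = det_chart c i j A + (- s) *\<^sub>R unit_matrix i j"
    unfolding det_chart_inv_def[of c i j "det_chart c i j A"] det_chart_entry by simp
  then show ?thesis
    unfolding \<phi> by simp
qed

lemma det_chart_det_chart_inv:
  assumes "B \<in> cofactor_domain i j"
  shows "det_chart c i j (det_chart_inv c i j B) = B"
proof -
  \<comment> \<open>This t solves det B + t * \<open>cofactor B i j\<close> = c +
    \<open>B $ i $ j\<close>, which makes the determinant of the preimage exceed c by the prescribed
    entry of B.\<close>
  define t where "t = (c + B $ i $ j - det B) / cofactor B i j"
  have inv: "det_chart_inv c i j B = B + t *\<^sub>R unit_matrix i j"
    by (simp add: det_chart_inv_def t_def)
  have "det (B + t *\<^sub>R unit_matrix i j) = c + B $ i $ j"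
    using assms by (simp add: det_add_unit_matrix t_def cofactor_domain_def)
  then show ?thesis
    unfolding inv det_chart_def by (simp add: unit_matrix_nth)
qed

lemma smooth_on_det_chart: "open S \<Longrightarrow> smooth_on S (det_chart c i j)"
  unfolding det_chart_def
  by (intro smooth_on_add smooth_on_diff smooth_on_scaleR smooth_on_const smooth_on_ident smooth_on_det smooth_on_entry)

lemma open_cofactor_domain: "open (cofactor_domain i j)"
proof -
  have "continuous_on UNIV (\<lambda>A. cofactor A i j)"
    using smooth_on_cofactor[OF open_UNIV smooth_on_ident[OF open_UNIV], of i j]
    unfolding smooth_on_def by (metis Ck_on.simps(1))
  then show ?thesis
    unfolding cofactor_domain_def by (intro open_Collect_neq) auto
qed

lemma smooth_on_det_chart_inv: "smooth_on (cofactor_domain i j) (det_chart_inv c i j)"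
  unfolding det_chart_inv_def
  by (intro smooth_on_add smooth_on_diff smooth_on_scaleR smooth_on_divide smooth_on_const smooth_on_ident
      smooth_on_det smooth_on_entry smooth_on_cofactor open_cofactor_domain)
     (simp add: cofactor_domain_def)

lemma smooth_on_imp_continuous_on: "smooth_on S f \<Longrightarrow> continuous_on S f"
  using Ck_on.simps(1) unfolding smooth_on_def by metis

definition entry_zero :: "'n \<Rightarrow> 'n \<Rightarrow> (real^'n^'n) set" where
  "entry_zero i j = {B. B $ i $ j = 0}"

lemma entry_zero_eq: "entry_zero i j = {B. unit_matrix i j \<bullet> B = 0}"
  by (simp add: entry_zero_def unit_matrix_def inner_axis')

lemma subspace_entry_zero: "subspace (entry_zero i j)"
  unfolding entry_zero_eq by (rule subspace_hyperplane)

lemma dim_entry_zero: "dim (entry_zero i j :: (real^'n^'n) set) = CARD('n)\<^sup>2 - 1"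
proof -
  have "unit_matrix i j \<noteq> (0 :: real^'n^'n)"
    by (simp add: vec_eq_iff unit_matrix_nth)
  then show ?thesis
    unfolding entry_zero_eq by (simp add: dim_hyperplane power2_eq_square)
qed

text \<open>The image V is left free because a manifold chart can use the whole cofactor domain,
  while the foliation needs a ball as image.\<close>

lemma det_chart_slice:
  fixes i j :: "'n::finite" and c :: real
  assumes "open V" "V \<subseteq> cofactor_domain i j"
  defines "U \<equiv> {A \<in> cofactor_domain i j. det_chart c i j A \<in> V}"
  shows "open U" "det_chart c i j ` U = V" "diffeomorphism U V (det_chart c i j)"
    "\<And>A. A \<in> V \<Longrightarrow> det_chart_inv c i j A \<in> U"
proof -
  have "U = cofactor_domain i j \<inter> det_chart c i j -` V"
    by (auto simp: U_def)
  then show "open U"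
    using continuous_open_preimage[OF smooth_on_imp_continuous_on[OF smooth_on_det_chart[OF open_cofactor_domain]]
        open_cofactor_domain assms(1)] by simp
  show inv: "det_chart_inv c i j A \<in> U" if "A \<in> V" for A
    using that assms(2) by (auto simp: U_def det_chart_domain det_chart_det_chart_inv)
  show image: "det_chart c i j ` U = V"
  proof
    show "V \<subseteq> det_chart c i j ` U"
    proof
      fix A assume "A \<in> V"
      then have "A = det_chart c i j (det_chart_inv c i j A)"
        using assms(2) by (auto simp: det_chart_det_chart_inv)
      then show "A \<in> det_chart c i j ` U"
        using inv[OF \<open>A \<in> V\<close>] by blast
    qed
  qed (auto simp: U_def)
  have "smooth_map U (det_chart c i j)"
    by (rule smooth_map_smooth_on[OF open_UNIV]) (auto intro: smooth_on_det_chart)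
  moreover have "smooth_map V (det_chart_inv c i j)"
    by (rule smooth_map_smooth_on[OF assms(1)]) (auto intro: smooth_on_subset[OF smooth_on_det_chart_inv assms(2)])
  moreover have "\<forall>A\<in>U. det_chart_inv c i j (det_chart c i j A) = A"
    by (simp add: U_def det_chart_inv_det_chart)
  ultimately show "diffeomorphism U V (det_chart c i j)"
    unfolding diffeomorphism_def using image by blast
qed

lemma manifold_open: "open S \<Longrightarrow> manifold (DIM('a)) (S :: 'a::euclidean_space set)"
proof -
  assume S: "open S"
  have "slice_chart S S (\<lambda>x. x) (UNIV :: 'a set)"
    unfolding slice_chart_def diffeomorphism_def using S
    by (auto intro: smooth_map_ident exI[of _ "\<lambda>x. x"])
  then show ?thesis
    unfolding manifold_def by (metis dim_UNIV)
qed

lemma manifold_GL: "manifold (CARD('n)\<^sup>2) (GL :: (real^'n^'n) set)"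
  using manifold_open[OF open_GL[where 'n = 'n]] by (simp add: power2_eq_square)

lemma manifold_SL:
  assumes "c \<noteq> 0"
  shows "manifold (CARD('n)\<^sup>2 - 1) (SL c :: (real^'n^'n) set)"
  unfolding manifold_def
proof
  fix p :: "real^'n^'n" assume "p \<in> SL c"
  define i :: 'n where "i = undefined"
  obtain j where "cofactor p i j \<noteq> 0"
    using exists_cofactor_nonzero[of p] \<open>p \<in> SL c\<close> by (auto simp: SL_def)
  then have p: "p \<in> cofactor_domain i j"
    by (simp add: cofactor_domain_def)
  have dom: "{A \<in> cofactor_domain i j. det_chart c i j A \<in> cofactor_domain i j} = cofactor_domain i j"
    by (auto simp: det_chart_domain)
  note chart = det_chart_slice[where c = c and i = i and j = j, OF open_cofactor_domain subset_refl, unfolded dom]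
  have "slice_chart (SL c) (cofactor_domain i j) (det_chart c i j) (entry_zero i j)"
    unfolding slice_chart_def
  proof (intro conjI)
    have "det_chart c i j ` (cofactor_domain i j \<inter> SL c) = det_chart c i j ` cofactor_domain i j \<inter> entry_zero i j"
    proof -
      have "A \<in> SL c \<longleftrightarrow> det_chart c i j A \<in> entry_zero i j" for A
        using assms by (simp add: entry_zero_def det_chart_entry SL_iff)
      then show ?thesis
        by blast
    qed
    then show "det_chart c i j ` (cofactor_domain i j \<inter> SL c) = det_chart c i j ` cofactor_domain i j \<inter> entry_zero i j" .
  qed (use chart open_cofactor_domain subspace_entry_zero in simp_all)
  then show "\<exists>U \<phi> F. p \<in> U \<and> slice_chart (SL c) U \<phi> F \<and> dim F = CARD('n)\<^sup>2 - 1"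
    using p dim_entry_zero by blast
qed

section \<open>The foliation by the level sets of the determinant\<close>

lemma GL_eq_Union_SL: "(GL :: (real^'n^'n) set) = (\<Union>c\<in>-{0}. SL c)"
  by (auto simp: SL_def GL_iff_det)

text \<open>With parameter 0 the chart makes the determinant itself the entry (i, j), so a single
  chart flattens all leaves at once into the parallel hyperplanes
  \<open>B $ i $ j = c\<close>.\<close>

lemma foliation_SL: "foliation (GL :: (real^'n^'n) set) (CARD('n)\<^sup>2 - 1) (SL ` (-{0}))"
  unfolding foliation_def
proof (intro conjI)
  show "\<exists>m. manifold m (GL :: (real^'n^'n) set)"
    using manifold_GL by blast
  show "\<Union> (SL ` (- {0})) = (GL :: (real^'n^'n) set)"
    by (rule GL_eq_Union_SL[symmetric])
  show "pairwise disjnt (SL ` (- {0}) :: (real^'n^'n) set set)"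
    by (auto simp: pairwise_def disjnt_def SL_def)
  show "\<forall>L\<in>SL ` (- {0}). L \<noteq> {} \<and> path_connected (L :: (real^'n^'n) set)"
  proof (intro ballI conjI)
    fix L :: "(real^'n^'n) set" assume "L \<in> SL ` (- {0})"
    then obtain c where c: "c \<noteq> 0" "L = SL c"
      by auto
    have "scaling undefined c \<in> L"
      using c by (simp add: SL_iff det_scaling)
    then show "L \<noteq> {}"
      by blast
    show "path_connected L"
      using path_connected_SL c by blast
  qed
  show "\<forall>p\<in>GL. \<exists>U \<phi> F E. p \<in> U \<and> slice_chart GL U \<phi> F \<and> subspace E \<and> E \<subseteq> F \<and>
      dim E = CARD('n)\<^sup>2 - 1 \<and>
      (\<forall>L\<in>SL ` (- {0}). \<forall>C\<in>components (U \<inter> L). \<exists>v. C = {q \<in> U \<inter> (GL :: (real^'n^'n) set). \<phi> q - v \<in> E})"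
  proof
    fix p :: "real^'n^'n" assume "p \<in> GL"
    define i :: 'n where "i = undefined"
    obtain j where "cofactor p i j \<noteq> 0"
      using exists_cofactor_nonzero[OF \<open>p \<in> GL\<close>] by blast
    then have p: "p \<in> cofactor_domain i j"
      by (simp add: cofactor_domain_def)
    define \<phi> where "\<phi> = det_chart 0 i j"
    define \<psi> where "\<psi> = det_chart_inv 0 i j"
    have cont: "continuous_on (cofactor_domain i j) \<psi>"
      unfolding \<psi>_def by (rule smooth_on_imp_continuous_on[OF smooth_on_det_chart_inv])
    have "open (cofactor_domain i j \<inter> \<psi> -` GL)"
      by (rule continuous_open_preimage[OF cont open_cofactor_domain open_GL])
    moreover have "\<phi> p \<in> cofactor_domain i j \<inter> \<psi> -` GL"
      using p \<open>p \<in> GL\<close> by (simp add: \<phi>_def \<psi>_def det_chart_domain det_chart_inv_det_chart)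
    ultimately obtain e where e: "e > 0" "ball (\<phi> p) e \<subseteq> cofactor_domain i j \<inter> \<psi> -` GL"
      using openE by blast
    \<comment> \<open>A ball cut by a hyperplane is convex, hence connected, so a leaf meets
      \<open>U\<close> in at most one plaque.\<close>
    define V where "V = ball (\<phi> p) e"
    define U where "U = {A \<in> cofactor_domain i j. \<phi> A \<in> V}"
    have V: "open V" "V \<subseteq> cofactor_domain i j"
      using e(2) by (auto simp: V_def)
    note chart = det_chart_slice[where c = 0, OF V, folded \<phi>_def \<psi>_def, folded U_def]
    have inv: "\<psi> (\<phi> A) = A" if "A \<in> U" for A
      using that by (simp add: U_def \<phi>_def \<psi>_def det_chart_inv_det_chart)
    have U_GL: "U \<subseteq> GL"
    proof
      fix A assume "A \<in> U"
      then have "\<psi> (\<phi> A) \<in> GL"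
        using e(2) by (auto simp: U_def V_def)
      then show "A \<in> GL"
        using inv[OF \<open>A \<in> U\<close>] by simp
    qed
    have leaf: "C = {q \<in> U \<inter> GL. \<phi> q - c *\<^sub>R unit_matrix i j \<in> entry_zero i j}"
      if "c \<noteq> 0" "C \<in> components (U \<inter> SL c)" for c C
    proof -
      have eq: "U \<inter> SL c = {q \<in> U \<inter> GL. \<phi> q - c *\<^sub>R unit_matrix i j \<in> entry_zero i j}"
        using U_GL \<open>c \<noteq> 0\<close>
        by (auto simp: entry_zero_def \<phi>_def det_chart_entry SL_def unit_matrix_nth)
      have "U \<inter> SL c = \<psi> ` (V \<inter> {B. unit_matrix i j \<bullet> B = c})"
      proof (intro set_eqI iffI)
        fix A assume A: "A \<in> U \<inter> SL c"
        then have "\<phi> A \<in> V \<inter> {B. unit_matrix i j \<bullet> B = c}"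
          by (auto simp: U_def SL_def unit_matrix_def inner_axis' \<phi>_def det_chart_entry)
        then show "A \<in> \<psi> ` (V \<inter> {B. unit_matrix i j \<bullet> B = c})"
          using A inv[of A] by (metis IntD1 image_eqI)
      next
        fix A assume "A \<in> \<psi> ` (V \<inter> {B. unit_matrix i j \<bullet> B = c})"
        then obtain B where B: "B \<in> V" "B $ i $ j = c" "A = \<psi> B"
          by (auto simp: unit_matrix_def inner_axis')
        then have "A \<in> U"
          using chart(4) by simp
        moreover have "det A = \<phi> A $ i $ j"
          by (simp add: \<phi>_def det_chart_entry)
        moreover have "\<phi> A = B"
          using B V(2) by (auto simp: \<phi>_def \<psi>_def det_chart_det_chart_inv)
        ultimately show "A \<in> U \<inter> SL c"
          using B(2) \<open>c \<noteq> 0\<close> by (simp add: SL_iff)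
      qed
      moreover have "connected (V \<inter> {B. unit_matrix i j \<bullet> B = c})"
        unfolding V_def by (intro convex_connected convex_Int convex_ball convex_hyperplane)
      ultimately have "connected (U \<inter> SL c)"
        using connected_continuous_image continuous_on_subset[OF cont] V(2) by (metis le_infI1)
      then have "components (U \<inter> SL c) \<subseteq> {U \<inter> SL c}"
        by (simp add: connected_eq_components_subset_sing)
      then show ?thesis
        using that(2) eq by blast
    qed
    have "slice_chart GL U \<phi> UNIV"
      unfolding slice_chart_def using chart V(1) U_GL by (auto simp: Int_absorb2)
    moreover have "p \<in> U"
      using p e(1) by (simp add: U_def V_def)
    ultimately show "\<exists>U \<phi> F E. p \<in> U \<and> slice_chart GL U \<phi> F \<and> subspace E \<and> E \<subseteq> F \<and>
      dim E = CARD('n)\<^sup>2 - 1 \<and>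
      (\<forall>L\<in>SL ` (- {0}). \<forall>C\<in>components (U \<inter> L). \<exists>v. C = {q \<in> U \<inter> GL. \<phi> q - v \<in> E})"
      using leaf subspace_entry_zero dim_entry_zero
      by (intro exI[of _ U] exI[of _ \<phi>] exI[of _ UNIV] exI[of _ "entry_zero i j"]) auto
  qed
qed

subsection \<open>The Levi-Civita connection of the trace metric\<close>

definition bracket :: "real^'n^'n \<Rightarrow> real^'n^'n \<Rightarrow> real^'n^'n" where
  "bracket x y = x ** y - y ** x"

lemma bounded_bilinear_bracket: "bounded_bilinear (bracket :: real^'n^'n \<Rightarrow> real^'n^'n \<Rightarrow> real^'n^'n)"
proof -
  have "bilinear (bracket :: real^'n^'n \<Rightarrow> real^'n^'n \<Rightarrow> real^'n^'n)"
    unfolding bilinear_def bracket_def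
    by (auto intro!: linearI simp: mm_distribs algebra_simps)
  then show ?thesis
    by (simp add: bilinear_conv_bounded_bilinear)
qed

interpretation br: bounded_bilinear "bracket :: real^'n^'n \<Rightarrow> real^'n^'n \<Rightarrow> real^'n^'n"
  by (rule bounded_bilinear_bracket)

lemmas bracket_distribs = br.add_left br.add_right br.diff_left br.diff_right
  br.scaleR_left br.scaleR_right

lemma bracket_commute: "bracket x y = - bracket y x"
  by (simp add: bracket_def)

lemma bracket_self: "bracket x x = 0"
  by (simp add: bracket_def)

lemma jacobi_bracket: "bracket (bracket x y) z = bracket x (bracket y z) - bracket y (bracket x z)"
  by (simp add: bracket_def mm_distribs matrix_mul_assoc algebra_simps)

lemma trace_bracket: "trace (bracket x y) = 0" for x y :: "real^'n^'n"
  by (simp add: bracket_def trace_sub trace_mul_sym[of x y])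

text \<open>The map ad x is skew for the trace form; this makes the bracket terms of the connection
  cancel in metric compatibility.\<close>

lemma trace_bracket_invariant: "trace (bracket x y ** z) = - trace (y ** bracket x z)"
  for x y z :: "real^'n^'n"
proof -
  have "trace (x ** y ** z) = trace (y ** z ** x)"
    by (metis matrix_mul_assoc trace_mul_sym)
  then show ?thesis
    by (simp add: bracket_def mm_distribs trace_distribs matrix_mul_assoc)
qed

lemma trace_metric_left: "p \<in> GL \<Longrightarrow> trace_metric p (p ** x) (p ** y) = trace (x ** y)"
  by (simp add: trace_metric_def matrix_mul_assoc[symmetric] matrix_cancel)

lemma trace_metric_eq: "trace_metric p v w = trace ((matrix_inv p ** v) ** (matrix_inv p ** w))"
  by (simp add: trace_metric_def matrix_mul_assoc)

lemma trace_transpose_mult: "trace (x ** transpose x) = x \<bullet> x" for x :: "real^'n^'n"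
  by (simp add: trace_def matrix_matrix_mult_def transpose_def inner_vec_def)

lemma trace_transpose: "trace (transpose x) = trace x"
  by (simp add: trace_def transpose_def)

text \<open>The general linear group (\<open>r = 0\<close>) and the leaves \<open>SL c\<close> (\<open>r = 1\<close>) are treated at once:
  the tangent spaces are the left translates of \<open>{x. r * trace x = 0}\<close>.\<close>

locale trace_group =
  fixes M :: "(real^'n^'n) set" and r :: real
  assumes subset_GL: "M \<subseteq> GL"
    and tangent: "p \<in> M \<Longrightarrow> tangent_space M p = {v. r * trace (matrix_inv p ** v) = 0}"
    and r_cases: "r = 0 \<or> r = 1"
begin

lemma GL: "p \<in> M \<Longrightarrow> p \<in> GL"
  using subset_GL by blast

lemma left_mult_tangent_iff: "p \<in> M \<Longrightarrow> p ** x \<in> tangent_space M p \<longleftrightarrow> r * trace x = 0"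
  using GL by (simp add: tangent matrix_cancel)

lemma tangentE:
  assumes "p \<in> M" "v \<in> tangent_space M p"
  obtains x where "v = p ** x" "r * trace x = 0" "x = matrix_inv p ** v"
  using assms GL by (metis left_mult_tangent_iff matrix_inv_cancel_right)

lemma subspace_tangent: "p \<in> M \<Longrightarrow> subspace (tangent_space M p)"
  unfolding tangent subspace_def
  by (auto simp: mm_distribs trace_distribs distrib_left)

text \<open>Left trivialisation: it recovers \<xi> from a field given as
  \<open>p ** \<xi> p\<close>.\<close>

definition ltr :: "(real^'n^'n \<Rightarrow> real^'n^'n) \<Rightarrow> real^'n^'n \<Rightarrow> real^'n^'n" where
  "ltr X p = matrix_inv p ** X p"

lemma left_mult_ltr: "p \<in> M \<Longrightarrow> p ** ltr X p = X p"
  using GL by (simp add: ltr_def matrix_cancel)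

lemma smooth_map_ltr: "smooth_map M X \<Longrightarrow> smooth_map M (ltr X)"
  unfolding ltr_def
  by (intro smooth_map_bilinear[OF bounded_bilinear_matrix_mult]
      smooth_map_smooth_on[OF open_GL smooth_on_matrix_inv subset_GL])

lemma vector_fieldD:
  assumes "X \<in> vector_fields M"
  shows "smooth_map M X" "smooth_map M (ltr X)"
    and "p \<in> M \<Longrightarrow> X p \<in> tangent_space M p" "p \<in> M \<Longrightarrow> r * trace (ltr X p) = 0"
  using assms smooth_map_ltr left_mult_tangent_iff left_mult_ltr
  by (auto simp: vector_fields_def) (metis left_mult_ltr left_mult_tangent_iff mult_eq_0_iff)

lemma vector_fieldI:
  assumes "smooth_map M \<xi>" "\<And>p. p \<in> M \<Longrightarrow> r * trace (\<xi> p) = 0"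
  shows "(\<lambda>p. p ** \<xi> p) \<in> vector_fields M"
  unfolding vector_fields_def
  using assms left_mult_tangent_iff
  by (auto intro!: smooth_map_bilinear[OF bounded_bilinear_matrix_mult] smooth_map_ident)

lemma vector_field_cong:
  "X \<in> vector_fields M \<Longrightarrow> (\<And>p. p \<in> M \<Longrightarrow> Y p = X p) \<Longrightarrow> Y \<in> vector_fields M"
  unfolding vector_fields_def using smooth_map_cong[of M X Y] by auto

lemma left_invariant_field: "r * trace x = 0 \<Longrightarrow> (\<lambda>q. q ** x) \<in> vector_fields M"
  by (rule vector_fieldI) (auto intro: smooth_map_const)

text \<open>The left-invariant field through v is defined on all of \<open>M\<close>, so no cut-off
  function is involved.\<close>

lemma extend_tangent:
  assumes "p \<in> M" "v \<in> tangent_space M p"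
  obtains X where "X \<in> vector_fields M" "X p = v"
  using tangentE[OF assms] left_invariant_field by metis

text \<open>The function r * trace \<xi> vanishes on \<open>M\<close>, hence so does its
  differential in tangent directions.\<close>

lemma differential_trace_zero:
  fixes \<xi> :: "real^'n^'n \<Rightarrow> real^'n^'n"
  assumes "smooth_map M \<xi>" "\<And>p. p \<in> M \<Longrightarrow> r * trace (\<xi> p) = 0" "p \<in> M" "v \<in> tangent_space M p"
  shows "r * trace (differential M \<xi> p v) = 0"
proof -
  have lin: "bounded_linear (\<lambda>x :: real^'n^'n. r * trace x)"
    by (rule bounded_linear_const_mult[OF bounded_linear_trace])
  have "r * trace (differential M \<xi> p v) = differential M (\<lambda>q. r * trace (\<xi> q)) p v"
    by (rule differential_linear[OF lin assms(4,1), symmetric])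
  also have "\<dots> = differential M (\<lambda>q. 0) p v"
    by (rule differential_cong[OF assms(4) smooth_map_linear[OF lin assms(1)]]) (rule assms(2))
  finally show ?thesis
    by (simp only: differential_const[OF assms(4)])
qed

lemma differential_ltr_trace:
  assumes "X \<in> vector_fields M" "Y \<in> vector_fields M" "p \<in> M"
  shows "r * trace (differential M (ltr Y) p (X p)) = 0"
  by (rule differential_trace_zero[OF vector_fieldD(2)[OF assms(2)] vector_fieldD(4)[OF assms(2)] assms(3)
        vector_fieldD(3)[OF assms(1,3)]])

lemma differential_field:
  assumes "Y \<in> vector_fields M" "p \<in> M" "v \<in> tangent_space M p"
  shows "differential M Y p v = p ** differential M (ltr Y) p v + v ** ltr Y p"
proof -
  have "differential M Y p v = differential M (\<lambda>q. q ** ltr Y q) p v"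
    by (rule differential_cong[OF assms(3) vector_fieldD(1)[OF assms(1)]]) (simp add: left_mult_ltr)
  then show ?thesis
    using differential_bilinear[OF bounded_bilinear_matrix_mult assms(3) smooth_map_ident vector_fieldD(2)[OF assms(1)]]
    by (simp add: differential_ident[OF assms(3)])
qed

section \<open>The Lie bracket in left trivialisation\<close>

text \<open>For Y = p \<eta> the Leibniz rule gives dY(X) = p d\<eta>(X) + (X p) \<eta>, and X p = p
  \<xi> turns the last term into p \<xi> \<eta>. Antisymmetrising produces the matrix
  commutator.\<close>

lemma lie_bracket_eq:
  assumes "X \<in> vector_fields M" "Y \<in> vector_fields M" "p \<in> M"
  shows "lie_bracket M X Y p = p ** (differential M (ltr Y) p (X p) - differential M (ltr X) p (Y p)
    + bracket (ltr X p) (ltr Y p))"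
proof -
  note T = vector_fieldD(3)[OF assms(1,3)] vector_fieldD(3)[OF assms(2,3)]
  have "X p ** ltr Y p = p ** (ltr X p ** ltr Y p)" "Y p ** ltr X p = p ** (ltr Y p ** ltr X p)"
    by (simp_all add: matrix_mul_assoc left_mult_ltr assms(3))
  then show ?thesis
    unfolding lie_bracket_def differential_field[OF assms(2,3) T(1)] differential_field[OF assms(1,3) T(2)]
    by (simp add: bracket_def mm_distribs)
qed

lemma ltr_lie_bracket:
  assumes "X \<in> vector_fields M" "Y \<in> vector_fields M" "p \<in> M"
  shows "ltr (lie_bracket M X Y) p = differential M (ltr Y) p (X p) - differential M (ltr X) p (Y p)
    + bracket (ltr X p) (ltr Y p)"
  using GL[OF assms(3)] by (simp add: ltr_def[of "lie_bracket M X Y"] lie_bracket_eq[OF assms] matrix_cancel)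

lemma smooth_map_bracket: "smooth_map M f \<Longrightarrow> smooth_map M g \<Longrightarrow> smooth_map M (\<lambda>q. bracket (f q) (g q))"
  by (rule smooth_map_bilinear[OF bounded_bilinear_bracket])

text \<open>Tangency, hidden in the ambient coordinate formula, becomes the vanishing of a
  trace.\<close>

lemma lie_bracket_field:
  assumes "X \<in> vector_fields M" "Y \<in> vector_fields M"
  shows "lie_bracket M X Y \<in> vector_fields M"
proof (rule vector_field_cong)
  show "(\<lambda>p. p ** (differential M (ltr Y) p (X p) - differential M (ltr X) p (Y p)
      + bracket (ltr X p) (ltr Y p))) \<in> vector_fields M"
  proof (rule vector_fieldI)
    show "smooth_map M (\<lambda>p. differential M (ltr Y) p (X p) - differential M (ltr X) p (Y p)
        + bracket (ltr X p) (ltr Y p))"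
      by (intro smooth_map_add smooth_map_diff smooth_map_differential smooth_map_bracket vector_fieldD(2) assms)
  next
    fix p assume p: "p \<in> M"
    show "r * trace (differential M (ltr Y) p (X p) - differential M (ltr X) p (Y p)
        + bracket (ltr X p) (ltr Y p)) = 0"
      using differential_ltr_trace[OF assms p] differential_ltr_trace[OF assms(2,1) p]
      by (auto simp: trace_distribs trace_bracket)
  qed
qed (rule lie_bracket_eq[OF assms])

definition connection :: "(real^'n^'n \<Rightarrow> real^'n^'n) \<Rightarrow> (real^'n^'n \<Rightarrow> real^'n^'n) \<Rightarrow> real^'n^'n \<Rightarrow> real^'n^'n" where
  "connection X Y p = p ** (differential M (ltr Y) p (X p) + (1/2) *\<^sub>R bracket (ltr X p) (ltr Y p))"

lemma connection_field:
  assumes "X \<in> vector_fields M" "Y \<in> vector_fields M"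
  shows "connection X Y \<in> vector_fields M"
  unfolding connection_def[abs_def]
proof (rule vector_fieldI)
  show "smooth_map M (\<lambda>p. differential M (ltr Y) p (X p) + (1/2) *\<^sub>R bracket (ltr X p) (ltr Y p))"
    by (intro smooth_map_add smooth_map_differential smooth_map_bilinear[OF bounded_bilinear_scaleR]
        smooth_map_const smooth_map_bracket vector_fieldD(2) assms)
  fix p assume p: "p \<in> M"
  show "r * trace (differential M (ltr Y) p (X p) + (1/2) *\<^sub>R bracket (ltr X p) (ltr Y p)) = 0"
    using differential_ltr_trace[OF assms p] by (simp add: trace_distribs trace_bracket)
qed

lemma ltr_connection:
  assumes "p \<in> M"
  shows "ltr (connection X Y) p = differential M (ltr Y) p (X p) + (1/2) *\<^sub>R bracket (ltr X p) (ltr Y p)"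
  using GL[OF assms] by (simp add: ltr_def[of "connection X Y"] connection_def matrix_cancel)

lemma ltr_scaleR: "ltr (\<lambda>q. f q *\<^sub>R X q) = (\<lambda>q. f q *\<^sub>R ltr X q)"
  by (simp add: fun_eq_iff ltr_def mm.scaleR_right)

lemma ltr_add: "ltr (\<lambda>q. X q + Y q) = (\<lambda>q. ltr X q + ltr Y q)"
  by (simp add: fun_eq_iff ltr_def mm.add_right)

lemma is_levi_civita_connection: "is_levi_civita M trace_metric connection"
  unfolding is_levi_civita_def
proof (intro conjI ballI allI impI)
  fix X Y assume "X \<in> vector_fields M" "Y \<in> vector_fields M"
  then show "connection X Y \<in> vector_fields M"
    by (rule connection_field)
next
  fix X X' Y and f h :: "real^'n^'n \<Rightarrow> real" and p
  assume *: "X \<in> vector_fields M" "X' \<in> vector_fields M" "Y \<in> vector_fields M"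
    "smooth_map M f \<and> smooth_map M h" "p \<in> M"
  note T = vector_fieldD(3)[OF *(1,5)] vector_fieldD(3)[OF *(2,5)]
  have "f p *\<^sub>R X p + h p *\<^sub>R X' p \<in> tangent_space M p"
    using subspace_tangent[OF *(5)] T by (intro subspace_add subspace_scale)
  then have "differential M (ltr Y) p (f p *\<^sub>R X p + h p *\<^sub>R X' p) =
      f p *\<^sub>R differential M (ltr Y) p (X p) + h p *\<^sub>R differential M (ltr Y) p (X' p)"
    by (rule differential_lincomb[OF vector_fieldD(2)[OF *(3)] *(5) T])
  then show "connection (\<lambda>q. f q *\<^sub>R X q + h q *\<^sub>R X' q) Y p = f p *\<^sub>R connection X Y p + h p *\<^sub>R connection X' Y p"
    by (simp add: connection_def ltr_add ltr_scaleR bracket_distribs mm_distribs scaleR_add_right add_ac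
        mult.commute)
next
  fix X Y Y' and a b :: real and p
  assume *: "X \<in> vector_fields M" "Y \<in> vector_fields M" "Y' \<in> vector_fields M" "p \<in> M"
  note T = vector_fieldD(3)[OF *(1,4)]
  note lin = bounded_linear_scaleR_right[of a] bounded_linear_scaleR_right[of b]
  have "differential M (\<lambda>q. a *\<^sub>R ltr Y q + b *\<^sub>R ltr Y' q) p (X p) =
      a *\<^sub>R differential M (ltr Y) p (X p) + b *\<^sub>R differential M (ltr Y') p (X p)"
    using differential_add[OF T smooth_map_linear[OF lin(1) vector_fieldD(2)[OF *(2)]]
        smooth_map_linear[OF lin(2) vector_fieldD(2)[OF *(3)]]]
    by (simp add: differential_linear[OF lin(1) T vector_fieldD(2)[OF *(2)]]
        differential_linear[OF lin(2) T vector_fieldD(2)[OF *(3)]])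
  then show "connection X (\<lambda>q. a *\<^sub>R Y q + b *\<^sub>R Y' q) p = a *\<^sub>R connection X Y p + b *\<^sub>R connection X Y' p"
    by (simp add: connection_def ltr_add ltr_scaleR bracket_distribs mm_distribs scaleR_add_right add_ac
        mult.commute)
next
  fix X Y and f :: "real^'n^'n \<Rightarrow> real" and p
  assume *: "X \<in> vector_fields M" "Y \<in> vector_fields M" "smooth_map M f" "p \<in> M"
  note T = vector_fieldD(3)[OF *(1,4)]
  have "differential M (\<lambda>q. f q *\<^sub>R ltr Y q) p (X p) =
      f p *\<^sub>R differential M (ltr Y) p (X p) + differential M f p (X p) *\<^sub>R ltr Y p"
    by (rule differential_bilinear[OF bounded_bilinear_scaleR T *(3) vector_fieldD(2)[OF *(2)]])
  then show "connection X (\<lambda>q. f q *\<^sub>R Y q) p = differential M f p (X p) *\<^sub>R Y p + f p *\<^sub>R connection X Y p"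
    by (simp add: connection_def ltr_scaleR bracket_distribs mm_distribs scaleR_add_right add_ac
        mult.commute left_mult_ltr[OF *(4)])
next
  fix X Y p
  assume *: "X \<in> vector_fields M" "Y \<in> vector_fields M" "p \<in> M"
  \<comment> \<open>The half bracket is skew, so it occurs twice in the difference and adds up to
    the full bracket of \<open>lie_bracket_eq\<close>.\<close>
  have "differential M (ltr Y) p (X p) - differential M (ltr X) p (Y p) + bracket (ltr X p) (ltr Y p) =
      (differential M (ltr Y) p (X p) + (1/2) *\<^sub>R bracket (ltr X p) (ltr Y p)) -
      (differential M (ltr X) p (Y p) + (1/2) *\<^sub>R bracket (ltr Y p) (ltr X p))"
    by (simp add: bracket_commute[of "ltr Y p" "ltr X p"] vec_eq_iff)
  then show "lie_bracket M X Y p = connection X Y p - connection Y X p"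
    by (simp only: connection_def lie_bracket_eq[OF *] mm.diff_right[symmetric])
next
  fix X Y Z p
  assume *: "X \<in> vector_fields M" "Y \<in> vector_fields M" "Z \<in> vector_fields M" "p \<in> M"
  note T = vector_fieldD(3)[OF *(1,4)]
  note sm = vector_fieldD(2)[OF *(2)] vector_fieldD(2)[OF *(3)]
  note sm' = smooth_map_bilinear[OF bounded_bilinear_matrix_mult sm]
  have "differential M (\<lambda>q. trace_metric q (Y q) (Z q)) p (X p) = differential M (\<lambda>q. trace (ltr Y q ** ltr Z q)) p (X p)"
    by (simp add: trace_metric_eq ltr_def)
  also have "\<dots> = trace (ltr Y p ** differential M (ltr Z) p (X p) + differential M (ltr Y) p (X p) ** ltr Z p)"
    unfolding differential_linear[OF bounded_linear_trace T sm']
      differential_bilinear[OF bounded_bilinear_matrix_mult T sm] ..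
  \<comment> \<open>The two half brackets cancel by ad-invariance of the trace form.\<close>
  also have "\<dots> = trace_metric p (connection X Y p) (Z p) + trace_metric p (Y p) (connection X Z p)"
  proof -
    have "trace_metric p (connection X Y p) (Z p) = trace (ltr (connection X Y) p ** ltr Z p)"
      "trace_metric p (Y p) (connection X Z p) = trace (ltr Y p ** ltr (connection X Z) p)"
      by (simp_all add: trace_metric_eq ltr_def)
    then show ?thesis
      by (simp add: ltr_connection[OF *(4)] mm_distribs trace_distribs trace_bracket_invariant)
  qed
  finally show "differential M (\<lambda>q. trace_metric q (Y q) (Z q)) p (X p) =
      trace_metric p (connection X Y p) (Z p) + trace_metric p (Y p) (connection X Z p)" .
qed

section \<open>Nondegeneracy of the metric and uniqueness of its connection\<close>

text \<open>Testing against the transpose of x, which obeys the same trace condition, gives the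
  squared Euclidean norm of x.\<close>

lemma trace_form_nondegenerate:
  assumes "r * trace x = 0" "\<And>y. r * trace y = 0 \<Longrightarrow> trace (x ** y) = 0"
  shows "x = 0"
  using assms(2)[of "transpose x"] assms(1) by (simp add: trace_transpose trace_transpose_mult)

lemma trace_metric_nondegenerate:
  assumes "p \<in> M" "v \<in> tangent_space M p" "\<And>w. w \<in> tangent_space M p \<Longrightarrow> trace_metric p v w = 0"
  shows "v = 0"
proof -
  obtain x where x: "v = p ** x" "r * trace x = 0"
    using tangentE[OF assms(1,2)] by metis
  have "x = 0"
  proof (rule trace_form_nondegenerate[OF x(2)])
    fix y :: "real^'n^'n" assume "r * trace y = 0"
    then have "trace_metric p v (p ** y) = 0"
      using assms(1,3) left_mult_tangent_iff by blast
    then show "trace (x ** y) = 0"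
      using GL[OF assms(1)] by (simp add: x(1) trace_metric_left)
  qed
  then show ?thesis
    by (simp add: x(1) mm.zero_right)
qed

lemma trace_metric_bilinear:
  "trace_metric p (u + v) w = trace_metric p u w + trace_metric p v w"
  "trace_metric p (u - v) w = trace_metric p u w - trace_metric p v w"
  "trace_metric p (a *\<^sub>R u) w = a * trace_metric p u w"
  for u v w :: "real^'n^'n"
  by (simp_all add: trace_metric_eq mm_distribs trace_distribs)

lemma trace_metric_commute: "trace_metric p v w = trace_metric p w v" for p :: "real^'n^'n"
  unfolding trace_metric_eq by (rule trace_mul_sym)

lemma levi_civitaD:
  assumes "is_levi_civita M g D"
  shows "\<forall>X\<in>vector_fields M. \<forall>Y\<in>vector_fields M. D X Y \<in> vector_fields M"
    and "\<forall>X\<in>vector_fields M. \<forall>Y\<in>vector_fields M. \<forall>p\<in>M.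
       lie_bracket M X Y p = D X Y p - D Y X p"
    and "\<forall>X\<in>vector_fields M. \<forall>Y\<in>vector_fields M. \<forall>Z\<in>vector_fields M. \<forall>p\<in>M.
       differential M (\<lambda>q. g q (Y q) (Z q)) p (X p) = g p (D X Y p) (Z p) + g p (Y p) (D X Z p)"
  using assms unfolding is_levi_civita_def by - (elim conjE, assumption)+

text \<open>The difference of two torsion-free metric connections is symmetric in its first two and
  skew in its last two arguments, hence zero.\<close>

lemma levi_civita_unique:
  assumes D: "is_levi_civita M trace_metric D" and D': "is_levi_civita M trace_metric D'"
    and X: "X \<in> vector_fields M" and Y: "Y \<in> vector_fields M" and p: "p \<in> M"
  shows "D X Y p = D' X Y p"
proof -
  define s where "s = (\<lambda>X Y. D X Y p - D' X Y p)"
  define a where "a = (\<lambda>X Y Z. trace_metric p (s X Y) (Z p))"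
  have sym: "a X Y Z = a Y X Z" if "X \<in> vector_fields M" "Y \<in> vector_fields M" for X Y Z
  proof -
    have "lie_bracket M X Y p = D X Y p - D Y X p" "lie_bracket M X Y p = D' X Y p - D' Y X p"
      using levi_civitaD(2)[OF D] levi_civitaD(2)[OF D'] that p by blast+
    then have "D X Y p - D' X Y p = D Y X p - D' Y X p"
      by (simp add: algebra_simps)
    then show ?thesis
      by (simp add: a_def s_def)
  qed
  have skew: "a X Y Z = - a X Z Y"
    if "X \<in> vector_fields M" "Y \<in> vector_fields M" "Z \<in> vector_fields M" for X Y Z
  proof -
    have "differential M (\<lambda>q. trace_metric q (Y q) (Z q)) p (X p) =
        trace_metric p (D X Y p) (Z p) + trace_metric p (Y p) (D X Z p)"
      using levi_civitaD(3)[OF D] that p by blast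
    moreover have "differential M (\<lambda>q. trace_metric q (Y q) (Z q)) p (X p) =
        trace_metric p (D' X Y p) (Z p) + trace_metric p (Y p) (D' X Z p)"
      using levi_civitaD(3)[OF D'] that p by blast
    ultimately show ?thesis
      by (simp add: a_def s_def trace_metric_bilinear trace_metric_commute[of p "Y p"])
  qed
  have zero: "a X Y Z = 0" if Z: "Z \<in> vector_fields M" for Z
  proof -
    \<comment> \<open>The six exchanges lead back to the start with three sign changes, so a = -
      a.\<close>
    have "a X Y Z = - a X Z Y" "a X Z Y = a Z X Y" "a Z X Y = - a Z Y X" "a Z Y X = a Y Z X"
      "a Y Z X = - a Y X Z" "a Y X Z = a X Y Z"
      using sym skew X Y Z by blast+
    then show ?thesis
      by linarith
  qed
  have "D X Y \<in> vector_fields M" "D' X Y \<in> vector_fields M"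
    using levi_civitaD(1)[OF D] levi_civitaD(1)[OF D'] X Y by blast+
  then have "s X Y \<in> tangent_space M p"
    unfolding s_def using subspace_diff[OF subspace_tangent[OF p]] vector_fieldD(3) p by blast
  then have "s X Y = 0"
  proof (rule trace_metric_nondegenerate[OF p])
    fix w assume "w \<in> tangent_space M p"
    then obtain Z where "Z \<in> vector_fields M" "Z p = w"
      using extend_tangent[OF p] by metis
    then show "trace_metric p (s X Y) w = 0"
      using zero by (auto simp: a_def)
  qed
  then show ?thesis
    by (simp add: s_def)
qed

lemma is_levi_civita: "is_levi_civita M trace_metric (levi_civita M trace_metric)"
  unfolding levi_civita_def by (rule someI[where P = "is_levi_civita M trace_metric", OF is_levi_civita_connection])

lemma levi_civita_eq:
  "X \<in> vector_fields M \<Longrightarrow> Y \<in> vector_fields M \<Longrightarrow> p \<in> M \<Longrightarrow> levi_civita M trace_metric X Y p = connection X Y p"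
  by (rule levi_civita_unique[OF is_levi_civita is_levi_civita_connection])

lemma levi_civita_field:
  "X \<in> vector_fields M \<Longrightarrow> Y \<in> vector_fields M \<Longrightarrow> levi_civita M trace_metric X Y \<in> vector_fields M"
  by (rule vector_field_cong[OF connection_field]) (auto simp: levi_civita_eq)

lemma ltr_cong: "X p = Y p \<Longrightarrow> ltr X p = ltr Y p"
  by (simp add: ltr_def)

lemma ltr_levi_civita:
  assumes "X \<in> vector_fields M" "Y \<in> vector_fields M" "p \<in> M"
  shows "ltr (levi_civita M trace_metric X Y) p =
    differential M (ltr Y) p (X p) + (1/2) *\<^sub>R bracket (ltr X p) (ltr Y p)"
proof -
  have "ltr (levi_civita M trace_metric X Y) p = ltr (connection X Y) p"
    by (rule ltr_cong) (rule levi_civita_eq[OF assms])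
  then show ?thesis
    using ltr_connection[OF assms(3)] by simp
qed

section \<open>The curvature tensor\<close>

lemma differential_ltr_levi_civita:
  assumes "X \<in> vector_fields M" "Y \<in> vector_fields M" "p \<in> M" "v \<in> tangent_space M p"
  shows "differential M (ltr (levi_civita M trace_metric X Y)) p v =
    differential M (\<lambda>q. differential M (ltr Y) q (X q)) p v +
    (1/2) *\<^sub>R (bracket (ltr X p) (differential M (ltr Y) p v) + bracket (differential M (ltr X) p v) (ltr Y p))"
proof -
  note sm = vector_fieldD(2)[OF assms(1)] vector_fieldD(2)[OF assms(2)]
  note sd = smooth_map_differential[OF sm(2) assms(1)]
  note sb = smooth_map_bracket[OF sm]
  have lin: "bounded_linear (\<lambda>x :: real^'n^'n. (1/2) *\<^sub>R x)"
    by (rule bounded_linear_scaleR_right)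
  have "differential M (ltr (levi_civita M trace_metric X Y)) p v =
      differential M (\<lambda>q. differential M (ltr Y) q (X q) + (1/2) *\<^sub>R bracket (ltr X q) (ltr Y q)) p v"
    by (rule differential_cong[OF assms(4) vector_fieldD(2)[OF levi_civita_field[OF assms(1,2)]]])
       (rule ltr_levi_civita[OF assms(1,2)])
  also have "\<dots> = differential M (\<lambda>q. differential M (ltr Y) q (X q)) p v +
      (1/2) *\<^sub>R differential M (\<lambda>q. bracket (ltr X q) (ltr Y q)) p v"
    unfolding differential_add[OF assms(4) sd smooth_map_linear[OF lin sb]]
      differential_linear[OF lin assms(4) sb] ..
  finally show ?thesis
    unfolding differential_bilinear[OF bounded_bilinear_bracket assms(4) sm] .
qed

text \<open>Here x, y, z stand for the trivialised fields, dXY for the iterated derivative X(Y z),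
  and dXz, dYz, dXy, dYx for first derivatives, the capital naming the direction. All derivatives
  cancel; by the Jacobi identity the rest is 1/2 - 1/4 = 1/4 of the double bracket.\<close>

lemma curvature_algebra:
  fixes x y z dXY dYX dXz dYz dXy dYx :: "real^'n^'n"
  shows "((dXY - dYX) + (1/2) *\<^sub>R bracket (dXy - dYx + bracket x y) z)
    - ((dXY + (1/2) *\<^sub>R (bracket y dXz + bracket dXy z)) + (1/2) *\<^sub>R bracket x (dYz + (1/2) *\<^sub>R bracket y z))
    + ((dYX + (1/2) *\<^sub>R (bracket x dYz + bracket dYx z)) + (1/2) *\<^sub>R bracket y (dXz + (1/2) *\<^sub>R bracket x z))
    = (1/4) *\<^sub>R bracket (bracket x y) z"
  by (simp add: bracket_distribs jacobi_bracket vec_eq_iff field_simps)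

lemma curvature_field_eq:
  assumes "X \<in> vector_fields M" "Y \<in> vector_fields M" "Z \<in> vector_fields M" "p \<in> M"
  shows "curvature_field M trace_metric X Y Z p = p ** ((1/4) *\<^sub>R bracket (bracket (ltr X p) (ltr Y p)) (ltr Z p))"
proof -
  define D where "D = levi_civita M trace_metric"
  note T = vector_fieldD(3)[OF assms(1,4)] vector_fieldD(3)[OF assms(2,4)]
  note L = lie_bracket_field[OF assms(1,2)]
  have fields: "D Y Z \<in> vector_fields M" "D X Z \<in> vector_fields M"
    unfolding D_def by (intro levi_civita_field assms)+
  \<comment> \<open>Writing the derivative along the bracket as a commutator lets it cancel against
    the iterated derivatives in the two second covariant derivatives.\<close>
  have "differential M (ltr Z) p (lie_bracket M X Y p) =
      differential M (\<lambda>q. differential M (ltr Z) q (Y q)) p (X p) -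
      differential M (\<lambda>q. differential M (ltr Z) q (X q)) p (Y p)"
    by (rule differential_commutator[OF vector_fieldD(2)[OF assms(3)] assms(1,2,4) vector_fieldD(3)[OF L assms(4)], symmetric])
  then have "ltr (D (lie_bracket M X Y) Z) p - ltr (D X (D Y Z)) p + ltr (D Y (D X Z)) p =
      (1/4) *\<^sub>R bracket (bracket (ltr X p) (ltr Y p)) (ltr Z p)"
    using curvature_algebra
    unfolding D_def ltr_levi_civita[OF L assms(3,4)]
      ltr_levi_civita[OF assms(1) fields(1)[unfolded D_def] assms(4)]
      ltr_levi_civita[OF assms(2) fields(2)[unfolded D_def] assms(4)]
      differential_ltr_levi_civita[OF assms(2,3,4) T(1)] differential_ltr_levi_civita[OF assms(1,3,4) T(2)]
      ltr_levi_civita[OF assms(2,3,4)] ltr_levi_civita[OF assms(1,3,4)]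
      ltr_lie_bracket[OF assms(1,2,4)]
    by simp
  then have "p ** (ltr (D (lie_bracket M X Y) Z) p - ltr (D X (D Y Z)) p + ltr (D Y (D X Z)) p) =
      p ** ((1/4) *\<^sub>R bracket (bracket (ltr X p) (ltr Y p)) (ltr Z p))"
    by simp
  then show ?thesis
    by (simp add: curvature_field_def Let_def D_def mm.diff_right mm.add_right left_mult_ltr[OF assms(4)])
qed

lemma curvature_eq:
  assumes "p \<in> M" "r * trace x = 0" "r * trace y = 0" "r * trace z = 0"
  shows "curvature M trace_metric p (p ** x) (p ** y) (p ** z) = p ** ((1/4) *\<^sub>R bracket (bracket x y) z)"
  unfolding curvature_def
proof (rule the_equality)
  have ltr: "ltr X p = x" if "X p = p ** x" for X x
    using that GL[OF assms(1)] by (simp add: ltr_def matrix_cancel)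
  show "\<forall>X\<in>vector_fields M. \<forall>Y\<in>vector_fields M. \<forall>Z\<in>vector_fields M.
      X p = p ** x \<and> Y p = p ** y \<and> Z p = p ** z \<longrightarrow>
      curvature_field M trace_metric X Y Z p = p ** ((1/4) *\<^sub>R bracket (bracket x y) z)"
    by (auto simp: curvature_field_eq[OF _ _ _ assms(1)] ltr)
  \<comment> \<open>Left-invariant extensions of the three vectors exist, so the condition on w is
    not vacuous and determines it.\<close>
  then show "w = p ** ((1/4) *\<^sub>R bracket (bracket x y) z)"
    if "\<forall>X\<in>vector_fields M. \<forall>Y\<in>vector_fields M. \<forall>Z\<in>vector_fields M.
      X p = p ** x \<and> Y p = p ** y \<and> Z p = p ** z \<longrightarrow> curvature_field M trace_metric X Y Z p = w" for w
    using that left_invariant_field[OF assms(2)] left_invariant_field[OF assms(3)] left_invariant_field[OF assms(4)]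
    by metis
qed

end

subsection \<open>Traces, dimensions and indices from projections\<close>

text \<open>A trace may be computed from any family \<open>e\<close> with coefficient functionals \<open>f\<close>, even a
  linearly dependent one.\<close>

lemma trace_on_frame:
  fixes V :: "'a::euclidean_space set" and e :: "'i \<Rightarrow> 'a"
  assumes V: "subspace V" and I: "finite I"
    and e: "\<And>i. i \<in> I \<Longrightarrow> e i \<in> V"
    and frame: "\<And>v. v \<in> V \<Longrightarrow> v = (\<Sum>i\<in>I. f i v *\<^sub>R e i)"
    and f: "\<And>i. i \<in> I \<Longrightarrow> linear (f i)"
    and L: "linear L'" "\<And>v. v \<in> V \<Longrightarrow> L v = L' v" "\<And>v. v \<in> V \<Longrightarrow> L' v \<in> V"
  shows "trace_on V L = (\<Sum>i\<in>I. f i (L' (e i)))"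
    and "real (dim V) = (\<Sum>i\<in>I. f i (e i))"
proof -
  define B where "B = (SOME B. independent B \<and> span B = V)"
  have B: "independent B" "span B = V"
  proof -
    obtain B' where "independent B'" "span B' = V"
      using basis_subspace_exists[OF V] by metis
    then have "independent B \<and> span B = V"
      unfolding B_def by (intro someI[where P = "\<lambda>B. independent B \<and> span B = V"]) simp
    then show "independent B" "span B = V"
      by auto
  qed
  have finB: "finite B"
    using B(1) by (rule finiteI_independent)
  have BV: "b \<in> V" if "b \<in> B" for b
    using that B(2) span_base by blast
  have main: "(\<Sum>b\<in>B. representation B (T b) b) = (\<Sum>i\<in>I. f i (T (e i)))"
    if T: "linear T" "\<And>v. v \<in> V \<Longrightarrow> T v \<in> V" for T
  proof -
    \<comment> \<open>Expanding \<open>T (e i)\<close> in \<open>B\<close>, or b in the family e,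
      leads to the same double sum of \<open>f i b\<close> times the b-coefficient of
      \<open>T (e i)\<close>.\<close>
    have "(\<Sum>i\<in>I. f i (T (e i))) = (\<Sum>i\<in>I. \<Sum>b\<in>B. representation B (T (e i)) b * f i b)"
    proof (rule sum.cong)
      fix i assume i: "i \<in> I"
      have "T (e i) = (\<Sum>b\<in>B. representation B (T (e i)) b *\<^sub>R b)"
        using real_vector.sum_representation_eq[OF B(1) _ finB subset_refl] T(2) e[OF i] B(2) by simp
      then have "f i (T (e i)) = f i (\<Sum>b\<in>B. representation B (T (e i)) b *\<^sub>R b)"
        by simp
      then show "f i (T (e i)) = (\<Sum>b\<in>B. representation B (T (e i)) b * f i b)"
        by (simp add: linear_sum[OF f[OF i]] linear_cmul[OF f[OF i]])
    qed simp
    also have "\<dots> = (\<Sum>b\<in>B. \<Sum>i\<in>I. f i b * representation B (T (e i)) b)"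
      by (subst sum.swap) (simp add: mult.commute)
    also have "\<dots> = (\<Sum>b\<in>B. representation B (T b) b)"
    proof (rule sum.cong)
      fix b assume b: "b \<in> B"
      have T_span: "T (e i) \<in> span B" if "i \<in> I" for i
        using T(2) e[OF that] B(2) by simp
      have "T b = T (\<Sum>i\<in>I. f i b *\<^sub>R e i)"
        using frame[OF BV[OF b]] by simp
      also have "\<dots> = (\<Sum>i\<in>I. f i b *\<^sub>R T (e i))"
        by (simp add: linear_sum[OF T(1)] linear_cmul[OF T(1)])
      finally have "representation B (T b) b = (\<Sum>i\<in>I. representation B (f i b *\<^sub>R T (e i)) b)"
        using real_vector.representation_sum[OF B(1), of I "\<lambda>i. f i b *\<^sub>R T (e i)"] T_span
        by (simp add: span_scale)
      also have "\<dots> = (\<Sum>i\<in>I. f i b * representation B (T (e i)) b)"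
        by (rule sum.cong) (simp_all add: real_vector.representation_scale[OF B(1) T_span])
      finally show "(\<Sum>i\<in>I. f i b * representation B (T (e i)) b) = representation B (T b) b"
        by simp
    qed simp
    finally show ?thesis
      by simp
  qed
  have "trace_on V L = (\<Sum>b\<in>B. representation B (L b) b)"
    by (simp add: trace_on_def B_def Let_def)
  also have "\<dots> = (\<Sum>b\<in>B. representation B (L' b) b)"
    by (intro sum.cong refl) (simp add: L(2) BV)
  finally show "trace_on V L = (\<Sum>i\<in>I. f i (L' (e i)))"
    using main[OF L(1,3)] by simp
  \<comment> \<open>The dimension is the trace of the identity.\<close>
  have "real (dim V) = real (card B)"
    using dim_eq_card[of B V] B by (metis span_span)
  also have "\<dots> = (\<Sum>b\<in>B. representation B b b)"
    by (simp add: real_vector.representation_basis[OF B(1)])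
  finally show "real (dim V) = (\<Sum>i\<in>I. f i (e i))"
    using main[of "\<lambda>v. v"] by (simp add: linear_id[unfolded id_def])
qed

text \<open>The family consists of the left translates of the projected unit matrices, and its
  coefficient functionals are the entries of the trivialised vector. In particular the dimension of
  \<open>V\<close> is the trace of the projection \<pi>.\<close>

lemma trace_on_projection:
  fixes V :: "(real^'n^'n) set"
  assumes V: "subspace V" and p: "p \<in> GL" and \<pi>: "linear \<pi>"
    and range: "\<And>x. p ** \<pi> x \<in> V" and fixed: "\<And>v. v \<in> V \<Longrightarrow> \<pi> (matrix_inv p ** v) = matrix_inv p ** v"
    and L: "linear L'" "\<And>v. v \<in> V \<Longrightarrow> L v = L' v" "\<And>v. v \<in> V \<Longrightarrow> L' v \<in> V"
  shows "trace_on V L = (\<Sum>i\<in>UNIV. \<Sum>j\<in>UNIV. (matrix_inv p ** L' (p ** \<pi> (unit_matrix i j))) $ i $ j)"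
    and "real (dim V) = (\<Sum>i\<in>UNIV. \<Sum>j\<in>UNIV. \<pi> (unit_matrix i j) $ i $ j)"
proof -
  define f where "f = (\<lambda>ij (v :: real^'n^'n). (matrix_inv p ** v) $ fst ij $ snd ij)"
  define e where "e = (\<lambda>ij. p ** \<pi> (unit_matrix (fst ij) (snd ij)))"
  have frame: "v = (\<Sum>ij\<in>UNIV. f ij v *\<^sub>R e ij)" if "v \<in> V" for v
  proof -
    define x where "x = matrix_inv p ** v"
    have "v = p ** \<pi> x"
      using fixed[OF that] p by (simp add: x_def matrix_cancel)
    also have "\<dots> = p ** \<pi> (\<Sum>i\<in>UNIV. \<Sum>j\<in>UNIV. x $ i $ j *\<^sub>R unit_matrix i j)"
      using matrix_expansion[of x] by simp
    also have "\<dots> = (\<Sum>i\<in>UNIV. \<Sum>j\<in>UNIV. x $ i $ j *\<^sub>R (p ** \<pi> (unit_matrix i j)))"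
      by (simp add: linear_sum[OF \<pi>] linear_cmul[OF \<pi>] mm.sum_right mm.scaleR_right)
    also have "\<dots> = (\<Sum>ij\<in>UNIV. f ij v *\<^sub>R e ij)"
      by (simp add: sum.cartesian_product f_def e_def x_def split_beta)
    finally show ?thesis .
  qed
  have lin: "linear (f ij)" for ij
    unfolding f_def by (intro linearI) (simp_all add: mm_distribs)
  have e: "e ij \<in> V" for ij
    unfolding e_def by (rule range)
  note main = trace_on_frame[OF V finite_class.finite_UNIV e frame lin L]
  show "trace_on V L = (\<Sum>i\<in>UNIV. \<Sum>j\<in>UNIV. (matrix_inv p ** L' (p ** \<pi> (unit_matrix i j))) $ i $ j)"
    using main(1) by (simp add: sum.cartesian_product f_def e_def split_beta)
  show "real (dim V) = (\<Sum>i\<in>UNIV. \<Sum>j\<in>UNIV. \<pi> (unit_matrix i j) $ i $ j)"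
    using main(2) by (simp add: sum.cartesian_product f_def e_def split_beta matrix_cancel p)
qed

lemmas dim_projection = trace_on_projection(2)[OF _ _ _ _ _ linear_ident refl]

text \<open>The dimension count of Sylvester's law of inertia: a positive and a negative definite
  subspace meet only in 0, so their dimensions add up to at most dim V. A complementary pair
  therefore attains both maxima.\<close>

lemma index_eq:
  fixes V :: "'a::euclidean_space set"
  assumes V: "subspace V"
    and P: "subspace P" "P \<subseteq> V" "\<And>w. w \<in> P - {0} \<Longrightarrow> \<beta> w w > 0"
    and N: "subspace N" "N \<subseteq> V" "\<And>w. w \<in> N - {0} \<Longrightarrow> \<beta> w w < 0"
    and dim: "dim P + dim N = dim V"
  shows "pos_index \<beta> V = dim P" "neg_index \<beta> V = dim N"
proof -
  have bound: "dim W + dim W' \<le> dim V"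
    if "subspace W" "subspace W'" "W \<subseteq> V" "W' \<subseteq> V"
      and pos: "\<forall>w\<in>W - {0}. \<beta> w w > 0" and neg: "\<forall>w\<in>W' - {0}. \<beta> w w < 0" for W W'
  proof -
    have "W \<inter> W' \<subseteq> {0}"
    proof
      fix w assume "w \<in> W \<inter> W'"
      then show "w \<in> {0}"
        using pos neg by (cases "w = 0") force+
    qed
    then have "dim (W \<inter> W') = 0"
      by (simp add: dim_eq_0)
    moreover have "{x + y |x y. x \<in> W \<and> y \<in> W'} \<subseteq> V"
      using that(3,4) subspace_add[OF V] by blast
    ultimately show ?thesis
      using dim_sums_Int[OF that(1,2)] dim_subset[of "{x + y |x y. x \<in> W \<and> y \<in> W'}" V] by linarith
  qed
  have fin: "finite {dim W |W. subspace W \<and> W \<subseteq> V \<and> Q W}" for Q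
    by (rule finite_subset[of _ "{..dim V}"]) (auto intro: dim_subset)
  show "pos_index \<beta> V = dim P"
    unfolding pos_index_def
  proof (rule Max_eqI[OF fin])
    fix d assume "d \<in> {dim W |W. subspace W \<and> W \<subseteq> V \<and> (\<forall>w\<in>W - {0}. 0 < \<beta> w w)}"
    then obtain W where W: "d = dim W" "subspace W" "W \<subseteq> V" "\<forall>w\<in>W - {0}. 0 < \<beta> w w"
      by auto
    show "d \<le> dim P"
      using bound[OF W(2) N(1) W(3) N(2) W(4)] N(3) dim W(1) by simp
  qed (use P in blast)
  show "neg_index \<beta> V = dim N"
    unfolding neg_index_def
  proof (rule Max_eqI[OF fin])
    fix d assume "d \<in> {dim W |W. subspace W \<and> W \<subseteq> V \<and> (\<forall>w\<in>W - {0}. \<beta> w w < 0)}"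
    then obtain W where W: "d = dim W" "subspace W" "W \<subseteq> V" "\<forall>w\<in>W - {0}. \<beta> w w < 0"
      by auto
    show "d \<le> dim N"
      using bound[OF P(1) W(2) P(2) W(3) _ W(4)] P(3) dim W(1) by simp
  qed (use N in blast)
qed

lemma transpose_distribs:
  fixes x y :: "real^'n^'n"
  shows "transpose (x + y) = transpose x + transpose y" "transpose (x - y) = transpose x - transpose y"
    "transpose (a *\<^sub>R x) = a *\<^sub>R transpose x" "transpose (- x) = - transpose x" "transpose (0 :: real^'n^'n) = 0"
  by (simp_all add: transpose_def vec_eq_iff)

lemma trace_unit_matrix: "trace (unit_matrix i j) = (if i = j then 1 else 0)"
  by (cases "i = j") (auto simp: trace_def unit_matrix_nth if_if_eq_conj intro!: sum.neutral)

lemma mult_unit_mult_nth: "(A ** unit_matrix i j ** B) $ k $ l = A $ k $ i * B $ j $ l"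
  by (simp add: matrix_matrix_mult_def[of "A ** unit_matrix i j"] mult_unit_matrix_nth
      if_distrib[of "\<lambda>x. x * y" for y] cong: if_cong)

text \<open>The trace of \<open>- ad y \<circ> ad x\<close> on all matrices, that is, minus the Killing form.\<close>

lemma trace_ad_ad:
  fixes x y :: "real^'n^'n"
  shows "(\<Sum>i\<in>UNIV. \<Sum>j\<in>UNIV. bracket (bracket x (unit_matrix i j)) y $ i $ j) =
    2 * trace x * trace y - 2 * real CARD('n) * trace (x ** y)"
proof -
  have "bracket (bracket x (unit_matrix i j)) y $ i $ j =
      x $ i $ i * y $ j $ j - (x ** y) $ j $ j - (y ** x) $ i $ i + y $ i $ i * x $ j $ j" for i j
  proof -
    have "bracket (bracket x (unit_matrix i j)) y =
        x ** unit_matrix i j ** y - unit_matrix i j ** (x ** y) - y ** x ** unit_matrix i j + y ** unit_matrix i j ** x"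
      by (simp add: bracket_def mm_distribs matrix_mul_assoc)
    then show ?thesis
      by (simp add: mult_unit_mult_nth mult_unit_matrix_nth unit_matrix_mult_nth)
  qed
  moreover have "(\<Sum>i\<in>UNIV. \<Sum>j\<in>UNIV. a $ i $ i * b $ j $ j) = trace a * trace b" for a b :: "real^'n^'n"
    by (simp add: trace_def sum_product)
  moreover have "(\<Sum>i\<in>(UNIV :: 'n set). \<Sum>j\<in>UNIV. a $ j $ j) = real CARD('n) * trace a"
    "(\<Sum>i\<in>UNIV. \<Sum>j\<in>(UNIV :: 'n set). a $ i $ i) = real CARD('n) * trace a" for a :: "real^'n^'n"
    by (simp_all add: trace_def sum_distrib_left)
  ultimately have "(\<Sum>i\<in>UNIV. \<Sum>j\<in>UNIV. bracket (bracket x (unit_matrix i j)) y $ i $ j) =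
      trace x * trace y - real CARD('n) * trace (x ** y) - real CARD('n) * trace (y ** x) + trace y * trace x"
    by (simp only: sum.distrib sum_subtractf)
  then show ?thesis
    by (simp add: trace_mul_sym[of y x])
qed

subsection \<open>Signature and curvature of the trace metric\<close>

context trace_group
begin

text \<open>For r = 0 the identity; for r = 1 the projection onto the traceless matrices along the
  multiples of the identity.\<close>

definition proj :: "real^'n^'n \<Rightarrow> real^'n^'n" where
  "proj x = x - (r * trace x / real CARD('n)) *\<^sub>R mat 1"

lemma linear_proj: "linear proj"
  unfolding proj_def
  by (rule linearI) (simp_all add: trace_distribs algebra_simps add_divide_distrib)

lemma trace_proj: "r * trace (proj x) = 0"
  using r_cases by (auto simp: proj_def trace_distribs trace_I)

lemma proj_fixed: "r * trace x = 0 \<Longrightarrow> proj x = x"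
  by (simp add: proj_def)

lemma proj_tangent:
  assumes "p \<in> M"
  shows "p ** proj x \<in> tangent_space M p"
    and "v \<in> tangent_space M p \<Longrightarrow> proj (matrix_inv p ** v) = matrix_inv p ** v"
  by (simp_all only: left_mult_tangent_iff[OF assms] trace_proj) (simp add: tangent[OF assms] proj_fixed)

text \<open>The trace of the part that \<open>proj\<close> removes, and the source of every
  \<open>- r\<close> in the dimension formulas below.\<close>

lemma sum_proj_unit:
  "(\<Sum>i\<in>UNIV. \<Sum>j\<in>UNIV. (r * trace (unit_matrix i j) / real CARD('n)) * (mat 1 :: real^'n^'n) $ i $ j) = r"
proof -
  have "(\<Sum>i\<in>UNIV. \<Sum>j\<in>UNIV. (r * trace (unit_matrix i j) / real CARD('n)) * (mat 1 :: real^'n^'n) $ i $ j) =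
      (\<Sum>i\<in>(UNIV :: 'n set). \<Sum>j\<in>(UNIV :: 'n set). if i = j then r / real CARD('n) else 0)"
    by (intro sum.cong refl) (simp add: trace_unit_matrix mat_def)
  then show ?thesis
    by simp
qed

lemma dim_tangent:
  assumes "p \<in> M"
  shows "real (dim (tangent_space M p)) = (real CARD('n))\<^sup>2 - r"
proof -
  have "real (dim (tangent_space M p)) = (\<Sum>i\<in>UNIV. \<Sum>j\<in>UNIV. proj (unit_matrix i j) $ i $ j)"
    by (rule dim_projection[OF subspace_tangent[OF assms] GL[OF assms] linear_proj proj_tangent[OF assms]])
  then show ?thesis
    using sum_proj_unit by (simp add: proj_def unit_matrix_nth sum_subtractf power2_eq_square)
qed

definition pos_space :: "real^'n^'n \<Rightarrow> (real^'n^'n) set" where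
  "pos_space p = {v. transpose (matrix_inv p ** v) = matrix_inv p ** v \<and> r * trace (matrix_inv p ** v) = 0}"

definition neg_space :: "real^'n^'n \<Rightarrow> (real^'n^'n) set" where
  "neg_space p = {v. transpose (matrix_inv p ** v) = - (matrix_inv p ** v)}"

lemma subspace_pos_space: "subspace (pos_space p)"
  unfolding pos_space_def subspace_def
  by (auto simp: mm_distribs trace_distribs transpose_distribs distrib_left)

lemma subspace_neg_space: "subspace (neg_space p)"
  unfolding neg_space_def subspace_def
  by (auto simp: mm_distribs transpose_distribs)

text \<open>Transposition, as a linear map on n by n matrices, has trace n because only diagonal
  unit matrices contribute. Hence the projections onto the symmetric and skew matrices have traces
  (n^2 + n)/2 and (n^2 - n)/2.\<close>

lemma sum_transpose_unit:
  "(\<Sum>i\<in>UNIV. \<Sum>j\<in>UNIV. transpose (unit_matrix i j :: real^'n^'n) $ i $ j) = real CARD('n)"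
proof -
  have "(\<Sum>i\<in>UNIV. \<Sum>j\<in>UNIV. transpose (unit_matrix i j :: real^'n^'n) $ i $ j) =
      (\<Sum>i\<in>(UNIV :: 'n set). \<Sum>j\<in>(UNIV :: 'n set). if i = j then 1 else 0)"
    by (intro sum.cong refl) (auto simp: transpose_def unit_matrix_nth)
  then show ?thesis
    by simp
qed

lemma dim_pos_space:
  assumes "p \<in> M"
  shows "real (dim (pos_space p)) = ((real CARD('n))\<^sup>2 + real CARD('n)) / 2 - r"
proof -
  define \<pi> where "\<pi> = (\<lambda>x :: real^'n^'n. (1/2) *\<^sub>R (x + transpose x) - (r * trace x / real CARD('n)) *\<^sub>R mat 1)"
  have "real (dim (pos_space p)) = (\<Sum>i\<in>UNIV. \<Sum>j\<in>UNIV. \<pi> (unit_matrix i j) $ i $ j)"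
  proof (rule dim_projection[OF subspace_pos_space GL[OF assms]])
    show "linear \<pi>"
      unfolding \<pi>_def
      by (rule linearI) (simp_all add: trace_distribs transpose_distribs algebra_simps add_divide_distrib)
    show "p ** \<pi> x \<in> pos_space p" for x
    proof -
      have "transpose (\<pi> x) = \<pi> x"
        by (simp add: \<pi>_def transpose_distribs transpose_transpose transpose_mat add.commute)
      moreover have "r * trace (\<pi> x) = 0"
        using r_cases by (auto simp: \<pi>_def trace_distribs trace_transpose trace_I)
      ultimately show ?thesis
        using GL[OF assms] by (simp add: pos_space_def matrix_cancel)
    qed
    show "\<pi> (matrix_inv p ** v) = matrix_inv p ** v" if "v \<in> pos_space p" for v
      using that by (simp add: pos_space_def \<pi>_def scaleR_2[symmetric])
  qed
  also have "\<dots> = (\<Sum>i\<in>UNIV. \<Sum>j\<in>UNIV. (1/2) * (1 + transpose (unit_matrix i j :: real^'n^'n) $ i $ j)) - r"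
    using sum_proj_unit by (simp add: \<pi>_def unit_matrix_nth sum_subtractf)
  also have "\<dots> = ((real CARD('n))\<^sup>2 + real CARD('n)) / 2 - r"
    unfolding sum_distrib_left[symmetric] using sum_transpose_unit by (simp add: sum.distrib power2_eq_square)
  finally show ?thesis .
qed

lemma dim_neg_space:
  assumes "p \<in> M"
  shows "real (dim (neg_space p)) = ((real CARD('n))\<^sup>2 - real CARD('n)) / 2"
proof -
  define \<pi> where "\<pi> = (\<lambda>x :: real^'n^'n. (1/2) *\<^sub>R (x - transpose x))"
  have "real (dim (neg_space p)) = (\<Sum>i\<in>UNIV. \<Sum>j\<in>UNIV. \<pi> (unit_matrix i j) $ i $ j)"
  proof (rule dim_projection[OF subspace_neg_space GL[OF assms]])
    show "linear \<pi>"
      unfolding \<pi>_def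
      by (rule linearI) (simp_all add: transpose_distribs algebra_simps)
    show "p ** \<pi> x \<in> neg_space p" for x
      using GL[OF assms]
      by (simp add: neg_space_def matrix_cancel \<pi>_def transpose_distribs transpose_transpose algebra_simps)
    show "\<pi> (matrix_inv p ** v) = matrix_inv p ** v" if "v \<in> neg_space p" for v
      using that by (simp add: neg_space_def \<pi>_def scaleR_2[symmetric])
  qed
  also have "\<dots> = (\<Sum>i\<in>UNIV. \<Sum>j\<in>UNIV. (1/2) * (1 - transpose (unit_matrix i j :: real^'n^'n) $ i $ j))"
    by (simp add: \<pi>_def unit_matrix_nth)
  also have "\<dots> = ((real CARD('n))\<^sup>2 - real CARD('n)) / 2"
    unfolding sum_distrib_left[symmetric] using sum_transpose_unit by (simp add: sum_subtractf power2_eq_square)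
  finally show ?thesis .
qed

text \<open>The trace form is the squared Euclidean norm on symmetric matrices and its negative on
  skew ones, which are traceless anyway; the two dimensions exhaust the tangent space.\<close>

lemma index_tangent:
  assumes "p \<in> M"
  shows "pos_index (trace_metric p) (tangent_space M p) = dim (pos_space p)"
    and "neg_index (trace_metric p) (tangent_space M p) = dim (neg_space p)"
proof -
  have nonzero: "(matrix_inv p ** v) \<bullet> (matrix_inv p ** v) > 0" if "v \<noteq> 0" for v :: "real^'n^'n"
  proof -
    have "p ** (matrix_inv p ** v) \<noteq> 0"
      using that GL[OF assms] by (simp add: matrix_cancel)
    then have "matrix_inv p ** v \<noteq> 0"
      by (auto simp: mm.zero_right)
    then show ?thesis
      by simp
  qed
  have pos: "trace_metric p v v > 0" if "v \<in> pos_space p - {0}" for v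
  proof -
    have "trace_metric p v v = (matrix_inv p ** v) \<bullet> (matrix_inv p ** v)"
      using that trace_transpose_mult[of "matrix_inv p ** v"] by (simp add: trace_metric_eq pos_space_def)
    then show ?thesis
      using nonzero[of v] that by simp
  qed
  have neg: "trace_metric p v v < 0" if "v \<in> neg_space p - {0}" for v
  proof -
    have "trace_metric p v v = - ((matrix_inv p ** v) \<bullet> (matrix_inv p ** v))"
      using that trace_transpose_mult[of "matrix_inv p ** v"]
      by (simp add: trace_metric_eq neg_space_def mm.minus_right trace_minus)
    then show ?thesis
      using nonzero[of v] that by simp
  qed
  have sub_pos: "pos_space p \<subseteq> tangent_space M p"
    by (auto simp: pos_space_def tangent[OF assms])
  have sub_neg: "neg_space p \<subseteq> tangent_space M p"
  proof
    fix v assume "v \<in> neg_space p"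
    then have "trace (transpose (matrix_inv p ** v)) = trace (- (matrix_inv p ** v))"
      by (simp add: neg_space_def)
    then show "v \<in> tangent_space M p"
      by (simp add: trace_transpose trace_minus tangent[OF assms])
  qed
  have "real (dim (pos_space p) + dim (neg_space p)) = real (dim (tangent_space M p))"
    by (simp add: dim_pos_space[OF assms] dim_neg_space[OF assms] dim_tangent[OF assms] field_simps)
  then have dims: "dim (pos_space p) + dim (neg_space p) = dim (tangent_space M p)"
    by (simp only: of_nat_eq_iff)
  note index = index_eq[where \<beta> = "trace_metric p", OF subspace_tangent[OF assms] subspace_pos_space sub_pos pos subspace_neg_space sub_neg neg dims]
  show "pos_index (trace_metric p) (tangent_space M p) = dim (pos_space p)"
    and "neg_index (trace_metric p) (tangent_space M p) = dim (neg_space p)"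
    using index by blast+
qed

lemma has_signature_trace_metric:
  assumes "real s = ((real CARD('n))\<^sup>2 + real CARD('n)) / 2 - r"
    and "real t = ((real CARD('n))\<^sup>2 - real CARD('n)) / 2"
  shows "has_signature M trace_metric (s, t)"
proof -
  have "dim (pos_space p) = s" "dim (neg_space p) = t" if "p \<in> M" for p
    using assms dim_pos_space[OF that] dim_neg_space[OF that] by simp_all
  then show ?thesis
    unfolding has_signature_def by (simp add: index_tangent)
qed

lemma semi_riemannian_metric_trace_metric:
  "semi_riemannian_metric M trace_metric"
  unfolding semi_riemannian_metric_def
proof (intro conjI ballI allI impI)
  fix p x y z :: "real^'n^'n" and a b :: real
  show "trace_metric p (a *\<^sub>R x + b *\<^sub>R y) z = a * trace_metric p x z + b * trace_metric p y z"
    by (simp add: trace_metric_bilinear)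
  show "trace_metric p x y = trace_metric p y x"
    by (rule trace_metric_commute)
next
  fix p x assume "p \<in> M" "x \<in> tangent_space M p" "\<forall>y\<in>tangent_space M p. trace_metric p x y = 0"
  then show "x = 0"
    using trace_metric_nondegenerate by blast
next
  fix X Y assume "X \<in> vector_fields M" "Y \<in> vector_fields M"
  note sm = vector_fieldD(2)[OF this(1)] vector_fieldD(2)[OF this(2)]
  show "smooth_map M (\<lambda>p. trace_metric p (X p) (Y p))"
    using smooth_map_linear[OF bounded_linear_trace smooth_map_bilinear[OF bounded_bilinear_matrix_mult sm]]
    by (simp add: ltr_def trace_metric_eq)
next
  show "\<exists>s. has_signature M trace_metric s"
  proof (cases "M = {}")
    case True
    then show ?thesis
      by (simp add: has_signature_def)
  next
    case False
    \<comment> \<open>The two dimensions depend on n and r only, so those at one point serve for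
      all.\<close>
    then obtain p where "p \<in> M"
      by blast
    then show ?thesis
      using has_signature_trace_metric[OF dim_pos_space dim_neg_space] by blast
  qed
qed

section \<open>Ricci form and metric trace\<close>

lemma ricci_eq:
  assumes "p \<in> M" "r * trace x = 0" "r * trace y = 0"
  shows "ricci M trace_metric p (p ** x) (p ** y) = (trace x * trace y - real CARD('n) * trace (x ** y)) / 2"
proof -
  define L' where "L' = (\<lambda>z. p ** ((1/4) *\<^sub>R bracket (bracket x (matrix_inv p ** z)) y))"
  have "ricci M trace_metric p (p ** x) (p ** y) =
      (\<Sum>i\<in>UNIV. \<Sum>j\<in>UNIV. (matrix_inv p ** L' (p ** proj (unit_matrix i j))) $ i $ j)"
    unfolding ricci_def
  proof (rule trace_on_projection(1)[OF subspace_tangent[OF assms(1)] GL[OF assms(1)] linear_proj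
        proj_tangent[OF assms(1)]])
    show "linear L'"
      unfolding L'_def by (rule linearI) (simp_all add: mm_distribs bracket_distribs scaleR_add_right)
    show "curvature M trace_metric p (p ** x) v (p ** y) = L' v" if v: "v \<in> tangent_space M p" for v
    proof -
      obtain z where z: "v = p ** z" "r * trace z = 0" "z = matrix_inv p ** v"
        using tangentE[OF assms(1) v] by metis
      show ?thesis
        unfolding L'_def z(3)[symmetric] using curvature_eq[OF assms(1,2) z(2) assms(3)] z(1) by simp
    qed
    show "L' v \<in> tangent_space M p" for v
      unfolding L'_def left_mult_tangent_iff[OF assms(1)] by (simp add: trace_distribs trace_bracket)
  qed
  also have "\<dots> = (\<Sum>i\<in>UNIV. \<Sum>j\<in>UNIV. (1/4) * bracket (bracket x (unit_matrix i j)) y $ i $ j)"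
  proof (intro sum.cong refl)
    fix i j
    \<comment> \<open>The identity is central and \<open>proj\<close> subtracts a multiple of it. So
      the trace over the tangent space equals the trace over all matrices, which
      \<open>trace_ad_ad\<close> evaluates.\<close>
    have "bracket x (mat 1) = 0"
      by (simp add: bracket_def)
    then have "bracket x (proj (unit_matrix i j)) = bracket x (unit_matrix i j)"
      by (simp add: proj_def bracket_distribs)
    then show "(matrix_inv p ** L' (p ** proj (unit_matrix i j))) $ i $ j =
        (1/4) * bracket (bracket x (unit_matrix i j)) y $ i $ j"
      using GL[OF assms(1)] by (simp add: L'_def matrix_cancel)
  qed
  finally show ?thesis
    unfolding sum_distrib_left[symmetric] trace_ad_ad by (simp add: algebra_simps)
qed

text \<open>A form proportional to the metric is represented by c times the identity, by
  nondegeneracy, so its trace is c times the dimension of the tangent space.\<close>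

lemma form_trace_trace_metric:
  assumes "p \<in> M" and h: "\<And>x y. x \<in> tangent_space M p \<Longrightarrow> y \<in> tangent_space M p \<Longrightarrow> h x y = c * trace_metric p x y"
  shows "form_trace (trace_metric p) (tangent_space M p) h = c * ((real CARD('n))\<^sup>2 - r)"
proof -
  have "form_trace (trace_metric p) (tangent_space M p) h =
      (\<Sum>i\<in>UNIV. \<Sum>j\<in>UNIV. (matrix_inv p ** (c *\<^sub>R (p ** proj (unit_matrix i j)))) $ i $ j)"
    unfolding form_trace_def
  proof (rule trace_on_projection(1)[OF subspace_tangent[OF assms(1)] GL[OF assms(1)] linear_proj
        proj_tangent[OF assms(1)]])
    show "linear (\<lambda>x :: real^'n^'n. c *\<^sub>R x)"
      by (rule linear_scaleR)
    show cv: "c *\<^sub>R v \<in> tangent_space M p" if "v \<in> tangent_space M p" for v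
      using that subspace_scale[OF subspace_tangent[OF assms(1)]] by blast
    show "(THE z. z \<in> tangent_space M p \<and> (\<forall>y\<in>tangent_space M p. trace_metric p z y = h v y)) = c *\<^sub>R v"
      if v: "v \<in> tangent_space M p" for v
    proof (rule the_equality)
      show "c *\<^sub>R v \<in> tangent_space M p \<and> (\<forall>y\<in>tangent_space M p. trace_metric p (c *\<^sub>R v) y = h v y)"
        using v cv h by (simp add: trace_metric_bilinear)
    next
      fix z assume z: "z \<in> tangent_space M p \<and> (\<forall>y\<in>tangent_space M p. trace_metric p z y = h v y)"
      have "z - c *\<^sub>R v = 0"
      proof (rule trace_metric_nondegenerate[OF assms(1)])
        show "z - c *\<^sub>R v \<in> tangent_space M p"
          using z cv[OF v] subspace_diff[OF subspace_tangent[OF assms(1)]] by blast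
        show "trace_metric p (z - c *\<^sub>R v) w = 0" if "w \<in> tangent_space M p" for w
          using z h[OF v that] that by (simp add: trace_metric_bilinear)
      qed
      then show "z = c *\<^sub>R v"
        by simp
    qed
  qed auto
  also have "\<dots> = c * (\<Sum>i\<in>UNIV. \<Sum>j\<in>UNIV. proj (unit_matrix i j) $ i $ j)"
    using GL[OF assms(1)] by (simp add: mm.scaleR_right matrix_cancel sum_distrib_left)
  also have "(\<Sum>i\<in>UNIV. \<Sum>j\<in>UNIV. proj (unit_matrix i j) $ i $ j) = (real CARD('n))\<^sup>2 - r"
    using sum_proj_unit by (simp add: proj_def unit_matrix_nth sum_subtractf power2_eq_square)
  finally show ?thesis .
qed

end

subsection \<open>Covariant derivatives along curves and geodesics\<close>

lemma has_vector_derivative_shift: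
  assumes "((\<lambda>s. f (t + s)) has_vector_derivative d) (at (0::real))"
  shows "(f has_vector_derivative d) (at t)"
proof -
  have "((\<lambda>s. s - t) has_vector_derivative 1) (at t)"
    by (auto intro!: derivative_eq_intros)
  from vector_diff_chain_at[OF this, of "\<lambda>s. f (t + s)" d] assms show ?thesis
    by (simp add: o_def)
qed

lemma smooth_on_real_derivative:
  fixes h :: "real \<Rightarrow> real"
  assumes "smooth_on I h" "t \<in> I"
  shows "(h has_field_derivative deriv h t) (at t)"
proof -
  have "h differentiable (at t)"
    using smooth_on_has_derivative[OF assms] differentiableI by blast
  then show ?thesis
    using DERIV_deriv_iff_real_differentiable by blast
qed

context trace_group
begin

definition velocity :: "(real \<Rightarrow> real^'n^'n) \<Rightarrow> real \<Rightarrow> real^'n^'n" where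
  "velocity \<gamma> t = matrix_inv (\<gamma> t) ** vector_derivative \<gamma> (at t)"

text \<open>For Z = \<gamma> \<zeta> this is the formula of \<open>connection\<close> with the
  directional derivative replaced by the derivative of \<zeta> in the parameter.\<close>

definition covariant :: "(real \<Rightarrow> real^'n^'n) \<Rightarrow> (real \<Rightarrow> real^'n^'n) \<Rightarrow> real \<Rightarrow> real^'n^'n" where
  "covariant \<gamma> Z t = \<gamma> t ** (vector_derivative (\<lambda>s. matrix_inv (\<gamma> s) ** Z s) (at t)
    + (1/2) *\<^sub>R bracket (velocity \<gamma> t) (matrix_inv (\<gamma> t) ** Z t))"

context
  fixes I :: "real set" and \<gamma> :: "real \<Rightarrow> real^'n^'n"
  assumes I: "open I" and smooth: "smooth_on I \<gamma>" and in_M: "\<gamma> ` I \<subseteq> M"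
begin

abbreviation lt :: "(real \<Rightarrow> real^'n^'n) \<Rightarrow> real \<Rightarrow> real^'n^'n" where
  "lt Z \<equiv> \<lambda>s. matrix_inv (\<gamma> s) ** Z s"

lemma gamma_M: "t \<in> I \<Longrightarrow> \<gamma> t \<in> M"
  using in_M by blast

lemma gamma_GL: "t \<in> I \<Longrightarrow> \<gamma> t \<in> GL"
  using gamma_M GL by blast

lemma smooth_on_inv_gamma: "smooth_on I (\<lambda>t. matrix_inv (\<gamma> t))"
  by (rule smooth_on_compose_smooth_map[OF I smooth in_M smooth_map_smooth_on[OF open_GL smooth_on_matrix_inv subset_GL]])

lemma shifted_curve:
  assumes "t \<in> I"
  shows "(\<lambda>s. \<gamma> (t + s)) \<in> curves_through M (\<gamma> t) (vector_derivative \<gamma> (at t))"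
  by (rule curve_shift[OF I smooth in_M assms smooth_on_vector_derivative[OF smooth assms]])

lemma velocity_tangent: "t \<in> I \<Longrightarrow> vector_derivative \<gamma> (at t) \<in> tangent_space M (\<gamma> t)"
  using shifted_curve unfolding tangent_space_def by blast

lemma velocity_trace: "t \<in> I \<Longrightarrow> r * trace (velocity \<gamma> t) = 0"
  using velocity_tangent gamma_M by (simp add: velocity_def tangent)

lemma smooth_on_velocity': "smooth_on I (velocity \<gamma>)"
  unfolding velocity_def by (intro smooth_on_matrix_mult smooth_on_inv_gamma smooth_on_velocity I smooth)

lemma velocity_field: "(\<lambda>s. vector_derivative \<gamma> (at s)) \<in> fields_along M I \<gamma>"
  unfolding fields_along_def using velocity_tangent smooth_on_velocity[OF I smooth] by blast

lemma field_alongD: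
  assumes "Z \<in> fields_along M I \<gamma>"
  shows "smooth_on I Z" "smooth_on I (lt Z)"
    "t \<in> I \<Longrightarrow> r * trace (lt Z t) = 0"
    "t \<in> I \<Longrightarrow> Z t = \<gamma> t ** (lt Z t)"
proof -
  show Z: "smooth_on I Z"
    using assms by (simp add: fields_along_def)
  show "smooth_on I (lt Z)"
    by (intro smooth_on_matrix_mult smooth_on_inv_gamma I Z)
  show "r * trace (lt Z t) = 0" if "t \<in> I"
  proof -
    have "Z t \<in> tangent_space M (\<gamma> t)"
      using assms that by (simp add: fields_along_def)
    then show ?thesis
      using tangent[OF gamma_M[OF that]] by simp
  qed
  show "Z t = \<gamma> t ** (lt Z t)" if "t \<in> I"
    using gamma_GL[OF that] by (simp add: matrix_cancel)
qed

lemma field_alongI: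
  assumes "smooth_on I \<zeta>" "\<And>t. t \<in> I \<Longrightarrow> r * trace (\<zeta> t) = 0"
  shows "(\<lambda>t. \<gamma> t ** \<zeta> t) \<in> fields_along M I \<gamma>"
  unfolding fields_along_def
  using assms left_mult_tangent_iff gamma_M by (auto intro!: smooth_on_matrix_mult I smooth)

lemma field_along_lincomb:
  assumes "Z \<in> fields_along M I \<gamma>" "Z' \<in> fields_along M I \<gamma>"
  shows "(\<lambda>s. a *\<^sub>R Z s + b *\<^sub>R Z' s) \<in> fields_along M I \<gamma>"
proof -
  have "a *\<^sub>R Z t + b *\<^sub>R Z' t \<in> tangent_space M (\<gamma> t)" if "t \<in> I" for t
    using assms that subspace_tangent[OF gamma_M[OF that]]
    by (intro subspace_add subspace_scale) (auto simp: fields_along_def)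
  then show ?thesis
    unfolding fields_along_def using field_alongD(1)[OF assms(1)] field_alongD(1)[OF assms(2)]
    by (auto intro!: smooth_on_add smooth_on_scaleR smooth_on_const I)
qed

lemma field_along_scale:
  assumes "Z \<in> fields_along M I \<gamma>" "smooth_on I h"
  shows "(\<lambda>s. h s *\<^sub>R Z s) \<in> fields_along M I \<gamma>"
proof -
  have "h t *\<^sub>R Z t \<in> tangent_space M (\<gamma> t)" if "t \<in> I" for t
    using assms(1) that subspace_tangent[OF gamma_M[OF that]]
    by (intro subspace_scale) (auto simp: fields_along_def)
  then show ?thesis
    unfolding fields_along_def using field_alongD(1)[OF assms(1)] assms(2)
    by (auto intro!: smooth_on_scaleR I)
qed

lemma field_along_restrict:
  assumes "V \<in> vector_fields M"
  shows "(\<lambda>s. V (\<gamma> s)) \<in> fields_along M I \<gamma>"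
  unfolding fields_along_def
  using smooth_on_compose_smooth_map[OF I smooth in_M vector_fieldD(1)[OF assms]]
    vector_fieldD(3)[OF assms gamma_M] by simp

lemma trace_derivative_zero:
  assumes "smooth_on I \<zeta>" "\<And>t. t \<in> I \<Longrightarrow> r * trace (\<zeta> t) = 0" "t \<in> I"
  shows "r * trace (vector_derivative \<zeta> (at t) :: real^'n^'n) = 0"
proof -
  have "((\<lambda>t. r * trace (\<zeta> t)) has_vector_derivative r * trace (vector_derivative \<zeta> (at t))) (at t)"
    by (rule bounded_linear.has_vector_derivative[OF bounded_linear_const_mult[OF bounded_linear_trace]
        smooth_on_vector_derivative[OF assms(1,3)]])
  moreover have "((\<lambda>t. r * trace (\<zeta> t)) has_vector_derivative 0) (at t)"
    by (rule has_vector_derivative_transform_within_open[OF _ I assms(3)])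
       (auto intro: has_vector_derivative_const simp: assms(2))
  ultimately show ?thesis
    using vector_derivative_unique_at by blast
qed

lemma covariant_eqI:
  assumes "((lt Z) has_vector_derivative d) (at t)"
  shows "covariant \<gamma> Z t = \<gamma> t ** (d + (1/2) *\<^sub>R bracket (velocity \<gamma> t) (lt Z t))"
  using vector_derivative_at[OF assms] by (simp add: covariant_def)

lemma is_covariant_derivative_covariant:
  "is_covariant_derivative M trace_metric I \<gamma> (covariant \<gamma>)"
  unfolding is_covariant_derivative_def
proof (intro conjI ballI allI impI)
  fix Z assume Z: "Z \<in> fields_along M I \<gamma>"
  note Z' = field_alongD[OF Z]
  show "covariant \<gamma> Z \<in> fields_along M I \<gamma>"
    unfolding covariant_def[abs_def]
  proof (rule field_alongI)
    show "smooth_on I (\<lambda>t. vector_derivative (lt Z) (at t)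
        + (1/2) *\<^sub>R bracket (velocity \<gamma> t) (lt Z t))"
      by (intro smooth_on_add smooth_on_velocity smooth_on_scaleR smooth_on_const
          smooth_on_bilinear[OF bounded_bilinear_bracket] smooth_on_velocity' Z'(2) I)
    show "r * trace (vector_derivative (lt Z) (at t)
        + (1/2) *\<^sub>R bracket (velocity \<gamma> t) (lt Z t)) = 0" if "t \<in> I" for t
      using trace_derivative_zero[OF Z'(2,3) that] by (simp add: trace_distribs trace_bracket)
  qed
next
  fix Z Z' t and a b :: real
  assume *: "Z \<in> fields_along M I \<gamma>" "Z' \<in> fields_along M I \<gamma>" "t \<in> I"
  note d = smooth_on_vector_derivative[OF field_alongD(2)[OF *(1)] *(3)]
    smooth_on_vector_derivative[OF field_alongD(2)[OF *(2)] *(3)]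
  have "((\<lambda>s. a *\<^sub>R (lt Z s) + b *\<^sub>R (lt Z' s)) has_vector_derivative
      a *\<^sub>R vector_derivative (lt Z) (at t) +
      b *\<^sub>R vector_derivative (lt Z') (at t)) (at t)"
    by (intro has_vector_derivative_add bounded_linear.has_vector_derivative[OF bounded_linear_scaleR_right] d)
  then have "((\<lambda>s. matrix_inv (\<gamma> s) ** (a *\<^sub>R Z s + b *\<^sub>R Z' s)) has_vector_derivative
      a *\<^sub>R vector_derivative (lt Z) (at t) +
      b *\<^sub>R vector_derivative (lt Z') (at t)) (at t)"
    by (simp add: mm_distribs)
  from covariant_eqI[OF this]
  show "covariant \<gamma> (\<lambda>s. a *\<^sub>R Z s + b *\<^sub>R Z' s) t = a *\<^sub>R covariant \<gamma> Z t + b *\<^sub>R covariant \<gamma> Z' t"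
    by (simp add: covariant_def mm_distribs bracket_distribs scaleR_add_right mult.commute add_ac)
next
  fix Z t and h :: "real \<Rightarrow> real"
  assume *: "Z \<in> fields_along M I \<gamma>" "smooth_on I h" "t \<in> I"
  have "((\<lambda>s. h s *\<^sub>R (lt Z s)) has_vector_derivative
      h t *\<^sub>R vector_derivative (lt Z) (at t) +
      deriv h t *\<^sub>R (lt Z t)) (at t)"
    by (rule has_vector_derivative_scaleR[OF smooth_on_real_derivative[OF *(2,3)]
        smooth_on_vector_derivative[OF field_alongD(2)[OF *(1)] *(3)]])
  then have "((\<lambda>s. matrix_inv (\<gamma> s) ** (h s *\<^sub>R Z s)) has_vector_derivative
      h t *\<^sub>R vector_derivative (lt Z) (at t) +
      deriv h t *\<^sub>R (lt Z t)) (at t)"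
    by (simp add: mm.scaleR_right)
  from covariant_eqI[OF this]
  show "covariant \<gamma> (\<lambda>s. h s *\<^sub>R Z s) t = deriv h t *\<^sub>R Z t + h t *\<^sub>R covariant \<gamma> Z t"
    using field_alongD(4)[OF *(1,3)]
    by (simp add: covariant_def mm_distribs bracket_distribs scaleR_add_right mult.commute add_ac)
next
  fix V X t
  assume *: "V \<in> vector_fields M" "X \<in> vector_fields M" "t \<in> I" "X (\<gamma> t) = vector_derivative \<gamma> (at t)"
  have "((\<lambda>s. ltr V (\<gamma> (t + s))) has_vector_derivative
      differential M (ltr V) (\<gamma> t) (vector_derivative \<gamma> (at t))) (at 0)"
    by (rule differential_along_curve[OF shifted_curve[OF *(3)] vector_fieldD(2)[OF *(1)]])
  then have "((\<lambda>s. ltr V (\<gamma> s)) has_vector_derivative differential M (ltr V) (\<gamma> t) (X (\<gamma> t))) (at t)"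
    using has_vector_derivative_shift[of "\<lambda>s. ltr V (\<gamma> s)"] *(4) by simp
  then have "covariant \<gamma> (\<lambda>s. V (\<gamma> s)) t = connection X V (\<gamma> t)"
    using covariant_eqI[of "\<lambda>s. V (\<gamma> s)"] *(4) by (simp add: ltr_def connection_def velocity_def)
  then show "covariant \<gamma> (\<lambda>s. V (\<gamma> s)) t = levi_civita M trace_metric X V (\<gamma> t)"
    using levi_civita_eq[OF *(2,1) gamma_M[OF *(3)]] by simp
qed

lemma covariant_derivativeD:
  assumes "is_covariant_derivative M trace_metric I \<gamma> C"
  shows "\<lbrakk>Z \<in> fields_along M I \<gamma>; Z' \<in> fields_along M I \<gamma>; t \<in> I\<rbrakk> \<Longrightarrow>
      C (\<lambda>s. a *\<^sub>R Z s + b *\<^sub>R Z' s) t = a *\<^sub>R C Z t + b *\<^sub>R C Z' t"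
    and "\<lbrakk>Z \<in> fields_along M I \<gamma>; smooth_on I h; t \<in> I\<rbrakk> \<Longrightarrow>
      C (\<lambda>s. h s *\<^sub>R Z s) t = deriv h t *\<^sub>R Z t + h t *\<^sub>R C Z t"
    and "\<lbrakk>V \<in> vector_fields M; X \<in> vector_fields M; t \<in> I; X (\<gamma> t) = vector_derivative \<gamma> (at t)\<rbrakk> \<Longrightarrow>
      C (\<lambda>s. V (\<gamma> s)) t = levi_civita M trace_metric X V (\<gamma> t)"
  using assms unfolding is_covariant_derivative_def by simp_all

text \<open>Multiplying by the indicator of \<open>I\<close>, which is smooth on the open set \<open>I\<close>, shows that only
  the values on \<open>I\<close> matter.\<close>

lemma covariant_derivative_local:
  assumes C: "is_covariant_derivative M trace_metric I \<gamma> C"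
    and Z: "Z \<in> fields_along M I \<gamma>" "Z' \<in> fields_along M I \<gamma>" "\<And>s. s \<in> I \<Longrightarrow> Z s = Z' s" and t: "t \<in> I"
  shows "C Z t = C Z' t"
proof -
  define h where "h = (\<lambda>s. if s \<in> I then 1 else 0 :: real)"
  have h: "smooth_on I h"
    by (rule smooth_on_cong[OF I _ smooth_on_const[OF I, of 1]]) (simp add: h_def)
  have "(h has_field_derivative 0) (at t)"
    by (rule DERIV_cong_ev[THEN iffD1, OF refl _ refl DERIV_const[of 1]])
       (use eventually_nhds_in_open[OF I t] in \<open>auto simp: h_def elim: eventually_mono\<close>)
  then have h': "deriv h t = 0"
    by (rule DERIV_imp_deriv)
  have "C (\<lambda>s. h s *\<^sub>R Z s) t = C Z t" "C (\<lambda>s. h s *\<^sub>R Z' s) t = C Z' t"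
    using covariant_derivativeD(2)[OF C Z(1) h t] covariant_derivativeD(2)[OF C Z(2) h t] h' t
    by (simp_all add: h_def)
  moreover have "(\<lambda>s. h s *\<^sub>R Z s) = (\<lambda>s. h s *\<^sub>R Z' s)"
    using Z(3) by (auto simp: h_def)
  ultimately show ?thesis
    by simp
qed

text \<open>On \<open>I\<close> every field along the curve is a combination, with smooth
  coefficients, of restrictions of left-invariant fields. Linearity, the product rule and the clause
  on restrictions determine any covariant derivative of such a combination.\<close>

lemma covariant_derivative_unique:
  assumes C: "is_covariant_derivative M trace_metric I \<gamma> C" and C': "is_covariant_derivative M trace_metric I \<gamma> C'"
    and Z: "Z \<in> fields_along M I \<gamma>" and t: "t \<in> I"
  shows "C Z t = C' Z t"
proof -
  define h where "h = (\<lambda>b s. (lt Z s) \<bullet> b)"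
  define V where "V = (\<lambda>b (q :: real^'n^'n). q ** proj b)"
  obtain X where X: "X \<in> vector_fields M" "X (\<gamma> t) = vector_derivative \<gamma> (at t)"
    using extend_tangent[OF gamma_M[OF t] velocity_tangent[OF t]] by metis
  have V: "V b \<in> vector_fields M" for b
    unfolding V_def by (rule left_invariant_field[OF trace_proj])
  have h: "smooth_on I (h b)" for b
    unfolding h_def by (intro smooth_on_inner field_alongD(2)[OF Z] smooth_on_const I)
  have field: "(\<lambda>s. h b s *\<^sub>R V b (\<gamma> s)) \<in> fields_along M I \<gamma>" for b
    by (intro field_along_scale field_along_restrict V h)
  \<comment> \<open>Start of the induction over the sum: linearity with both coefficients 0 forces
    the value 0 on the zero field.\<close>
  have zero: "(\<lambda>s. 0) \<in> fields_along M I \<gamma>"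
    using field_along_lincomb[OF Z Z, of 0 0] by simp
  have "(\<lambda>s. \<Sum>b\<in>B. h b s *\<^sub>R V b (\<gamma> s)) \<in> fields_along M I \<gamma> \<and>
      C (\<lambda>s. \<Sum>b\<in>B. h b s *\<^sub>R V b (\<gamma> s)) t = C' (\<lambda>s. \<Sum>b\<in>B. h b s *\<^sub>R V b (\<gamma> s)) t" if "finite B" for B
    using that
  proof induction
    case empty
    then show ?case
      using zero covariant_derivativeD(1)[OF C zero zero t, of 0 0] covariant_derivativeD(1)[OF C' zero zero t, of 0 0]
      by simp
  next
    case (insert b B)
    have "C (\<lambda>s. h b s *\<^sub>R V b (\<gamma> s)) t = C' (\<lambda>s. h b s *\<^sub>R V b (\<gamma> s)) t"
      using covariant_derivativeD(2)[OF C field_along_restrict[OF V] h t]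
        covariant_derivativeD(2)[OF C' field_along_restrict[OF V] h t]
        covariant_derivativeD(3)[OF C V X(1) t X(2)] covariant_derivativeD(3)[OF C' V X(1) t X(2)] by simp
    then show ?case
      using insert field_along_lincomb[OF field[of b], of "\<lambda>s. \<Sum>b\<in>B. h b s *\<^sub>R V b (\<gamma> s)" 1 1]
        covariant_derivativeD(1)[OF C field[of b] _ t, of "\<lambda>s. \<Sum>b\<in>B. h b s *\<^sub>R V b (\<gamma> s)" 1 1]
        covariant_derivativeD(1)[OF C' field[of b] _ t, of "\<lambda>s. \<Sum>b\<in>B. h b s *\<^sub>R V b (\<gamma> s)" 1 1]
      by simp
  qed
  from this[OF finite_Basis]
  have sum: "(\<lambda>s. \<Sum>b\<in>Basis. h b s *\<^sub>R V b (\<gamma> s)) \<in> fields_along M I \<gamma>"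
    "C (\<lambda>s. \<Sum>b\<in>Basis. h b s *\<^sub>R V b (\<gamma> s)) t = C' (\<lambda>s. \<Sum>b\<in>Basis. h b s *\<^sub>R V b (\<gamma> s)) t"
    by auto
  have expand: "Z s = (\<Sum>b\<in>Basis. h b s *\<^sub>R V b (\<gamma> s))" if s: "s \<in> I" for s
  proof -
    define x where "x = lt Z s"
    \<comment> \<open>Projecting the basis vectors makes the fields \<open>V b\<close> tangent to
      \<open>M\<close>; the expansion survives because x already satisfies the trace
      condition.\<close>
    have "x = proj x"
      using field_alongD(3)[OF Z s] by (simp add: x_def proj_fixed)
    also have "\<dots> = proj (\<Sum>b\<in>Basis. (x \<bullet> b) *\<^sub>R b)"
      by (simp add: euclidean_representation)
    also have "\<dots> = (\<Sum>b\<in>Basis. (x \<bullet> b) *\<^sub>R proj b)"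
      by (simp add: linear_sum[OF linear_proj] linear_cmul[OF linear_proj])
    finally have "\<gamma> s ** x = (\<Sum>b\<in>Basis. (x \<bullet> b) *\<^sub>R (\<gamma> s ** proj b))"
      by (metis (no_types, lifting) mm.sum_right mm.scaleR_right sum.cong)
    then show ?thesis
      using field_alongD(4)[OF Z s] by (simp add: x_def h_def V_def)
  qed
  show ?thesis
    using covariant_derivative_local[OF C Z sum(1) expand t] covariant_derivative_local[OF C' Z sum(1) expand t] sum(2)
    by simp
qed

lemma covariant_derivative_eq:
  assumes "Z \<in> fields_along M I \<gamma>" "t \<in> I"
  shows "covariant_derivative M trace_metric I \<gamma> Z t = covariant \<gamma> Z t"
proof (rule covariant_derivative_unique[OF _ is_covariant_derivative_covariant assms])
  show "is_covariant_derivative M trace_metric I \<gamma> (covariant_derivative M trace_metric I \<gamma>)"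
    unfolding covariant_derivative_def
    by (rule someI[where P = "is_covariant_derivative M trace_metric I \<gamma>", OF is_covariant_derivative_covariant])
qed

text \<open>The bracket of the trivialised velocity with itself vanishes, so only its ordinary
  derivative remains.\<close>

lemma geodesic_equation:
  assumes "t \<in> I"
  shows "covariant_derivative M trace_metric I \<gamma> (\<lambda>s. vector_derivative \<gamma> (at s)) t = 0 \<longleftrightarrow>
    vector_derivative (velocity \<gamma>) (at t) = 0"
proof -
  have "(\<lambda>s. matrix_inv (\<gamma> s) ** vector_derivative \<gamma> (at s)) = velocity \<gamma>"
    by (simp add: velocity_def fun_eq_iff)
  then have "covariant \<gamma> (\<lambda>s. vector_derivative \<gamma> (at s)) t = \<gamma> t ** vector_derivative (velocity \<gamma>) (at t)"
    unfolding covariant_def by (simp add: velocity_def[symmetric] bracket_self)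
  moreover have "\<gamma> t ** x = 0 \<longleftrightarrow> x = 0" for x :: "real^'n^'n"
    using matrix_inv_cancel_left[OF gamma_GL[OF assms], of x] by (auto simp: mm.zero_right)
  ultimately show ?thesis
    using covariant_derivative_eq[OF velocity_field assms] by simp
qed

end

section \<open>Geodesics as translated one-parameter subgroups\<close>

text \<open>On an interval, vanishing derivative makes the trivialised velocity a constant C; then
  \<gamma>' = \<gamma> C, which \<open>matrix_ode_unique\<close> solves. Conversely, the velocity of
  K exp (t C) trivialises to C because C commutes with its exponential.\<close>

lemma geodesic_on_iff:
  "geodesic_on M trace_metric I \<gamma> \<longleftrightarrow> open I \<and> is_interval I \<and> I \<noteq> {} \<and>
    (\<exists>K C. K \<in> GL \<and> r * trace C = 0 \<and> (\<forall>t\<in>I. \<gamma> t = K ** matrix_exp (t *\<^sub>R C) \<and> \<gamma> t \<in> M))"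
proof
  assume geo: "geodesic_on M trace_metric I \<gamma>"
  then have I: "open I" "is_interval I" "I \<noteq> {}" "smooth_on I \<gamma>" "\<gamma> ` I \<subseteq> M"
    by (auto simp: geodesic_on_def)
  note along = I(1,4,5)
  have zero: "vector_derivative (velocity \<gamma>) (at t) = 0" if "t \<in> I" for t
    using geo that geodesic_equation[OF along that] by (simp add: geodesic_on_def)
  have "(velocity \<gamma> has_derivative (\<lambda>h. 0)) (at t within I)" if "t \<in> I" for t
    using smooth_on_vector_derivative[OF smooth_on_velocity'[OF along] that] zero[OF that]
    by (simp add: has_vector_derivative_def has_derivative_at_withinI)
  then have "\<exists>C. \<forall>t\<in>I. velocity \<gamma> t = C"
    using has_derivative_zero_constant[OF is_interval_convex[OF I(2)]] by blast
  then obtain C where C: "\<And>t. t \<in> I \<Longrightarrow> velocity \<gamma> t = C"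
    by blast
  have "(\<gamma> has_vector_derivative \<gamma> t ** C) (at t)" if "t \<in> I" for t
    using smooth_on_vector_derivative[OF I(4) that] C[OF that] gamma_GL[OF along that]
    by (simp add: velocity_def[abs_def] matrix_cancel flip: C[OF that])
  then obtain K where K: "\<forall>t\<in>I. \<gamma> t = K ** matrix_exp (t *\<^sub>R C)"
    using matrix_ode_unique[OF I(1,2)] by blast
  obtain t where t: "t \<in> I"
    using I(3) by blast
  \<comment> \<open>K is a factor of the invertible matrix \<gamma> t at any one parameter
    t.\<close>
  have "K \<in> GL"
    using gamma_GL[OF along t] K t by (auto simp: GL_iff_det det_mul)
  moreover have "r * trace C = 0"
    using velocity_trace[OF along t] C[OF t] by simp
  ultimately show "open I \<and> is_interval I \<and> I \<noteq> {} \<and>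
    (\<exists>K C. K \<in> GL \<and> r * trace C = 0 \<and> (\<forall>t\<in>I. \<gamma> t = K ** matrix_exp (t *\<^sub>R C) \<and> \<gamma> t \<in> M))"
    using I K by blast
next
  assume "open I \<and> is_interval I \<and> I \<noteq> {} \<and>
    (\<exists>K C. K \<in> GL \<and> r * trace C = 0 \<and> (\<forall>t\<in>I. \<gamma> t = K ** matrix_exp (t *\<^sub>R C) \<and> \<gamma> t \<in> M))"
  then obtain K C where I: "open I" "is_interval I" "I \<noteq> {}" and K: "K \<in> GL"
    and \<gamma>: "\<And>t. t \<in> I \<Longrightarrow> \<gamma> t = K ** matrix_exp (t *\<^sub>R C)" "\<And>t. t \<in> I \<Longrightarrow> \<gamma> t \<in> M"
    by blast
  have smooth: "smooth_on I \<gamma>"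
    by (rule smooth_on_cong[OF I(1) _ smooth_on_subset[OF smooth_on_matrix_exp_curve subset_UNIV]]) (simp add: \<gamma>(1))
  have M: "\<gamma> ` I \<subseteq> M"
    using \<gamma>(2) by blast
  note along = I(1) smooth M
  have vel: "velocity \<gamma> t = C" if "t \<in> I" for t
  proof -
    have "(\<gamma> has_vector_derivative K ** (C ** matrix_exp (t *\<^sub>R C))) (at t)"
      by (rule has_vector_derivative_transform_within_open[OF matrix_exp_curve_derivative I(1) that]) (simp add: \<gamma>(1))
    then have "vector_derivative \<gamma> (at t) = \<gamma> t ** C"
      by (simp add: vector_derivative_at \<gamma>(1)[OF that] matrix_exp_commute matrix_mul_assoc)
    then show ?thesis
      using gamma_GL[OF along that] by (simp add: velocity_def matrix_cancel)
  qed
  have "vector_derivative (velocity \<gamma>) (at t) = 0" if "t \<in> I" for t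
  proof (rule vector_derivative_at)
    show "(velocity \<gamma> has_vector_derivative 0) (at t)"
      by (rule has_vector_derivative_transform_within_open[OF has_vector_derivative_const I(1) that]) (simp add: vel)
  qed
  then show "geodesic_on M trace_metric I \<gamma>"
    unfolding geodesic_on_def using I along geodesic_equation[OF along] by simp
qed

end

subsection \<open>The leaves\<close>

lemma trace_group_GL: "trace_group GL 0"
  by unfold_locales (auto simp: tangent_space_open[OF open_GL])

lemma trace_group_SL: "trace_group (SL c) 1"
  by unfold_locales (auto simp: SL_subset_GL[THEN subsetD] tangent_space_SL)

lemma semi_riemannian_manifold_GL: "semi_riemannian_manifold (GL :: (real^'n^'n) set) trace_metric"
  unfolding semi_riemannian_manifold_def
  using manifold_GL trace_group.semi_riemannian_metric_trace_metric[OF trace_group_GL] by blast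

lemma semi_riemannian_manifold_SL:
  "c \<noteq> 0 \<Longrightarrow> semi_riemannian_manifold (SL c :: (real^'n^'n) set) trace_metric"
  unfolding semi_riemannian_manifold_def
  using manifold_SL trace_group.semi_riemannian_metric_trace_metric[OF trace_group_SL] by blast

lemma has_signature_SL:
  "has_signature (SL c :: (real^'n^'n) set) trace_metric
    (CARD('n) * (CARD('n) + 1) div 2 - 1, CARD('n) * (CARD('n) - 1) div 2)"
proof (rule trace_group.has_signature_trace_metric[OF trace_group_SL])
  have even: "even (CARD('n) * (CARD('n) + 1))" "even (CARD('n) * (CARD('n) - 1))"
    by auto
  have half: "real (CARD('n) * (CARD('n) + 1) div 2) = real (CARD('n) * (CARD('n) + 1)) / 2"
    using real_of_nat_div[OF even(1)] by simp
  \<comment> \<open>Positivity makes the natural number subtraction of 1 exact.\<close>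
  have "real (CARD('n) * (CARD('n) + 1) div 2) > 0"
    unfolding half by (simp add: add_pos_pos)
  then have "CARD('n) * (CARD('n) + 1) div 2 > 0"
    by (simp only: of_nat_0_less_iff)
  with half show "real (CARD('n) * (CARD('n) + 1) div 2 - 1) = ((real CARD('n))\<^sup>2 + real CARD('n)) / 2 - 1"
    by (simp add: of_nat_diff Suc_le_eq power2_eq_square distrib_left)
  have "real (CARD('n) * (CARD('n) - 1) div 2) = real (CARD('n) * (CARD('n) - 1)) / 2"
    using real_of_nat_div[OF even(2)] by simp
  then show "real (CARD('n) * (CARD('n) - 1) div 2) = ((real CARD('n))\<^sup>2 - real CARD('n)) / 2"
    by (simp add: of_nat_diff Suc_le_eq power2_eq_square right_diff_distrib)
qed

lemma ricci_SL:
  fixes p :: "real^'n^'n"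
  assumes "p \<in> SL c" "v \<in> tangent_space (SL c) p" "w \<in> tangent_space (SL c) p"
  shows "ricci (SL c) trace_metric p v w = - (real CARD('n) / 2) * trace_metric p v w"
proof -
  interpret trace_group "SL c :: (real^'n^'n) set" 1
    by (rule trace_group_SL)
  obtain x where x: "v = p ** x" "1 * trace x = 0"
    using tangentE[OF assms(1,2)] by metis
  obtain y where y: "w = p ** y" "1 * trace y = 0"
    using tangentE[OF assms(1,3)] by metis
  show ?thesis
    using ricci_eq[OF assms(1) x(2) y(2)] x y GL[OF assms(1)] by (simp add: trace_metric_left)
qed

lemma einstein_SL: "c \<noteq> 0 \<Longrightarrow> einstein (SL c :: (real^'n^'n) set) trace_metric"
  unfolding einstein_def using semi_riemannian_manifold_SL ricci_SL by blast

text \<open>The Einstein constant - n/2 times the dimension n^2 - 1 of the leaf.\<close>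

lemma scalar_curvature_SL:
  fixes p :: "real^'n^'n"
  assumes "p \<in> SL c"
  shows "scalar_curvature (SL c) trace_metric p = - ((real CARD('n) - 1) * real CARD('n) * (real CARD('n) + 1) / 2)"
  unfolding scalar_curvature_def
  using trace_group.form_trace_trace_metric[OF trace_group_SL assms ricci_SL[OF assms]]
  by (simp add: power2_eq_square field_simps)

lemma semi_riemannian_submanifold_SL:
  "c \<noteq> 0 \<Longrightarrow> semi_riemannian_submanifold GL trace_metric (SL c :: (real^'n^'n) set)"
  unfolding semi_riemannian_submanifold_def
  using semi_riemannian_manifold_GL semi_riemannian_manifold_SL SL_subset_GL by blast

lemma semi_riemannian_hypersurface_SL:
  assumes "c \<noteq> 0"
  shows "semi_riemannian_hypersurface GL trace_metric (SL c :: (real^'n^'n) set)"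
proof -
  have "Suc ((CARD('n))\<^sup>2 - 1) = (CARD('n))\<^sup>2"
    by simp
  then show ?thesis
    unfolding semi_riemannian_hypersurface_def
    using semi_riemannian_submanifold_SL[OF assms] manifold_GL[where 'n = 'n] manifold_SL[OF assms, where 'n = 'n]
    by metis
qed

lemma curves_through_mono: "M \<subseteq> N \<Longrightarrow> curves_through M p v \<subseteq> curves_through N p v"
  unfolding curves_through_def by blast

lemma smooth_map_subset:
  assumes "smooth_map N f" "M \<subseteq> N"
  shows "smooth_map M f"
  unfolding smooth_map_def
proof
  fix p assume "p \<in> M"
  then have "p \<in> N"
    using assms(2) by blast
  then obtain U F where "open U" "p \<in> U" "smooth_on U F" "\<And>q. q \<in> U \<Longrightarrow> q \<in> N \<Longrightarrow> F q = f q"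
    using smooth_mapE[OF assms(1)] by metis
  then show "\<exists>U F. open U \<and> p \<in> U \<and> smooth_on U F \<and> (\<forall>q\<in>U \<inter> M. F q = f q)"
    using assms(2) by (intro exI[of _ U] exI[of _ F]) auto
qed

lemma totally_geodesic_SL:
  fixes c :: real
  assumes "c \<noteq> 0"
  shows "totally_geodesic GL trace_metric (SL c :: (real^'n^'n) set)"
  unfolding totally_geodesic_def
proof (intro conjI ballI)
  show "semi_riemannian_submanifold GL trace_metric (SL c :: (real^'n^'n) set)"
    by (rule semi_riemannian_submanifold_SL[OF assms])
  interpret GL: trace_group "GL :: (real^'n^'n) set" 0
    by (rule trace_group_GL)
  interpret SL: trace_group "SL c :: (real^'n^'n) set" 1
    by (rule trace_group_SL)
  fix p x y :: "real^'n^'n"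
  assume p: "p \<in> SL c" and x: "x \<in> tangent_space (SL c) p" and y: "y \<in> tangent_space (SL c) p"
  note pGL = SL.GL[OF p]
  \<comment> \<open>Tangential vectors have no normal part: a normal vector that is also tangent is
    0, since the metric is nondegenerate on the leaf.\<close>
  have normal_zero: "normal_part GL trace_metric (SL c) p v = 0" if v: "v \<in> tangent_space (SL c) p" for v
    unfolding normal_part_def
  proof (rule the_equality)
    show "0 \<in> tangent_space GL p \<and> (\<forall>u\<in>tangent_space (SL c) p. trace_metric p 0 u = 0) \<and>
        v - 0 \<in> tangent_space (SL c) p"
      using v by (simp add: tangent_space_open[OF open_GL pGL] trace_metric_eq mm.zero_left mm.zero_right trace_zero)
  next
    fix w assume w: "w \<in> tangent_space GL p \<and> (\<forall>u\<in>tangent_space (SL c) p. trace_metric p w u = 0) \<and>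
        v - w \<in> tangent_space (SL c) p"
    have "v - (v - w) \<in> tangent_space (SL c) p"
      using v w subspace_diff[OF SL.subspace_tangent[OF p]] by blast
    then show "w = 0"
      using SL.trace_metric_nondegenerate[OF p] w by simp
  qed
  have tangential: "levi_civita GL trace_metric X Y p \<in> tangent_space (SL c) p"
    if X: "X \<in> vector_fields GL" and Y: "Y \<in> vector_fields GL"
      and T: "\<forall>q\<in>SL c. X q \<in> tangent_space (SL c) q \<and> Y q \<in> tangent_space (SL c) q" for X Y
  proof -
    have XpT: "X p \<in> tangent_space (SL c) p"
      using T p by blast
    then obtain \<gamma> where \<gamma>: "\<gamma> \<in> curves_through (SL c) p (X p)"
      unfolding tangent_space_def by blast
    have smY: "smooth_map (SL c) (GL.ltr Y)"
      by (rule smooth_map_subset[OF GL.vector_fieldD(2)[OF Y] SL_subset_GL])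
    \<comment> \<open>In a direction tangent to the leaf the differential may be computed inside the
      leaf. There the trivialised Y is traceless, which it need not be elsewhere in
      \<open>GL\<close>.\<close>
    have "differential (SL c) (GL.ltr Y) p (X p) = differential GL (GL.ltr Y) p (X p)"
      using curves_through_mono[OF SL_subset_GL] \<gamma>
      by (intro differential_eq_curve[OF \<gamma> smY] differential_along_curve GL.vector_fieldD(2)[OF Y]) blast
    moreover have "1 * trace (differential (SL c) (GL.ltr Y) p (X p)) = 0"
    proof (rule SL.differential_trace_zero[OF smY _ p XpT])
      fix q :: "real^'n^'n" assume "q \<in> SL c"
      then have "Y q \<in> tangent_space (SL c) q"
        using T by blast
      then show "1 * trace (GL.ltr Y q) = 0"
        using SL.tangent[OF \<open>q \<in> SL c\<close>] by (simp add: GL.ltr_def)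
    qed
    ultimately have "1 * trace (differential GL (GL.ltr Y) p (X p) + (1/2) *\<^sub>R bracket (GL.ltr X p) (GL.ltr Y p)) = 0"
      by (simp add: trace_distribs trace_bracket)
    then show ?thesis
      using GL.levi_civita_eq[OF X Y pGL] SL.left_mult_tangent_iff[OF p]
      by (simp add: GL.connection_def)
  qed
  show "shape_tensor GL trace_metric (SL c) p x y = 0"
    unfolding shape_tensor_def
  proof (rule the_equality)
    show "\<forall>X\<in>vector_fields GL. \<forall>Y\<in>vector_fields GL.
        (\<forall>q\<in>SL c. X q \<in> tangent_space (SL c) q \<and> Y q \<in> tangent_space (SL c) q) \<and> X p = x \<and> Y p = y \<longrightarrow>
        normal_part GL trace_metric (SL c) p (levi_civita GL trace_metric X Y p) = 0"
      using normal_zero tangential by blast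
  next
    fix w
    assume w: "\<forall>X\<in>vector_fields GL. \<forall>Y\<in>vector_fields GL.
        (\<forall>q\<in>SL c. X q \<in> tangent_space (SL c) q \<and> Y q \<in> tangent_space (SL c) q) \<and> X p = x \<and> Y p = y \<longrightarrow>
        normal_part GL trace_metric (SL c) p (levi_civita GL trace_metric X Y p) = w"
    obtain x' where x': "x = p ** x'" "1 * trace x' = 0"
      using SL.tangentE[OF p x] by metis
    obtain y' where y': "y = p ** y'" "1 * trace y' = 0"
      using SL.tangentE[OF p y] by metis
    \<comment> \<open>Left-invariant fields through traceless matrices are tangent to the leaf, so
      admissible extensions of x and y exist and fix the value of the \<open>THE\<close>.\<close>
    define X where "X = (\<lambda>q :: real^'n^'n. q ** x')"
    define Y where "Y = (\<lambda>q :: real^'n^'n. q ** y')"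
    have fields: "X \<in> vector_fields GL" "Y \<in> vector_fields GL"
      unfolding X_def Y_def by (rule GL.left_invariant_field; simp)+
    have T: "\<forall>q\<in>SL c. X q \<in> tangent_space (SL c) q \<and> Y q \<in> tangent_space (SL c) q"
      unfolding X_def Y_def using SL.left_mult_tangent_iff x'(2) y'(2) by blast
    have "X p = x" "Y p = y"
      by (simp_all add: X_def Y_def x' y')
    then have "normal_part GL trace_metric (SL c) p (levi_civita GL trace_metric X Y p) = w"
      using w fields T by blast
    then show "w = 0"
      using normal_zero[OF tangential[OF fields T]] by simp
  qed
qed

section \<open>Isometries between leaves and geodesic symmetries\<close>

lemma isometry_left_mult:
  fixes K :: "real^'n^'n"
  assumes "K \<in> GL"
  shows "isometry (SL c) trace_metric (SL (det K * c)) trace_metric (\<lambda>X. K ** X)"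
  unfolding isometry_def
proof (intro conjI ballI)
  have lin: "smooth_map M (\<lambda>X. A ** X)" for M :: "(real^'n^'n) set" and A :: "real^'n^'n"
    using smooth_map_linear[OF mm.bounded_linear_right smooth_map_ident] .
  have "(\<lambda>X. K ** X) ` SL c = SL (det K * c)"
  proof
    show "SL (det K * c) \<subseteq> (\<lambda>X. K ** X) ` SL c"
    proof
      fix X :: "real^'n^'n" assume X: "X \<in> SL (det K * c)"
      have "matrix_inv K ** X \<in> SL c"
        using X assms by (simp add: SL_def GL_mult GL_inv det_mul det_inv) (simp add: GL_iff_det)
      then show "X \<in> (\<lambda>X. K ** X) ` SL c"
        using assms by (intro image_eqI[of _ _ "matrix_inv K ** X"]) (simp_all add: matrix_cancel)
    qed
  qed (use assms in \<open>auto simp: SL_def GL_mult det_mul\<close>)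
  moreover have "\<forall>X\<in>SL c. matrix_inv K ** (K ** X) = X"
    using assms by (simp add: matrix_cancel)
  ultimately show "diffeomorphism (SL c) (SL (det K * c)) (\<lambda>X. K ** X)"
    unfolding diffeomorphism_def using lin by blast
  fix p v w :: "real^'n^'n"
  assume p: "p \<in> SL c" and v: "v \<in> tangent_space (SL c) p" and w: "w \<in> tangent_space (SL c) p"
  have d: "differential (SL c) (\<lambda>X. K ** X) p u = K ** u" if "u \<in> tangent_space (SL c) p" for u
    using differential_linear[OF mm.bounded_linear_right that smooth_map_ident] by (simp add: differential_ident[OF that])
  have "matrix_inv (K ** p) ** (K ** u) = matrix_inv p ** u" for u :: "real^'n^'n"
    using assms p by (simp add: SL_def matrix_inv_mult matrix_mul_assoc[symmetric] matrix_cancel)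
  then show "trace_metric (K ** p) (differential (SL c) (\<lambda>X. K ** X) p v) (differential (SL c) (\<lambda>X. K ** X) p w)
      = trace_metric p v w"
    by (simp add: trace_metric_eq d v w)
qed

lemma isometric_SL:
  assumes "c \<noteq> 0" "d \<noteq> 0"
  shows "isometric (SL c :: (real^'n^'n) set) trace_metric (SL d :: (real^'n^'n) set) trace_metric"
proof -
  define K :: "real^'n^'n" where "K = scaling undefined (d / c)"
  have "det K = d / c"
    by (simp add: K_def det_scaling)
  then have "K \<in> GL" "det K * c = d"
    using assms by (simp_all add: GL_iff_det)
  then show ?thesis
    unfolding isometric_def using isometry_left_mult[of K c] by metis
qed

lemma isometry_geodesic_symmetry:
  fixes p :: "real^'n^'n"
  assumes p: "p \<in> SL c"
  defines "\<sigma> \<equiv> \<lambda>X. p ** matrix_inv X ** p"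
  shows "isometry (SL c) trace_metric (SL c) trace_metric \<sigma>"
    and "\<sigma> p = p" and "v \<in> tangent_space (SL c) p \<Longrightarrow> differential (SL c) \<sigma> p v = - v"
proof -
  interpret trace_group "SL c :: (real^'n^'n) set" 1
    by (rule trace_group_SL)
  note pGL = GL[OF p]
  have inv: "smooth_map (SL c) (matrix_inv :: real^'n^'n \<Rightarrow> _)"
    by (rule smooth_map_smooth_on[OF open_GL smooth_on_matrix_inv SL_subset_GL])
  have lin: "bounded_linear (\<lambda>X. p ** X ** p)"
    by (rule bounded_linear_compose[OF mm.bounded_linear_left mm.bounded_linear_right])
  have \<sigma>_eq: "\<sigma> X = p ** matrix_inv X ** p" for X
    by (simp add: \<sigma>_def)
  have smooth: "smooth_map (SL c) \<sigma>"
    unfolding \<sigma>_def by (rule smooth_map_linear[OF lin inv])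
  have into: "\<sigma> X \<in> SL c" if "X \<in> SL c" for X
    using that p unfolding \<sigma>_def
    by (simp add: SL_def GL_mult GL_inv det_mul det_inv) (simp add: GL_iff_det)
  have inv_\<sigma>: "matrix_inv (\<sigma> X) = matrix_inv p ** X ** matrix_inv p" if "X \<in> SL c" for X
    using GL[OF that] pGL by (simp add: \<sigma>_def matrix_inv_mult GL_mult GL_inv matrix_inv_inv matrix_mul_assoc)
  have invol: "\<sigma> (\<sigma> X) = X" if "X \<in> SL c" for X
    using pGL unfolding \<sigma>_eq[of "\<sigma> X"] inv_\<sigma>[OF that]
    by (simp add: matrix_mul_assoc[symmetric] matrix_cancel)
  show "\<sigma> p = p"
    using pGL by (simp add: \<sigma>_def matrix_cancel)
  have d_inv: "differential (SL c) matrix_inv q u = - (matrix_inv q ** u ** matrix_inv q)"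
    if q: "q \<in> SL c" and u: "u \<in> tangent_space (SL c) q" for q u :: "real^'n^'n"
  proof -
    \<comment> \<open>The derivative of inversion comes from differentiating the constant product of
      X with its inverse.\<close>
    have "differential (SL c) (\<lambda>X. X ** matrix_inv X) q u = differential (SL c) (\<lambda>X. mat 1) q u"
      by (rule differential_cong[OF u smooth_map_bilinear[OF bounded_bilinear_matrix_mult smooth_map_ident inv]])
         (simp add: matrix_inv_right GL)
    then have "q ** differential (SL c) matrix_inv q u + u ** matrix_inv q = 0"
      using differential_bilinear[OF bounded_bilinear_matrix_mult u smooth_map_ident inv]
      by (simp add: differential_const[OF u] differential_ident[OF u])
    then have "q ** differential (SL c) matrix_inv q u = - (u ** matrix_inv q)"
      by (simp only: eq_neg_iff_add_eq_0)
    then have "matrix_inv q ** (q ** differential (SL c) matrix_inv q u) = matrix_inv q ** (- (u ** matrix_inv q))"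
      by (simp only:)
    then show ?thesis
      using GL[OF q] by (simp add: matrix_cancel mm.minus_right matrix_mul_assoc)
  qed
  have d: "differential (SL c) \<sigma> q u = - (p ** (matrix_inv q ** u ** matrix_inv q) ** p)"
    if q: "q \<in> SL c" and u: "u \<in> tangent_space (SL c) q" for q u :: "real^'n^'n"
    unfolding \<sigma>_def differential_linear[OF lin u inv] d_inv[OF q u] by (simp add: mm.minus_left mm.minus_right)
  show "differential (SL c) \<sigma> p v = - v" if "v \<in> tangent_space (SL c) p"
    using pGL unfolding d[OF p that] by (simp add: matrix_mul_assoc[symmetric] matrix_cancel)
  show "isometry (SL c) trace_metric (SL c) trace_metric \<sigma>"
    unfolding isometry_def
  proof (intro conjI ballI)
    have "\<sigma> ` SL c = SL c"
    proof
      show "SL c \<subseteq> \<sigma> ` SL c"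
        using invol into by (metis image_eqI subsetI)
    qed (use into in blast)
    then show "diffeomorphism (SL c) (SL c) \<sigma>"
      unfolding diffeomorphism_def using smooth invol by blast
    fix q v w :: "real^'n^'n"
    assume q: "q \<in> SL c" and v: "v \<in> tangent_space (SL c) q" and w: "w \<in> tangent_space (SL c) q"
    \<comment> \<open>The trivialised image is minus a conjugate, by p, of u times the inverse of q.
      In the trace form the signs and the conjugation cancel, and cyclicity moves the inverse of q
      to the left of u.\<close>
    have eq: "matrix_inv (\<sigma> q) ** differential (SL c) \<sigma> q u = - (matrix_inv p ** (u ** (matrix_inv q ** p)))"
      if u: "u \<in> tangent_space (SL c) q" for u
      using pGL GL[OF q] unfolding inv_\<sigma>[OF q] d[OF q u]
      by (simp add: matrix_mul_assoc[symmetric] matrix_cancel mm.minus_right)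
    have "trace_metric (\<sigma> q) (differential (SL c) \<sigma> q v) (differential (SL c) \<sigma> q w) =
        trace (matrix_inv p ** (v ** (matrix_inv q ** (w ** (matrix_inv q ** p)))))"
      unfolding trace_metric_eq eq[OF v] eq[OF w] using pGL
      by (simp add: mm.minus_left mm.minus_right matrix_mul_assoc[symmetric] matrix_cancel)
    also have "\<dots> = trace ((v ** (matrix_inv q ** (w ** (matrix_inv q ** p)))) ** matrix_inv p)"
      by (rule trace_mul_sym)
    also have "\<dots> = trace ((v ** (matrix_inv q ** w)) ** matrix_inv q)"
      using pGL by (simp add: matrix_mul_assoc[symmetric] matrix_cancel)
    also have "\<dots> = trace (matrix_inv q ** (v ** (matrix_inv q ** w)))"
      by (rule trace_mul_sym)
    finally show "trace_metric (\<sigma> q) (differential (SL c) \<sigma> q v) (differential (SL c) \<sigma> q w) = trace_metric q v w"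
      by (simp add: trace_metric_eq matrix_mul_assoc)
  qed
qed

lemma symmetric_space_SL:
  assumes "c \<noteq> 0"
  shows "symmetric_space (SL c :: (real^'n^'n) set) trace_metric"
  unfolding symmetric_space_def
proof (intro conjI ballI)
  show "semi_riemannian_manifold (SL c :: (real^'n^'n) set) trace_metric"
    by (rule semi_riemannian_manifold_SL[OF assms])
  show "connected (SL c :: (real^'n^'n) set)"
    by (rule path_connected_imp_connected[OF path_connected_SL[OF assms]])
  fix p :: "real^'n^'n" assume p: "p \<in> SL c"
  show "\<exists>f. isometry (SL c) trace_metric (SL c) trace_metric f \<and> f p = p \<and>
      (\<forall>v\<in>tangent_space (SL c) p. differential (SL c) f p v = - v)"
    using isometry_geodesic_symmetry[OF p] by blast
qed

section \<open>Geodesics and completeness of the leaves\<close>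

lemma geodesic_on_SL_iff:
  fixes P :: "real \<Rightarrow> real^'n^'n"
  assumes "c \<noteq> 0"
  shows "geodesic_on (SL c) trace_metric I P \<longleftrightarrow> open I \<and> is_interval I \<and> I \<noteq> {} \<and>
    (\<exists>K C. det K = c \<and> trace C = 0 \<and> (\<forall>t\<in>I. P t = K ** matrix_exp (t *\<^sub>R C)))"
proof -
  \<comment> \<open>Exponentials of traceless matrices have determinant 1, so the curve lies in the
    leaf at one parameter, hence at all, exactly when det K = c. A nonempty \<open>I\<close>
    provides that parameter.\<close>
  have eq: "(K \<in> GL \<and> 1 * trace C = 0 \<and> (\<forall>t\<in>I. P t = K ** matrix_exp (t *\<^sub>R C) \<and> P t \<in> SL c)) \<longleftrightarrow>
      (det K = c \<and> trace C = 0 \<and> (\<forall>t\<in>I. P t = K ** matrix_exp (t *\<^sub>R C)))"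
    if I: "I \<noteq> {}" for K C
  proof (cases "trace C = 0")
    case True
    have "K ** matrix_exp (t *\<^sub>R C) \<in> SL c \<longleftrightarrow> det K = c" for t
      using assms True by (simp add: SL_iff det_mul det_matrix_exp)
    moreover have "K \<in> GL" if "det K = c"
      using that assms by (simp add: GL_iff_det)
    ultimately show ?thesis
      using True I by (metis all_not_in_conv mult_1)
  qed simp
  show ?thesis
  proof (cases "I = {}")
    case False
    show ?thesis
      unfolding trace_group.geodesic_on_iff[OF trace_group_SL] eq[OF False] by (rule refl)
  qed (simp add: geodesic_on_def)
qed

text \<open>The formula for a geodesic on \<open>I\<close> makes sense on the whole real line and is
  a geodesic there with the same K and C, so maximality leaves only \<open>UNIV\<close>.\<close>

lemma maximal_geodesic_SL_iff:
  fixes P :: "real \<Rightarrow> real^'n^'n"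
  assumes "c \<noteq> 0"
  shows "maximal_geodesic (SL c) trace_metric I P \<longleftrightarrow> I = UNIV \<and>
    (\<exists>K C. det K = c \<and> trace C = 0 \<and> (\<forall>t. P t = K ** matrix_exp (t *\<^sub>R C)))"
proof
  assume max: "maximal_geodesic (SL c) trace_metric I P"
  then have "geodesic_on (SL c) trace_metric I P"
    by (simp add: maximal_geodesic_def)
  then obtain K C where K: "det K = c \<and> trace C = 0 \<and> (\<forall>t\<in>I. P t = K ** matrix_exp (t *\<^sub>R C))"
    unfolding geodesic_on_SL_iff[OF assms] by (elim conjE exE) (rule that; intro conjI; assumption)
  define \<delta> where "\<delta> = (\<lambda>t. K ** matrix_exp (t *\<^sub>R C))"
  have "\<exists>K C. det K = c \<and> trace C = 0 \<and> (\<forall>t\<in>UNIV. \<delta> t = K ** matrix_exp (t *\<^sub>R C))"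
    using K by (intro exI[of _ K] exI[of _ C]) (simp add: \<delta>_def)
  then have "geodesic_on (SL c) trace_metric UNIV \<delta>"
    unfolding geodesic_on_SL_iff[OF assms] by simp
  moreover have "\<forall>t\<in>I. \<delta> t = P t"
    using K by (simp add: \<delta>_def)
  moreover have "geodesic_on (SL c) trace_metric J \<delta> \<and> I \<subseteq> J \<and> (\<forall>t\<in>I. \<delta> t = P t) \<longrightarrow> J = I" for J
    using max unfolding maximal_geodesic_def by (elim conjE allE[of _ J] allE[of _ \<delta>])
  ultimately have "I = UNIV"
    by blast
  then show "I = UNIV \<and> (\<exists>K C. det K = c \<and> trace C = 0 \<and> (\<forall>t. P t = K ** matrix_exp (t *\<^sub>R C)))"
    using K by (intro conjI exI[of _ K] exI[of _ C]) simp_all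
next
  assume *: "I = UNIV \<and> (\<exists>K C. det K = c \<and> trace C = 0 \<and> (\<forall>t. P t = K ** matrix_exp (t *\<^sub>R C)))"
  then have "geodesic_on (SL c) trace_metric I P"
    unfolding geodesic_on_SL_iff[OF assms] by simp
  then show "maximal_geodesic (SL c) trace_metric I P"
    using * unfolding maximal_geodesic_def by (simp add: top.extremum_unique)
qed

theorem theorem4p1:
  "semi_riemannian_manifold (GL :: (real^'n^'n) set) trace_metric \<and>
   (GL :: (real^'n^'n) set) = (\<Union>c\<in>-{0}. SL c) \<and>
   foliation (GL :: (real^'n^'n) set) (CARD('n)\<^sup>2 - 1) (SL ` (-{0})) \<and>
   (\<forall>c\<noteq>0.
      totally_geodesic GL trace_metric (SL c :: (real^'n^'n) set) \<and>
      semi_riemannian_hypersurface GL trace_metric (SL c :: (real^'n^'n) set) \<and>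
      einstein (SL c :: (real^'n^'n) set) trace_metric \<and>
      symmetric_space (SL c :: (real^'n^'n) set) trace_metric \<and>
      geodesically_complete (SL c :: (real^'n^'n) set) trace_metric \<and>
      has_signature (SL c :: (real^'n^'n) set) trace_metric
        (CARD('n) * (CARD('n) + 1) div 2 - 1, CARD('n) * (CARD('n) - 1) div 2) \<and>
      (\<forall>A \<in> (SL c :: (real^'n^'n) set).
         scalar_curvature (SL c) trace_metric A =
           - ((real CARD('n) - 1) * real CARD('n) * (real CARD('n) + 1) / 2))) \<and>
   (\<forall>c\<noteq>0. \<forall>d\<noteq>0.
      isometric (SL c :: (real^'n^'n) set) trace_metric (SL d :: (real^'n^'n) set) trace_metric) \<and>
   (\<forall>c\<noteq>0. \<forall>I. \<forall>P :: real \<Rightarrow> real^'n^'n.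
      maximal_geodesic (SL c) trace_metric I P \<longleftrightarrow>
        I = UNIV \<and>
        (\<exists>K C. det K = c \<and> trace C = 0 \<and> (\<forall>t. P t = K ** matrix_exp (t *\<^sub>R C))))"
proof (intro conjI allI impI ballI)
  show "geodesically_complete (SL c :: (real^'n^'n) set) trace_metric" if "c \<noteq> 0" for c
    unfolding geodesically_complete_def maximal_geodesic_SL_iff[OF that] by blast
qed (rule semi_riemannian_manifold_GL GL_eq_Union_SL foliation_SL totally_geodesic_SL
    semi_riemannian_hypersurface_SL einstein_SL symmetric_space_SL has_signature_SL scalar_curvature_SL
    isometric_SL maximal_geodesic_SL_iff; assumption)+

end
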